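(* Let $a<b$ be real numbers, $d\ge 1$ an integer, $1<p<\infty$ and $0<\alpha<1$. Let $E$ be a weakly closed subset of $W^{1,p}=W^{1,p}(a,b;\mathbb{R}^d)$, let $L:(\mathbb{R}^d)^4\times[a,b]\to\mathbb{R}$ be of class $C^1$, and consider the functional $$\mathcal{L}:E\to\mathbb{R},\qquad \mathcal{L}(u)=\int_a^b L\big(u(t),I^{\alpha}_{-}[u](t),\dot u(t),{}_{c}D^{\alpha}_{-}[u](t),t\big)\,dt .$$ Assume that - $L$ is regular; - $\mathcal{L}$ is coercive on $E$; - for every $t\in[a,b]$, the function $L(\cdot,t)$ is convex on $(\mathbb{R}^d)^4$. Then there exists a minimizer for $\mathcal{L}$, i.e. there is $\bar u\in E$ with $\mathcal{L}(\bar u)\le \mathcal{L}(u)$ for all $u\in E$.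
   Context: $L^r=L^r(a,b;\mathbb{R}^d)$ and $W^{1,r}=W^{1,r}(a,b;\mathbb{R}^d)$ are the usual Lebesgue and Sobolev spaces with their usual norms (for scalar-valued functions, the notation $L^r$ means $L^r(a,b;\mathbb{R})$). Elements of $W^{1,p}$ are identified with their continuous representatives, and $\dot u$ denotes the derivative of $u$. $p'$ is the conjugate exponent of $p$, $1/p+1/p'=1$. $\partial_i L$ is the partial derivative (gradient) of $L$ with respect to its $i$th argument. For $\beta>0$ and $f\in L^1$, the left Riemann--Liouville fractional integral is $I^{\beta}_{-}[f](t)=\frac{1}{\Gamma(\beta)}\int_a^t (t-y)^{\beta-1}f(y)\,dy$ (defined for a.e. $t\in(a,b)$), where $\Gamma$ is the Euler Gamma function. For $0<\alpha<1$ and $f\in W^{1,1}$, the left Caputo fractional derivative is ${}_{c}D^{\alpha}_{-}[f]=I^{1-\alpha}_{-}[\dot f]$ (defined a.e. on $(a,b)$). $L$ is called regular if for every $u\in W^{1,p}$ the following functions of $t$, all evaluated at $(u,I^{\alpha}_{-}[u],\dot u,{}_{c}D^{\alpha}_{-}[u],t)$, satisfy: $L\in L^1$, $\partial_1L\in L^1$, $\partial_2L\in L^{p'}$, $\partial_3L\in L^{p'}$, $\partial_4L\in L^{p'}$. $\mathcal{L}$ is called coercive on $E$ if $\mathcal{L}(u)\to+\infty$ as $\|u\|_{W^{1,p}}\to\infty$ with $u\in E$. *)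

theory Defs
  imports "HOL-Analysis.Analysis"
begin

text \<open>
  Everything lives on a bounded open interval \<open>(a, b)\<close> with Lebesgue measure. Functions on the
  interval are total functions on \<open>\<real>\<close>.
\<close>

definition Lp :: "real \<Rightarrow> real \<Rightarrow> real \<Rightarrow> (real \<Rightarrow> 'v::euclidean_space) set" where
  "Lp a b r = {f. f \<in> borel_measurable (lebesgue_on {a<..<b}) \<and>
                  integrable (lebesgue_on {a<..<b}) (\<lambda>t. norm (f t) powr r)}"

definition Lp_norm :: "real \<Rightarrow> real \<Rightarrow> real \<Rightarrow> (real \<Rightarrow> 'v::euclidean_space) \<Rightarrow> real" where
  "Lp_norm a b r f = (LINT t|lebesgue_on {a<..<b}. norm (f t) powr r) powr (1 / r)"

definition test_functions :: "real \<Rightarrow> real \<Rightarrow> (real \<Rightarrow> real) set" where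
  "test_functions a b = {\<phi>. \<phi> C1_differentiable_on UNIV \<and>
     (\<exists>K. compact K \<and> K \<subseteq> {a<..<b} \<and> (\<forall>t. t \<notin> K \<longrightarrow> \<phi> t = 0))}"

definition is_weak_deriv ::
  "real \<Rightarrow> real \<Rightarrow> (real \<Rightarrow> 'v::euclidean_space) \<Rightarrow> (real \<Rightarrow> 'v) \<Rightarrow> bool" where
  "is_weak_deriv a b u g \<longleftrightarrow> (\<forall>\<phi>\<in>test_functions a b.
     (LINT t|lebesgue_on {a<..<b}. deriv \<phi> t *\<^sub>R u t) =
     - (LINT t|lebesgue_on {a<..<b}. \<phi> t *\<^sub>R g t))"

text \<open>
  An element of \<open>W\<^sup>1\<^sup>,\<^sup>r(a, b)\<close> is represented by its continuous representative on \<open>[a, b]\<close>; the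
  irrelevant values outside \<open>[a, b]\<close> are normalised to \<open>0\<close>, so that elements of the Sobolev space
  correspond one-to-one to elements of this set.
\<close>

definition W1p :: "real \<Rightarrow> real \<Rightarrow> real \<Rightarrow> (real \<Rightarrow> 'v::euclidean_space) set" where
  "W1p a b r = {u. continuous_on {a..b} u \<and> (\<forall>t. t \<notin> {a..b} \<longrightarrow> u t = 0) \<and> u \<in> Lp a b r \<and>
                   (\<exists>g\<in>Lp a b r. is_weak_deriv a b u g)}"

text \<open>
  The weak derivative is unique only up to null sets, so one version of it is selected. It is
  sought in \<open>L\<^sup>1\<close> (which contains \<open>L\<^sup>r\<close>) so that it does not depend on \<open>r\<close>.
\<close>

definition weak_deriv ::
  "real \<Rightarrow> real \<Rightarrow> (real \<Rightarrow> 'v::euclidean_space) \<Rightarrow> (real \<Rightarrow> 'v)" where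
  "weak_deriv a b u = (SOME g. g \<in> Lp a b 1 \<and> is_weak_deriv a b u g)"

definition W1p_norm :: "real \<Rightarrow> real \<Rightarrow> real \<Rightarrow> (real \<Rightarrow> 'v::euclidean_space) \<Rightarrow> real" where
  "W1p_norm a b r u = Lp_norm a b r u + Lp_norm a b r (weak_deriv a b u)"

definition W1p_dual ::
  "real \<Rightarrow> real \<Rightarrow> real \<Rightarrow> ((real \<Rightarrow> 'v::euclidean_space) \<Rightarrow> real) set" where
  "W1p_dual a b r = {\<Phi>.
     (\<forall>u\<in>W1p a b r. \<forall>v\<in>W1p a b r. \<Phi> (\<lambda>t. u t + v t) = \<Phi> u + \<Phi> v) \<and>
     (\<forall>c. \<forall>u\<in>W1p a b r. \<Phi> (\<lambda>t. c *\<^sub>R u t) = c * \<Phi> u) \<and>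
     (\<exists>C. \<forall>u\<in>W1p a b r. \<bar>\<Phi> u\<bar> \<le> C * W1p_norm a b r u)}"

definition W1p_weak_topology ::
  "real \<Rightarrow> real \<Rightarrow> real \<Rightarrow> (real \<Rightarrow> 'v::euclidean_space) topology" where
  "W1p_weak_topology a b r = topology_generated_by
     {{u \<in> W1p a b r. \<Phi> u \<in> U} | \<Phi> U. \<Phi> \<in> W1p_dual a b r \<and> open U}"

definition RL_integral ::
  "real \<Rightarrow> real \<Rightarrow> (real \<Rightarrow> 'v::euclidean_space) \<Rightarrow> real \<Rightarrow> 'v" where
  "RL_integral a \<beta> f t =
     (1 / Gamma \<beta>) *\<^sub>R (LINT y|lebesgue_on {a<..<t}. (t - y) powr (\<beta> - 1) *\<^sub>R f y)"

definition caputo ::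
  "real \<Rightarrow> real \<Rightarrow> real \<Rightarrow> (real \<Rightarrow> 'v::euclidean_space) \<Rightarrow> real \<Rightarrow> 'v" where
  "caputo a b \<alpha> u = RL_integral a (1 - \<alpha>) (weak_deriv a b u)"

text \<open>
  Class \<open>C\<^sup>1\<close> on a set \<open>S\<close>; meant for sets such as \<open>\<real>\<^sup>n \<times> [a, b]\<close>, where derivatives within \<open>S\<close> are
  unique (one-sided in \<open>t\<close> at the end points).
\<close>

definition C1_on ::
  "'x::real_normed_vector set \<Rightarrow> ('x \<Rightarrow> 'y::real_normed_vector) \<Rightarrow> bool" where
  "C1_on S f \<longleftrightarrow> (\<exists>f' :: 'x \<Rightarrow> 'x \<Rightarrow>\<^sub>L 'y.
     (\<forall>x\<in>S. (f has_derivative blinfun_apply (f' x)) (at x within S)) \<and> continuous_on S f')"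

type_synonym 'd phase = "(real ^ 'd) \<times> (real ^ 'd) \<times> (real ^ 'd) \<times> (real ^ 'd)"

definition grad :: "('v::euclidean_space \<Rightarrow> real) \<Rightarrow> 'v \<Rightarrow> 'v" where
  "grad f x = (THE D. GDERIV f x :> D)"

definition partial1 :: "('d::finite phase \<times> real \<Rightarrow> real) \<Rightarrow> 'd phase \<times> real \<Rightarrow> real ^ 'd" where
  "partial1 L = (\<lambda>((x1, x2, x3, x4), t). grad (\<lambda>x. L ((x, x2, x3, x4), t)) x1)"

definition partial2 :: "('d::finite phase \<times> real \<Rightarrow> real) \<Rightarrow> 'd phase \<times> real \<Rightarrow> real ^ 'd" where
  "partial2 L = (\<lambda>((x1, x2, x3, x4), t). grad (\<lambda>x. L ((x1, x, x3, x4), t)) x2)"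

definition partial3 :: "('d::finite phase \<times> real \<Rightarrow> real) \<Rightarrow> 'd phase \<times> real \<Rightarrow> real ^ 'd" where
  "partial3 L = (\<lambda>((x1, x2, x3, x4), t). grad (\<lambda>x. L ((x1, x2, x, x4), t)) x3)"

definition partial4 :: "('d::finite phase \<times> real \<Rightarrow> real) \<Rightarrow> 'd phase \<times> real \<Rightarrow> real ^ 'd" where
  "partial4 L = (\<lambda>((x1, x2, x3, x4), t). grad (\<lambda>x. L ((x1, x2, x3, x), t)) x4)"

definition lagr_arg ::
  "real \<Rightarrow> real \<Rightarrow> real \<Rightarrow> (real \<Rightarrow> real ^ 'd::finite) \<Rightarrow> real \<Rightarrow> 'd phase \<times> real" where
  "lagr_arg a b \<alpha> u t =
     ((u t, RL_integral a \<alpha> u t, weak_deriv a b u t, caputo a b \<alpha> u t), t)"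

definition regular ::
  "real \<Rightarrow> real \<Rightarrow> real \<Rightarrow> real \<Rightarrow> ('d::finite phase \<times> real \<Rightarrow> real) \<Rightarrow> bool" where
  "regular a b p \<alpha> L \<longleftrightarrow> (let p' = p / (p - 1) in
     \<forall>u\<in>W1p a b p.
       (\<lambda>t. L (lagr_arg a b \<alpha> u t)) \<in> Lp a b 1 \<and>
       (\<lambda>t. partial1 L (lagr_arg a b \<alpha> u t)) \<in> Lp a b 1 \<and>
       (\<lambda>t. partial2 L (lagr_arg a b \<alpha> u t)) \<in> Lp a b p' \<and>
       (\<lambda>t. partial3 L (lagr_arg a b \<alpha> u t)) \<in> Lp a b p' \<and>
       (\<lambda>t. partial4 L (lagr_arg a b \<alpha> u t)) \<in> Lp a b p')"

definition action ::
  "real \<Rightarrow> real \<Rightarrow> real \<Rightarrow> ('d::finite phase \<times> real \<Rightarrow> real) \<Rightarrow> (real \<Rightarrow> real ^ 'd) \<Rightarrow> real" where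
  "action a b \<alpha> L u = (LINT t|lebesgue_on {a<..<b}. L (lagr_arg a b \<alpha> u t))"

definition coercive_on ::
  "real \<Rightarrow> real \<Rightarrow> real \<Rightarrow> (real \<Rightarrow> 'v::euclidean_space) set \<Rightarrow>
   ((real \<Rightarrow> 'v) \<Rightarrow> real) \<Rightarrow> bool" where
  "coercive_on a b p E F \<longleftrightarrow>
     filterlim F at_top (inf (filtercomap (W1p_norm a b p) at_top) (principal E))"

end

theory Submission
  imports Defs
begin

text \<open>
  The direct method, with filters in place of minimizing sequences. By coercivity the sublevel
  sets of the action in \<open>E\<close> generate a proper filter concentrated on a bounded set, and by
  Tychonoff's theorem it has a proper refinement along which every functional of the dual converges.
  No representation of the dual is needed: by uniform convexity, nearly minimal elements of the
  convex hulls of the sets of the filter form a Cauchy sequence, so completeness yields a common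
  strong limit point \<open>w\<close> of all these hulls. Closed half spaces are convex, so \<open>w\<close> is the weak limit of
  the filter and lies in \<open>E\<close>. Sublevel sets of the action are convex too, and they are strongly closed
  because convexity and regularity bound the action from below by its tangent at \<open>w\<close>; hence \<open>w\<close> is
  a minimizer. Hulls under midpoints alone suffice throughout.
\<close>

section \<open>Uniform convexity\<close>

text \<open>\<open>E\<close> is closed for a topology given by a subbase, and filters match this
  directly; sequences would first need metrizability or a sequential compactness theorem.
  \<open>E\<close> need not be convex, so the hulls leave it: the action is therefore studied on all
  of \<open>W1p\<close>, where regularity keeps it finite, and \<open>E\<close> returns only through
  weak closedness. No infimum of the action is formed, since boundedness below is not known
  beforehand; it is enough that \<open>w\<close> lies in the extended sublevel set of every
  \<open>u\<close> in \<open>E\<close>.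

  Sizes are measured by p-th powers of norms without the root. Convexity, Young's inequality and
  Fatou's lemma then act pointwise under the integral, at the price of a factor 2^p in the triangle
  inequality. Products of functions are split by Young's inequality with weights c and c^(1-p). The
  second weight is large when c is small, but it multiplies a quantity that tends to 0 while c is
  still fixed.\<close>

lemma norm_add_powr_le:
  fixes x y :: "'v::real_normed_vector"
  assumes "0 \<le> p"
  shows "norm (x + y) powr p \<le> 2 powr p * (norm x powr p + norm y powr p)"
proof -
  have "norm (x + y) \<le> 2 * max (norm x) (norm y)"
    using norm_triangle_ineq[of x y] by linarith
  hence "norm (x + y) powr p \<le> (2 * max (norm x) (norm y)) powr p"
    using assms by (intro powr_mono2) auto
  also have "\<dots> = 2 powr p * max (norm x) (norm y) powr p"
    by (simp add: powr_mult)
  also have "max (norm x) (norm y) powr p \<le> norm x powr p + norm y powr p"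
    by (auto simp: max_def)
  finally show ?thesis by simp
qed

text \<open>Above the threshold c the negative power x^(1-p) is at most c^(1-p). The threshold stays
  free, so that the first term can be made small before the p-th power is sent to 0.\<close>

lemma le_add_powr:
  fixes x :: real
  assumes "0 \<le> x" "0 < c" "1 < p"
  shows "x \<le> c + c powr (1 - p) * x powr p"
proof (cases "x \<le> c")
  case False
  hence "x powr (1 - p) \<le> c powr (1 - p)"
    using assms by (intro powr_mono2') auto
  hence "x powr (1 - p) * x powr p \<le> c powr (1 - p) * x powr p"
    by (intro mult_right_mono) auto
  moreover have "x powr (1 - p) * x powr p = x"
    using False assms by (simp flip: powr_add)
  ultimately show ?thesis using assms by linarith
qed (use assms in \<open>simp add: add_increasing2\<close>)

text \<open>Young's inequality with an adjustable weight, standing in for Hoelder's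
  inequality.\<close>

lemma mult_le_powr_add:
  fixes x y :: real
  assumes "0 \<le> x" "0 \<le> y" "0 < c" "1 < p"
  shows "x * y \<le> c * x powr (p / (p - 1)) + c powr (1 - p) * y powr p"
proof (cases "x = 0 \<or> y = 0")
  case False
  hence pos: "0 < x" "0 < y" using assms by auto
  \<comment> \<open>This threshold for y gives both x * z = c * x^(p/(p-1)) and x * z^(1-p) =
    c^(1-p).\<close>
  define z where "z = c * x powr (1 / (p - 1))"
  have zp: "0 < z" using pos assms by (simp add: z_def)
  have "y \<le> z + z powr (1 - p) * y powr p"
    using le_add_powr[of y z p] zp assms by simp
  hence "x * y \<le> x * (z + z powr (1 - p) * y powr p)"
    using pos by simp
  also have "\<dots> = c * (x * x powr (1 / (p - 1))) + (x * z powr (1 - p)) * y powr p"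
    by (simp add: z_def algebra_simps)
  also have "x * x powr (1 / (p - 1)) = x powr (1 + 1 / (p - 1))"
    using pos by (simp add: powr_add)
  also have "1 + 1 / (p - 1) = p / (p - 1)"
    using assms by (simp add: field_simps)
  also have "x * z powr (1 - p) = c powr (1 - p)"
  proof -
    have "1 / (p - 1) * (1 - p) = -1" using assms by (simp add: field_simps)
    thus ?thesis
      using pos assms unfolding z_def by (simp add: powr_mult powr_powr powr_minus_divide del: times_divide_eq_left)
  qed
  finally show ?thesis .
qed (use assms in auto)

text \<open>The mean value theorem on the two halves of [r, s]: the slope p * z^(p-1) is strictly
  larger on the right half because p > 1.\<close>

lemma powr_midpoint_strict:
  fixes r s p :: real
  assumes "1 < p" "0 \<le> r" "r < s"
  shows "((r + s) / 2) powr p < (r powr p + s powr p) / 2"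
proof -
  define m where "m = (r + s) / 2"
  have m: "r < m" "m < s" using assms by (auto simp: m_def)
  \<comment> \<open>The derivative is needed only at interior points, so x = 0 is allowed.\<close>
  have mvt: "\<exists>l z. x < z \<and> z < y \<and> ((\<lambda>t. t powr p) has_real_derivative l) (at z) \<and>
      y powr p - x powr p = (y - x) * l" if "0 \<le> x" "x < y" for x y :: real
  proof (rule MVT[OF that(2)])
    show "continuous_on {x..y} (\<lambda>t. t powr p)"
      using assms that by (intro continuous_intros continuous_on_powr') auto
    show "(\<lambda>t. t powr p) differentiable at t" if "x < t" "t < y" for t
      using has_real_derivative_powr[of t p] that \<open>0 \<le> x\<close> real_differentiable_def by fastforce
  qed
  have mvt': "\<exists>z. x < z \<and> z < y \<and> y powr p - x powr p = (y - x) * (p * z powr (p - 1))"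
    if xy: "0 \<le> x" "x < y" for x y :: real
  proof -
    obtain l z where z: "x < z" "z < y" and l: "((\<lambda>t. t powr p) has_real_derivative l) (at z)"
      and eq: "y powr p - x powr p = (y - x) * l"
      using mvt[OF xy] by blast
    have "((\<lambda>t. t powr p) has_real_derivative p * z powr (p - 1)) (at z)"
      using has_real_derivative_powr[of z p] z xy by simp
    hence "l = p * z powr (p - 1)" using l DERIV_unique by blast
    thus ?thesis using z eq by blast
  qed
  obtain z where z: "r < z" "z < m" "m powr p - r powr p = (m - r) * (p * z powr (p - 1))"
    using mvt'[of r m] m assms by auto
  obtain w where w: "m < w" "w < s" "s powr p - m powr p = (s - m) * (p * w powr (p - 1))"
    using mvt'[of m s] m assms by auto
  have "z powr (p - 1) < w powr (p - 1)"
    using z w assms by (intro powr_less_mono2) auto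
  hence "(m - r) * (p * z powr (p - 1)) < (m - r) * (p * w powr (p - 1))"
    using m assms by simp
  moreover have "s - m = m - r" by (simp add: m_def field_simps)
  ultimately have "m powr p - r powr p < s powr p - m powr p" using z(3) w(3) by simp
  hence "2 * m powr p < r powr p + s powr p" by simp
  thus ?thesis by (simp add: m_def)
qed

lemma powr_midpoint_le:
  fixes r s p :: real
  assumes "1 < p" "0 \<le> r" "0 \<le> s"
  shows "((r + s) / 2) powr p \<le> (r powr p + s powr p) / 2"
  using powr_midpoint_strict[of p r s] powr_midpoint_strict[of p s r] assms
  by (cases r s rule: linorder_cases) (auto simp: add.commute)

text \<open>The defect in the midpoint inequality for the convex function norm^p.\<close>

definition powr_gap :: "real \<Rightarrow> 'v::real_inner \<Rightarrow> 'v \<Rightarrow> real" where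
  "powr_gap p x y = (norm x powr p + norm y powr p) / 2 - norm ((1/2) *\<^sub>R (x + y)) powr p"

lemma norm_midpoint_powr_le:
  fixes x y :: "'v::real_inner"
  assumes "1 < p"
  shows "norm ((1/2) *\<^sub>R (x + y)) powr p \<le> ((norm x + norm y) / 2) powr p"
proof (rule powr_mono2)
  show "norm ((1/2) *\<^sub>R (x + y)) \<le> (norm x + norm y) / 2"
    using norm_triangle_ineq[of x y] by simp
qed (use assms in auto)

lemma powr_gap_nonneg:
  assumes "1 < p"
  shows "0 \<le> powr_gap p x y"
  using norm_midpoint_powr_le[OF assms, of x y] powr_midpoint_le[OF assms, of "norm x" "norm y"]
  by (simp add: powr_gap_def)

text \<open>If the norms differ, strict convexity of t^p decides; if they agree, the parallelogram
  law makes the midpoint strictly shorter.\<close>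

lemma powr_gap_pos:
  assumes "1 < p" "x \<noteq> y"
  shows "0 < powr_gap p x y"
proof (cases "norm x = norm y")
  case False
  hence "((norm x + norm y) / 2) powr p < (norm x powr p + norm y powr p) / 2"
    using powr_midpoint_strict[OF assms(1), of "norm x" "norm y"]
      powr_midpoint_strict[OF assms(1), of "norm y" "norm x"]
    by (cases "norm x" "norm y" rule: linorder_cases) (auto simp: add.commute)
  thus ?thesis using norm_midpoint_powr_le[OF assms(1), of x y] by (simp add: powr_gap_def)
next
  case True
  have "(norm (x + y))\<^sup>2 + (norm (x - y))\<^sup>2 = 2 * (norm x)\<^sup>2 + 2 * (norm y)\<^sup>2"
    by (simp add: power2_norm_eq_inner algebra_simps inner_commute)
  moreover have "0 < (norm (x - y))\<^sup>2" using assms by simp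
  moreover have "(2 * norm x)\<^sup>2 = 4 * (norm x)\<^sup>2" by (simp add: power_mult_distrib)
  ultimately have "(norm (x + y))\<^sup>2 < (2 * norm x)\<^sup>2"
    unfolding True[symmetric] by linarith
  hence "norm (x + y) < 2 * norm x"
    by (rule power2_less_imp_less) simp
  hence "norm ((1/2) *\<^sub>R (x + y)) powr p < norm x powr p"
    using assms by (intro powr_less_mono2) auto
  thus ?thesis by (simp add: powr_gap_def True)
qed

text \<open>Both sides are homogeneous of degree p, so it suffices to treat pairs with
  \<open>norm x powr p + norm y powr p = 1\<close>. Where the difference is small, the e term is
  enough. The remaining pairs form a compact set \<open>K\<close> off the diagonal, by finite
  dimension, and there the gap has a positive minimum.\<close>

lemma powr_uniform_convexity:
  fixes p e :: real
  assumes "1 < p" "0 < e"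
  obtains C where "0 < C" "\<And>x y :: 'v::euclidean_space.
    norm (x - y) powr p \<le> e * (norm x powr p + norm y powr p) + C * powr_gap p x y"
proof -
  define K where "K = {z :: 'v \<times> 'v. norm (fst z) powr p + norm (snd z) powr p = 1 \<and>
      e \<le> norm (fst z - snd z) powr p}"
  have cont: "continuous_on UNIV (\<lambda>z::'v\<times>'v. norm (fst z) powr p)"
    "continuous_on UNIV (\<lambda>z::'v\<times>'v. norm (snd z) powr p)"
    "continuous_on UNIV (\<lambda>z::'v\<times>'v. norm (fst z - snd z) powr p)"
    "continuous_on UNIV (\<lambda>z::'v\<times>'v. norm ((1/2) *\<^sub>R (fst z + snd z)) powr p)"
    by (rule continuous_on_powr'; use assms in \<open>auto intro!: continuous_intros\<close>)+
  have "closed K"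
    unfolding K_def by (intro closed_Collect_conj closed_Collect_eq closed_Collect_le
        continuous_on_add cont continuous_on_const)
  moreover have "bounded K"
  proof (rule boundedI)
    fix z assume "z \<in> K"
    hence "norm (fst z) powr p \<le> 1" "norm (snd z) powr p \<le> 1"
      using powr_ge_zero[of "norm (fst z)" p] powr_ge_zero[of "norm (snd z)" p]
      unfolding K_def mem_Collect_eq by linarith+
    moreover have "r \<le> 1" if "r powr p \<le> 1" for r :: real
      using that gr_one_powr[of r p] assms by (meson less_trans not_le zero_less_one)
    ultimately have "norm (fst z) \<le> 1" "norm (snd z) \<le> 1" by auto
    thus "norm z \<le> 2" using norm_Pair_le[of "fst z" "snd z"] by simp
  qed
  ultimately have comp: "compact K" by (simp add: compact_eq_bounded_closed)
  have contg: "continuous_on K (\<lambda>z. powr_gap p (fst z) (snd z))"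
    unfolding powr_gap_def
    by (rule continuous_on_subset[OF _ subset_UNIV])
      (intro continuous_on_diff continuous_on_divide continuous_on_add continuous_on_const cont, simp)
  obtain \<delta> where \<delta>: "0 < \<delta>" "\<And>z. z \<in> K \<Longrightarrow> \<delta> \<le> powr_gap p (fst z) (snd z)"
  proof (cases "K = {}")
    case True thus ?thesis using that[of 1] by auto
  next
    case False
    obtain z0 where z0: "z0 \<in> K" "\<And>z. z \<in> K \<Longrightarrow> powr_gap p (fst z0) (snd z0) \<le> powr_gap p (fst z) (snd z)"
      using continuous_attains_inf[OF comp False contg] by blast
    have "fst z0 \<noteq> snd z0" using z0(1) assms by (auto simp: K_def)
    thus ?thesis using that[of "powr_gap p (fst z0) (snd z0)"] powr_gap_pos[OF assms(1)] z0(2) by blast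
  qed
  \<comment> \<open>On the sphere the left side is at most 2^p, so a gap of at least \<delta> pays
    for all of it.\<close>
  define C where "C = 2 powr p / \<delta>"
  have Cpos: "0 < C" using \<delta> by (simp add: C_def)
  have "norm (x - y) powr p \<le> e * (norm x powr p + norm y powr p) + C * powr_gap p x y" for x y :: 'v
  proof (cases "x = 0 \<and> y = 0")
    case False
    define S where "S = norm x powr p + norm y powr p"
    have S: "0 < S" using False by (auto simp: S_def add_pos_nonneg add_nonneg_pos)
    \<comment> \<open>The scaling factor that moves the pair (x, y) to the sphere containing
      \<open>K\<close>.\<close>
    define c where "c = S powr (- 1 / p)"
    have c: "0 < c" "c powr p = 1 / S"
      unfolding c_def powr_powr using S assms by (auto simp: powr_minus_divide)
    have sc: "norm (c *\<^sub>R v) powr p = norm v powr p / S" for v :: 'v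
      using c by (simp add: powr_mult)
    have gap: "powr_gap p (c *\<^sub>R x) (c *\<^sub>R y) = powr_gap p x y / S"
    proof -
      have "(1/2) *\<^sub>R (c *\<^sub>R x + c *\<^sub>R y) = c *\<^sub>R ((1/2) *\<^sub>R (x + y))"
        by (simp add: algebra_simps)
      thus ?thesis unfolding powr_gap_def by (simp only: sc) (simp add: diff_divide_distrib add_divide_distrib)
    qed
    have diff: "norm (c *\<^sub>R x - c *\<^sub>R y) powr p = norm (x - y) powr p / S"
      using sc[of "x - y"] by (simp add: algebra_simps)
    have sum1: "norm (c *\<^sub>R x) powr p + norm (c *\<^sub>R y) powr p = 1"
      unfolding sc using S by (simp add: S_def flip: add_divide_distrib)
    have "norm (c *\<^sub>R x - c *\<^sub>R y) powr p \<le> e + C * powr_gap p (c *\<^sub>R x) (c *\<^sub>R y)"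
    proof (cases "e \<le> norm (c *\<^sub>R x - c *\<^sub>R y) powr p")
      case True
      hence "\<delta> \<le> powr_gap p (c *\<^sub>R x) (c *\<^sub>R y)"
        using \<delta>(2)[of "(c *\<^sub>R x, c *\<^sub>R y)"] sum1 by (simp add: K_def)
      hence "2 powr p \<le> C * powr_gap p (c *\<^sub>R x) (c *\<^sub>R y)"
        using \<delta>(1) by (simp add: C_def field_simps)
      moreover have "norm (c *\<^sub>R x - c *\<^sub>R y) powr p \<le> 2 powr p"
        using norm_add_powr_le[of p "c *\<^sub>R x" "- (c *\<^sub>R y)"] sum1 assms by simp
      ultimately show ?thesis using assms by linarith
    next
      case False
      have "0 \<le> C * powr_gap p (c *\<^sub>R x) (c *\<^sub>R y)"
        using Cpos powr_gap_nonneg[OF assms(1), of "c *\<^sub>R x" "c *\<^sub>R y"] by simp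
      with False show ?thesis by linarith
    qed
    hence "norm (x - y) powr p / S \<le> (e * S + C * powr_gap p x y) / S"
      unfolding gap diff using S by (simp add: field_simps)
    thus ?thesis using S by (simp add: divide_le_cancel S_def[symmetric])
  qed (simp add: powr_gap_def)
  thus ?thesis using that[OF Cpos] by blast
qed

section \<open>The spaces \<open>L\<^sup>p\<close>\<close>

abbreviation lint :: "real \<Rightarrow> real \<Rightarrow> real measure" where
  "lint a b \<equiv> lebesgue_on {a<..<b}"

definition powr_int :: "real \<Rightarrow> real \<Rightarrow> real \<Rightarrow> (real \<Rightarrow> 'v::euclidean_space) \<Rightarrow> real" where
  "powr_int a b p f = (LINT t|lint a b. norm (f t) powr p)"

lemma finite_measure_lint: "finite_measure (lint a b)"
  by (rule finite_measure_lebesgue_on) (rule lmeasurable_interval)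

lemma measure_lint: "a \<le> b \<Longrightarrow> measure (lint a b) (space (lint a b)) = b - a"
  by (simp add: measure_restrict_space)

lemma integral_const_lint: "a \<le> b \<Longrightarrow> (LINT t|lint a b. c) = c * (b - a :: real)"
  using measure_lint[of a b] by simp

lemma integrable_const_lint [simp]: "integrable (lint a b) (\<lambda>t. c)"
  by (rule finite_measure.integrable_const[OF finite_measure_lint])

lemma powr_int_nonneg: "0 \<le> powr_int a b p f"
  by (simp add: powr_int_def integral_nonneg_AE)

lemma powr_int_cong_AE:
  assumes "f \<in> borel_measurable (lint a b)" "g \<in> borel_measurable (lint a b)"
    and "AE t in lint a b. f t = g t"
  shows "powr_int a b p f = powr_int a b p g"
  unfolding powr_int_def
proof (rule integral_cong_AE)
  show "AE t in lint a b. norm (f t) powr p = norm (g t) powr p"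
    using assms(3) by eventually_elim simp
qed (use assms in measurable)

lemma Lp_measurable: "f \<in> Lp a b p \<Longrightarrow> f \<in> borel_measurable (lint a b)"
  by (simp add: Lp_def)

lemma Lp_powr_integrable: "f \<in> Lp a b p \<Longrightarrow> integrable (lint a b) (\<lambda>t. norm (f t) powr p)"
  by (simp add: Lp_def)

lemma Lp_1_iff: "f \<in> Lp a b 1 \<longleftrightarrow> integrable (lint a b) f"
proof -
  have "integrable (lint a b) (\<lambda>t. norm (f t)) \<longleftrightarrow> integrable (lint a b) f"
    if "f \<in> borel_measurable (lint a b)"
    using that integrable_norm_iff by blast
  thus ?thesis by (auto simp: Lp_def)
qed

lemma Lp_scaleR:
  assumes "f \<in> Lp a b p"
  shows "(\<lambda>t. c *\<^sub>R f t) \<in> Lp a b p"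
  using assms by (auto simp: Lp_def powr_mult)

lemma Lp_add:
  assumes "f \<in> Lp a b p" "g \<in> Lp a b p" "0 \<le> p"
  shows "(\<lambda>t. f t + g t) \<in> Lp a b p"
    "powr_int a b p (\<lambda>t. f t + g t) \<le> 2 powr p * (powr_int a b p f + powr_int a b p g)"
proof -
  note [measurable] = Lp_measurable[OF assms(1)] Lp_measurable[OF assms(2)]
  have int: "integrable (lint a b) (\<lambda>t. 2 powr p * (norm (f t) powr p + norm (g t) powr p))"
    using assms Lp_powr_integrable by (intro integrable_mult_right Bochner_Integration.integrable_add) auto
  have int': "integrable (lint a b) (\<lambda>t. norm (f t + g t) powr p)"
    by (rule Bochner_Integration.integrable_bound[OF int])
      (auto intro!: AE_I2 norm_add_powr_le assms)
  thus "(\<lambda>t. f t + g t) \<in> Lp a b p" by (simp add: Lp_def)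
  have "powr_int a b p (\<lambda>t. f t + g t)
      \<le> (LINT t|lint a b. 2 powr p * (norm (f t) powr p + norm (g t) powr p))"
    unfolding powr_int_def by (intro integral_mono int int' norm_add_powr_le assms)
  also have "\<dots> = 2 powr p * (powr_int a b p f + powr_int a b p g)"
    using Lp_powr_integrable[OF assms(1)] Lp_powr_integrable[OF assms(2)] unfolding powr_int_def by simp
  finally show "powr_int a b p (\<lambda>t. f t + g t) \<le> 2 powr p * (powr_int a b p f + powr_int a b p g)" .
qed

lemma Lp_uminus:
  assumes "f \<in> Lp a b p"
  shows "(\<lambda>t. - f t) \<in> Lp a b p" "powr_int a b p (\<lambda>t. - f t) = powr_int a b p f"
  using assms by (auto simp: Lp_def powr_int_def)

lemma Lp_diff:
  assumes "f \<in> Lp a b p" "g \<in> Lp a b p" "0 \<le> p"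
  shows "(\<lambda>t. f t - g t) \<in> Lp a b p"
    "powr_int a b p (\<lambda>t. f t - g t) \<le> 2 powr p * (powr_int a b p f + powr_int a b p g)"
  using Lp_add[OF assms(1) Lp_uminus(1)[OF assms(2)] assms(3)] Lp_uminus[OF assms(2)] by auto

lemma powr_int_triangle:
  assumes "f \<in> Lp a b p" "g \<in> Lp a b p" "h \<in> Lp a b p" "0 \<le> p"
  shows "powr_int a b p (\<lambda>t. f t - h t)
    \<le> 2 powr p * (powr_int a b p (\<lambda>t. f t - g t) + powr_int a b p (\<lambda>t. g t - h t))"
  using Lp_add(2)[OF Lp_diff(1)[OF assms(1,2,4)] Lp_diff(1)[OF assms(2,3,4)] assms(4)] by simp

lemma Lp_integrable:
  assumes "f \<in> Lp a b p" "1 < p"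
  shows "integrable (lint a b) f"
    "a \<le> b \<Longrightarrow> 0 < c \<Longrightarrow> (LINT t|lint a b. norm (f t)) \<le> c * (b - a) + c powr (1 - p) * powr_int a b p f"
proof -
  note [measurable] = Lp_measurable[OF assms(1)]
  have int: "integrable (lint a b) (\<lambda>t. c + c powr (1 - p) * norm (f t) powr p)" for c
    using Lp_powr_integrable[OF assms(1)] by simp
  show int': "integrable (lint a b) f"
    using le_add_powr[of _ 1 p] assms
    by (intro Bochner_Integration.integrable_bound[OF int[of 1]]) (auto intro!: AE_I2)
  assume "a \<le> b" "0 < c"
  have "(LINT t|lint a b. norm (f t)) \<le> (LINT t|lint a b. c + c powr (1 - p) * norm (f t) powr p)"
    using int int' assms \<open>0 < c\<close> by (intro integral_mono integrable_norm le_add_powr) auto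
  also have "\<dots> = (LINT t|lint a b. c) + (LINT t|lint a b. c powr (1 - p) * norm (f t) powr p)"
    using Lp_powr_integrable[OF assms(1)] by (intro Bochner_Integration.integral_add) auto
  also have "\<dots> = c * (b - a) + c powr (1 - p) * powr_int a b p f"
    using integral_const_lint[OF \<open>a \<le> b\<close>] by (simp add: powr_int_def)
  finally show "(LINT t|lint a b. norm (f t)) \<le> c * (b - a) + c powr (1 - p) * powr_int a b p f" .
qed

text \<open>The continuous embedding of L^p into L^1 in epsilon-delta form.\<close>

lemma powr_int_imp_L1_small:
  assumes "1 < p" "a < b" "0 < e"
  obtains \<delta> where "0 < \<delta>"
    "\<And>f :: real \<Rightarrow> 'v::euclidean_space. f \<in> Lp a b p \<Longrightarrow> powr_int a b p f < \<delta> \<Longrightarrow> (LINT t|lint a b. norm (f t)) < e"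
proof -
  \<comment> \<open>With this c the length term c * (b - a) takes half of e; \<delta> is chosen so
    that the p-th power term takes the other half.\<close>
  define c where "c = e / (2 * (b - a))"
  have c: "0 < c" "c * (b - a) = e / 2" using assms by (auto simp: c_def divide_simps)
  define \<delta> where "\<delta> = e / 2 / c powr (1 - p)"
  have \<delta>: "0 < \<delta>" "c powr (1 - p) * \<delta> = e / 2" using assms c(1) by (auto simp: \<delta>_def)
  show ?thesis
  proof (rule that[OF \<delta>(1)])
    fix f :: "real \<Rightarrow> 'v" assume f: "f \<in> Lp a b p" "powr_int a b p f < \<delta>"
    have "c powr (1 - p) * powr_int a b p f < c powr (1 - p) * \<delta>"
      using f(2) c(1) by simp
    thus "(LINT t|lint a b. norm (f t)) < e"
      using Lp_integrable(2)[OF f(1) assms(1) _ c(1)] c(2) \<delta>(2) assms by simp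
  qed
qed

lemma powr_int_imp_L1_tendsto:
  assumes "1 < p" "a < b" "\<And>n. f n \<in> Lp a b p" "(\<lambda>n. powr_int a b p (f n)) \<longlonglongrightarrow> 0"
  shows "(\<lambda>n. LINT t|lint a b. norm (f n t)) \<longlonglongrightarrow> 0"
proof (rule LIMSEQ_I)
  fix e :: real assume "0 < e"
  then obtain \<delta> where \<delta>: "0 < \<delta>" "\<And>n. powr_int a b p (f n) < \<delta> \<Longrightarrow> (LINT t|lint a b. norm (f n t)) < e"
    using powr_int_imp_L1_small[OF assms(1,2)] assms(3) by metis
  obtain n0 where "\<forall>n\<ge>n0. norm (powr_int a b p (f n) - 0) < \<delta>"
    using LIMSEQ_D[OF assms(4) \<delta>(1)] by blast
  hence "\<forall>n\<ge>n0. (LINT t|lint a b. norm (f n t)) < e" using \<delta>(2) by auto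
  moreover have "0 \<le> (LINT t|lint a b. norm (f n t))" for n by (simp add: integral_nonneg_AE)
  ultimately show "\<exists>n0. \<forall>n\<ge>n0. norm ((LINT t|lint a b. norm (f n t)) - 0) < e" by auto
qed

text \<open>The pointwise inequality holds with one C for all vectors, so it can be integrated as it
  stands.\<close>

lemma powr_int_uniform_convexity:
  assumes "1 < p" "0 < e"
  obtains C where "0 < C" "\<And>f g :: real \<Rightarrow> 'v::euclidean_space. f \<in> Lp a b p \<Longrightarrow> g \<in> Lp a b p \<Longrightarrow>
    powr_int a b p (\<lambda>t. f t - g t) \<le> e * (powr_int a b p f + powr_int a b p g) +
      C * ((powr_int a b p f + powr_int a b p g) / 2 - powr_int a b p (\<lambda>t. (1/2) *\<^sub>R (f t + g t)))"
proof -
  obtain C where C: "0 < C" "\<And>x y :: 'v.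
    norm (x - y) powr p \<le> e * (norm x powr p + norm y powr p) + C * powr_gap p x y"
    using powr_uniform_convexity[OF assms] by metis
  show ?thesis
  proof (rule that[OF C(1)])
    fix f g :: "real \<Rightarrow> 'v" assume fg: "f \<in> Lp a b p" "g \<in> Lp a b p"
    note int = Lp_powr_integrable[OF fg(1)] Lp_powr_integrable[OF fg(2)]
      Lp_powr_integrable[OF Lp_scaleR[OF Lp_add(1)[OF fg]], of "1/2"]
      Lp_powr_integrable[OF Lp_diff(1)[OF fg]]
    have p: "0 \<le> p" using assms by simp
    have "powr_int a b p (\<lambda>t. f t - g t) \<le>
      (LINT t|lint a b. e * (norm (f t) powr p + norm (g t) powr p) + C * powr_gap p (f t) (g t))"
      unfolding powr_int_def using int p
      by (intro integral_mono C(2)) (auto simp: powr_gap_def simp del: norm_scaleR)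
    also have "\<dots> = e * (powr_int a b p f + powr_int a b p g) +
      C * ((powr_int a b p f + powr_int a b p g) / 2 - powr_int a b p (\<lambda>t. (1/2) *\<^sub>R (f t + g t)))"
      unfolding powr_int_def powr_gap_def using int p by (simp del: norm_scaleR)
    finally show "powr_int a b p (\<lambda>t. f t - g t) \<le> e * (powr_int a b p f + powr_int a b p g) +
      C * ((powr_int a b p f + powr_int a b p g) / 2 - powr_int a b p (\<lambda>t. (1/2) *\<^sub>R (f t + g t)))" .
  qed
qed

text \<open>Riesz-Fischer by way of L^1: a Cauchy sequence in L^p is Cauchy in L^1, hence has a
  subsequence converging almost everywhere, and Fatou's lemma carries the p-th power estimate over
  to the limit.\<close>

proposition Lp_complete:
  fixes f :: "nat \<Rightarrow> real \<Rightarrow> 'v::euclidean_space"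
  assumes "1 < p" "a < b" and f: "\<And>n. f n \<in> Lp a b p"
    and Cauchy: "\<And>e. 0 < e \<Longrightarrow> \<exists>n0. \<forall>m\<ge>n0. \<forall>n\<ge>n0. powr_int a b p (\<lambda>t. f m t - f n t) < e"
  obtains g where "g \<in> Lp a b p" "(\<lambda>n. powr_int a b p (\<lambda>t. f n t - g t)) \<longlonglongrightarrow> 0"
proof -
  have p: "0 \<le> p" using assms by simp
  note [measurable] = Lp_measurable[OF f]
  have L1: "\<exists>n0. \<forall>m\<ge>n0. \<forall>n\<ge>n0. (LINT t|lint a b. norm (f m t - f n t)) < e" if "0 < e" for e
  proof -
    obtain \<delta> where \<delta>: "0 < \<delta>"
      "\<And>h :: real \<Rightarrow> 'v. h \<in> Lp a b p \<Longrightarrow> powr_int a b p h < \<delta> \<Longrightarrow> (LINT t|lint a b. norm (h t)) < e"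
      using powr_int_imp_L1_small[OF assms(1,2) \<open>0 < e\<close>] by metis
    obtain n0 where n0: "\<forall>m\<ge>n0. \<forall>n\<ge>n0. powr_int a b p (\<lambda>t. f m t - f n t) < \<delta>"
      using Cauchy[OF \<delta>(1)] by blast
    show ?thesis
    proof (intro exI allI impI)
      fix m n assume "n0 \<le> m" "n0 \<le> n"
      thus "(LINT t|lint a b. norm (f m t - f n t)) < e"
        by (intro \<delta>(2) Lp_diff(1)[OF f f p]) (use n0 in blast)
    qed
  qed
  obtain r where r: "strict_mono r" "AE t in lint a b. Cauchy (\<lambda>i. f (r i) t)"
    by (rule cauchy_L1_AE_cauchy_subseq[of "lint a b" f, OF Lp_integrable(1)[OF f assms(1)] L1])
  define g where "g t = lim (\<lambda>i. f (r i) t)" for t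
  have g[measurable]: "g \<in> borel_measurable (lint a b)"
    unfolding g_def by (rule borel_measurable_lim_metric) measurable
  have lim: "AE t in lint a b. (\<lambda>i. f (r i) t) \<longlonglongrightarrow> g t"
    using r(2) by eventually_elim (simp add: g_def Cauchy_convergent_iff convergent_LIMSEQ_iff)
  \<comment> \<open>Here n stays fixed while Fatou's lemma is applied along the subsequence; this
    yields integrability and the distance bound at once.\<close>
  have bound: "integrable (lint a b) (\<lambda>t. norm (f n t - g t) powr p) \<and> powr_int a b p (\<lambda>t. f n t - g t) \<le> e"
    if n0: "\<forall>m\<ge>n0. \<forall>n\<ge>n0. powr_int a b p (\<lambda>t. f m t - f n t) < e" "n0 \<le> n" "0 < e" for e n n0
  proof -
    have "(\<integral>\<^sup>+ t. ennreal (norm (f n t - g t) powr p) \<partial>lint a b) =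
        (\<integral>\<^sup>+ t. liminf (\<lambda>i. ennreal (norm (f n t - f (r i) t) powr p)) \<partial>lint a b)"
    proof (rule nn_integral_cong_AE)
      show "AE t in lint a b. ennreal (norm (f n t - g t) powr p) =
          liminf (\<lambda>i. ennreal (norm (f n t - f (r i) t) powr p))"
        using lim
      proof eventually_elim
        fix t assume "(\<lambda>i. f (r i) t) \<longlonglongrightarrow> g t"
        hence "(\<lambda>i. ennreal (norm (f n t - f (r i) t) powr p)) \<longlonglongrightarrow> ennreal (norm (f n t - g t) powr p)"
          using assms(1) by (intro tendsto_ennrealI tendsto_powr' tendsto_norm tendsto_diff tendsto_const) auto
        thus "ennreal (norm (f n t - g t) powr p) = liminf (\<lambda>i. ennreal (norm (f n t - f (r i) t) powr p))"
          by (intro lim_imp_Liminf[symmetric]) auto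
      qed
    qed
    also have "\<dots> \<le> liminf (\<lambda>i. \<integral>\<^sup>+ t. ennreal (norm (f n t - f (r i) t) powr p) \<partial>lint a b)"
      by (rule nn_integral_liminf) measurable
    also have "\<dots> \<le> ennreal e"
    proof (rule Liminf_le)
      show "\<forall>\<^sub>F i in sequentially. (\<integral>\<^sup>+ t. ennreal (norm (f n t - f (r i) t) powr p) \<partial>lint a b) \<le> ennreal e"
        unfolding eventually_sequentially
      proof (intro exI allI impI)
        fix i assume "n0 \<le> i"
        hence "n0 \<le> r i" using seq_suble[OF r(1), of i] by linarith
        hence "powr_int a b p (\<lambda>t. f n t - f (r i) t) < e" using n0 by blast
        thus "(\<integral>\<^sup>+ t. ennreal (norm (f n t - f (r i) t) powr p) \<partial>lint a b) \<le> ennreal e"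
          using nn_integral_eq_integral[OF Lp_powr_integrable[OF Lp_diff(1)[OF f f p]], of n "r i"] that(3)
          by (simp add: powr_int_def ennreal_leI)
      qed
    qed simp
    finally have *: "(\<integral>\<^sup>+ t. ennreal (norm (f n t - g t) powr p) \<partial>lint a b) \<le> ennreal e" .
    have int: "integrable (lint a b) (\<lambda>t. norm (f n t - g t) powr p)"
      using le_less_trans[OF * ennreal_less_top] by (intro integrableI_bounded) auto
    have "ennreal (powr_int a b p (\<lambda>t. f n t - g t)) \<le> ennreal e"
      using * nn_integral_eq_integral[OF int] by (simp add: powr_int_def)
    thus ?thesis using int that(3) by (simp add: ennreal_le_iff)
  qed
  show ?thesis
  proof (rule that)
    obtain n0 where "\<forall>m\<ge>n0. \<forall>n\<ge>n0. powr_int a b p (\<lambda>t. f m t - f n t) < 1"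
      using Cauchy[of 1] by auto
    hence "(\<lambda>t. f n0 t - g t) \<in> Lp a b p"
      using bound[of n0 1 n0] by (simp add: Lp_def)
    from Lp_diff(1)[OF f this p, of n0] show "g \<in> Lp a b p" by simp
    show "(\<lambda>n. powr_int a b p (\<lambda>t. f n t - g t)) \<longlonglongrightarrow> 0"
    proof (rule LIMSEQ_I)
      fix e :: real assume e: "0 < e"
      obtain n0 where "\<forall>m\<ge>n0. \<forall>n\<ge>n0. powr_int a b p (\<lambda>t. f m t - f n t) < e / 2"
        using Cauchy[of "e / 2"] e by auto
      hence "\<forall>n\<ge>n0. powr_int a b p (\<lambda>t. f n t - g t) \<le> e / 2" using bound[of n0 "e/2"] e by auto
      hence "norm (powr_int a b p (\<lambda>t. f n t - g t) - 0) < e" if "n0 \<le> n" for n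
        using powr_int_nonneg[of a b p "\<lambda>t. f n t - g t"] e that by fastforce
      thus "\<exists>n0. \<forall>n\<ge>n0. norm (powr_int a b p (\<lambda>t. f n t - g t) - 0) < e" by blast
    qed
  qed
qed

section \<open>Uniqueness of weak derivatives\<close>

lemma indicator_measurable_lint [measurable]:
  "A \<in> sets borel \<Longrightarrow> indicat_real A \<in> borel_measurable (lint a b)"
  by (intro measurable_restrict_space1 borel_measurable_indicator) simp

lemma continuous_measurable_lint:
  fixes f :: "real \<Rightarrow> 'v::euclidean_space"
  assumes "continuous_on {a..b} f"
  shows "f \<in> borel_measurable (lint a b)"
  by (intro continuous_imp_measurable_on_sets_lebesgue continuous_on_subset[OF assms]) auto

lemma continuous_bounded_interval:
  fixes f :: "real \<Rightarrow> 'v::real_normed_vector"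
  assumes "continuous_on {a..b} f"
  obtains B where "0 \<le> B" "\<And>t. t \<in> {a..b} \<Longrightarrow> norm (f t) \<le> B"
proof -
  have "bounded (f ` {a..b})"
    using assms compact_continuous_image compact_imp_bounded by blast
  then obtain B where "\<forall>t\<in>{a..b}. norm (f t) \<le> B" by (auto simp: bounded_iff)
  thus ?thesis using that[of "max B 0"] by fastforce
qed

lemma integrable_bounded_lint:
  fixes f :: "real \<Rightarrow> 'v::euclidean_space"
  assumes "f \<in> borel_measurable (lint a b)" "\<And>t. t \<in> {a<..<b} \<Longrightarrow> norm (f t) \<le> B"
  shows "integrable (lint a b) f"
  by (rule finite_measure.integrable_const_bound[OF finite_measure_lint _ assms(1), of B])
    (auto intro!: AE_I2 assms(2))

lemma continuous_integrable_lint: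
  fixes f :: "real \<Rightarrow> 'v::euclidean_space"
  assumes "continuous_on {a..b} f"
  shows "integrable (lint a b) f"
  using continuous_bounded_interval[OF assms] integrable_bounded_lint[OF continuous_measurable_lint[OF assms]]
  by (metis atLeastAtMost_iff greaterThanLessThan_iff less_imp_le)

lemma integrable_scaleR_bounded:
  fixes g :: "real \<Rightarrow> 'v::euclidean_space"
  assumes g: "integrable (lint a b) g" and f: "f \<in> borel_measurable (lint a b)"
    and B: "\<And>t. t \<in> {a<..<b} \<Longrightarrow> \<bar>f t\<bar> \<le> B"
  shows "integrable (lint a b) (\<lambda>t. f t *\<^sub>R g t)"
proof (rule Bochner_Integration.integrable_bound)
  show "integrable (lint a b) (\<lambda>t. B * norm (g t))" using g by simp
  show "(\<lambda>t. f t *\<^sub>R g t) \<in> borel_measurable (lint a b)"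
    using f borel_measurable_integrable[OF g] by measurable
  show "AE t in lint a b. norm (f t *\<^sub>R g t) \<le> norm (B * norm (g t))"
  proof (rule AE_I2)
    fix t assume "t \<in> space (lint a b)"
    hence "\<bar>f t\<bar> * norm (g t) \<le> B * norm (g t)" using B by (intro mult_right_mono) auto
    thus "norm (f t *\<^sub>R g t) \<le> norm (B * norm (g t))" by simp
  qed
qed

lemma lint_integral_FTC:
  fixes F :: "real \<Rightarrow> real"
  assumes "a \<le> b" "\<And>x. (F has_real_derivative f x) (at x)" "continuous_on {a..b} f"
  shows "(LINT x|lint a b. f x) = F b - F a"
proof -
  have "(LINT x|lint a b. f x) = integral {a<..<b} f"
    by (intro lebesgue_integral_eq_integral continuous_integrable_lint assms) auto
  also have "\<dots> = integral {a..b} f" by (rule integral_open_interval_real[symmetric])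
  also have "\<dots> = F b - F a"
    using assms by (intro integral_unique fundamental_theorem_of_calculus)
      (auto simp: has_real_derivative_iff_has_vector_derivative[symmetric] intro: has_field_derivative_at_within)
  finally show ?thesis .
qed

section \<open>A C^1 step function and its hat-shaped derivative\<close>

lemma DERIV_max0_power2: "((\<lambda>x. (max 0 x)\<^sup>2) has_real_derivative 2 * max 0 x) (at (x::real))"
proof (cases x "0::real" rule: linorder_cases)
  case less
  have "((\<lambda>x. 0) has_real_derivative 2 * max 0 x) (at x)" using less by simp
  thus ?thesis
    by (rule has_field_derivative_transform_within[of _ _ _ _ "- x"])
      (use less in \<open>auto simp: dist_real_def\<close>)
next
  case greater
  have "((\<lambda>x. x\<^sup>2) has_real_derivative 2 * max 0 x) (at x)" 
    using greater by (auto intro!: derivative_eq_intros)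
  thus ?thesis
    by (rule has_field_derivative_transform_within[of _ _ _ _ x])
      (use greater in \<open>auto simp: dist_real_def\<close>)
next
  case equal
  have "(\<lambda>h. (max 0 h)\<^sup>2 / h) \<midarrow>0\<rightarrow> (0::real)"
  proof (rule Lim_null_comparison)
    show "\<forall>\<^sub>F h in at 0. norm ((max 0 h)\<^sup>2 / h) \<le> \<bar>h::real\<bar>"
      by (intro always_eventually allI) (auto simp: max_def power2_eq_square)
    show "(\<lambda>h::real. \<bar>h\<bar>) \<midarrow>0\<rightarrow> 0" using tendsto_rabs_zero[OF tendsto_ident_at] by simp
  qed
  thus ?thesis using equal by (simp add: DERIV_def)
qed

text \<open>The antiderivative of the function \<open>tent\<close> below; truncated squares give it a closed form.\<close>

definition smooth_step :: "real \<Rightarrow> real" where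
  "smooth_step x = 2 * (max 0 x)\<^sup>2 - 4 * (max 0 (x - 1/2))\<^sup>2 + 2 * (max 0 (x - 1))\<^sup>2"

text \<open>The hat function supported on [0, 1] with peak 2 at 1/2, so that its integral is
  1.\<close>

definition tent :: "real \<Rightarrow> real" where
  "tent x = 4 * max 0 x - 8 * max 0 (x - 1/2) + 4 * max 0 (x - 1)"

text \<open>Test functions are only required to be C^1, so a quadratic spline with a continuous
  derivative is smooth enough to build them.\<close>

lemma DERIV_smooth_step: "(smooth_step has_real_derivative tent x) (at x)"
proof -
  have d: "((\<lambda>x. (max 0 (x - c))\<^sup>2) has_real_derivative 2 * max 0 (x - c)) (at x)" for c
  proof -
    have "((\<lambda>x. x - c) has_real_derivative 1) (at x)" by (auto intro!: derivative_eq_intros)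
    from DERIV_chain2[OF DERIV_max0_power2 this] show ?thesis by simp
  qed
  show ?thesis unfolding smooth_step_def[abs_def] tent_def
    by (rule derivative_eq_intros d DERIV_max0_power2 refl | simp)+
qed

lemma DERIV_smooth_step_affine:
  "((\<lambda>x. smooth_step ((x - s) * m)) has_real_derivative m * tent ((x - s) * m)) (at x)"
proof -
  have "((\<lambda>x. (x - s) * m) has_real_derivative m) (at x)" by (auto intro!: derivative_eq_intros)
  from DERIV_chain2[OF DERIV_smooth_step this] show ?thesis by (simp add: mult.commute)
qed

lemma smooth_step_eq [simp]: "x \<le> 0 \<Longrightarrow> smooth_step x = 0" "1 \<le> x \<Longrightarrow> smooth_step x = 1"
  by (auto simp: smooth_step_def max_def power2_eq_square algebra_simps)

lemma smooth_step_bound: "\<bar>smooth_step x\<bar> \<le> 1"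
proof -
  consider "x \<le> 0" | "0 \<le> x" "x \<le> 1/2" | "1/2 \<le> x" "x \<le> 1" | "1 \<le> x" by linarith
  thus ?thesis
  proof cases
    case 2
    have "x\<^sup>2 \<le> (1/2)\<^sup>2" using 2 by (intro power_mono) auto
    thus ?thesis using 2 by (simp add: smooth_step_def power2_eq_square)
  next
    case 3
    have "(1 - x)\<^sup>2 \<le> (1/2)\<^sup>2" using 3 by (intro power_mono) auto
    moreover have "smooth_step x = 1 - 2 * (1 - x)\<^sup>2"
      using 3 by (simp add: smooth_step_def max_def power2_eq_square algebra_simps)
    moreover have "0 \<le> (1 - x)\<^sup>2" by simp
    ultimately show ?thesis by (simp add: power2_eq_square del: zero_le_square)
  qed auto
qed

lemma tent_nonneg: "0 \<le> tent x"
  by (auto simp: tent_def max_def)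

lemma tent_eq_0: "x \<le> 0 \<or> 1 \<le> x \<Longrightarrow> tent x = 0"
  by (auto simp: tent_def max_def)

lemma continuous_tent: "continuous_on S tent"
  unfolding tent_def[abs_def] by (intro continuous_intros)

text \<open>The kernels form a one-sided approximate identity: they are nonnegative, have mass 1 and
  live on [s, s + 1/m]. The mass is read off from \<open>smooth_step\<close>, which has risen from 0
  to 1 by the time b is reached.\<close>

lemma tent_mollify:
  fixes u :: "real \<Rightarrow> 'v::euclidean_space"
  assumes s: "a < s" "s < b" and u: "continuous_on {a..b} u"
    and m: "filterlim m at_top sequentially"
  shows "(\<lambda>n. LINT x|lint a b. (m n * tent ((x - s) * m n)) *\<^sub>R u x) \<longlonglongrightarrow> u s"
proof (rule LIMSEQ_I)
  fix e :: real assume e: "0 < e"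
  obtain d where d: "0 < d" "\<And>x. x \<in> {a..b} \<Longrightarrow> dist x s < d \<Longrightarrow> dist (u x) (u s) < e / 2"
    using u s e unfolding continuous_on_iff by (metis atLeastAtMost_iff half_gt_zero less_imp_le)
  \<comment> \<open>Beyond c the support, of length 1/m, fits into the d-neighbourhood of s and does
    not reach b.\<close>
  define c where "c = max 1 (max (1 / d + 1) (1 / (b - s) + 1))"
  have "\<forall>\<^sub>F n in sequentially. c \<le> m n" using m by (simp add: filterlim_at_top)
  then obtain n0 where n0: "\<And>n. n0 \<le> n \<Longrightarrow> c \<le> m n" by (auto simp: eventually_sequentially)
  have "norm ((LINT x|lint a b. (m n * tent ((x - s) * m n)) *\<^sub>R u x) - u s) < e" if "n0 \<le> n" for n
  proof -
    define M where "M = m n"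
    have M: "0 < M" "1 / d < M" "1 / (b - s) < M"
      using n0[OF that] by (auto simp: c_def M_def)
    have M': "1 / M < d" "1 < (b - s) * M"
      using M d(1) s by (auto simp: field_simps)
    define k where "k x = M * tent ((x - s) * M)" for x
    have contk: "continuous_on {a..b} k"
      unfolding k_def by (intro continuous_intros continuous_on_compose2[OF continuous_tent[of UNIV]]) auto
    have k0: "0 \<le> k x" for x using M tent_nonneg by (simp add: k_def)
    have "(LINT x|lint a b. k x) = smooth_step ((b - s) * M) - smooth_step ((a - s) * M)"
    proof (rule lint_integral_FTC)
      show "((\<lambda>x. smooth_step ((x - s) * M)) has_real_derivative k x) (at x)" for x
        unfolding k_def by (rule DERIV_smooth_step_affine)
    qed (use s contk in auto)
    also have "(a - s) * M \<le> 0" using s M by (simp add: mult_nonpos_nonneg)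
    hence "smooth_step ((b - s) * M) - smooth_step ((a - s) * M) = 1" using M' by simp
    finally have mass: "(LINT x|lint a b. k x) = 1" .
    have intk: "integrable (lint a b) k" by (rule continuous_integrable_lint[OF contk])
    have intku: "integrable (lint a b) (\<lambda>x. k x *\<^sub>R u x)"
      by (intro continuous_integrable_lint continuous_on_scaleR contk u)
    have bound: "norm (k x *\<^sub>R u x - k x *\<^sub>R u s) \<le> k x * (e / 2)" if x: "x \<in> {a<..<b}" for x
    proof (cases "k x = 0")
      case False
      hence "0 < (x - s) * M" "(x - s) * M < 1" using tent_eq_0[of "(x - s) * M"] by (force simp: k_def)+
      hence "0 < x - s" "x - s < 1 / M" using M by (auto simp: zero_less_mult_iff field_simps)
      hence "dist x s < d" using M' by (simp add: dist_real_def)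
      hence "norm (u x - u s) \<le> e / 2" using d(2)[of x] x by (auto simp: dist_norm)
      hence "k x * norm (u x - u s) \<le> k x * (e / 2)" using k0 by (rule mult_left_mono)
      thus ?thesis using k0[of x] by (simp flip: scaleR_diff_right)
    qed simp
    have "(LINT x|lint a b. k x *\<^sub>R u x) - u s = (LINT x|lint a b. k x *\<^sub>R u x - k x *\<^sub>R u s)"
      using intk intku mass by simp
    also have "norm \<dots> \<le> (LINT x|lint a b. k x * (e / 2))"
    proof (rule order_trans[OF integral_norm_bound integral_mono])
      show "norm (k x *\<^sub>R u x - k x *\<^sub>R u s) \<le> k x * (e / 2)" if "x \<in> space (lint a b)" for x
        using bound that by simp
    qed (use intk intku in auto)
    also have "\<dots> = e / 2" using mass by simp
    finally show ?thesis using e by (simp add: k_def M_def)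
  qed
  thus "\<exists>n0. \<forall>n\<ge>n0. norm ((LINT x|lint a b. (m n * tent ((x - s) * m n)) *\<^sub>R u x) - u s) < e" by blast
qed

text \<open>The weak identity is tested with C^1 approximations \<open>\<phi> n\<close> of the
  indicator of (s, t]. Their derivatives are differences of mollifiers at s and t, so one side tends
  to u s - u t; dominated convergence handles the other side.\<close>

proposition weak_deriv_integral:
  fixes u g :: "real \<Rightarrow> 'v::euclidean_space"
  assumes st: "a < s" "s < t" "t < b" and u: "continuous_on {a..b} u"
    and g: "integrable (lint a b) g" and wd: "is_weak_deriv a b u g"
  shows "u t - u s = (LINT x|lint a b. indicat_real {s<..t} x *\<^sub>R g x)"
proof -
  \<comment> \<open>Chosen so that t + 1/c is the midpoint of t and b; all supports then lie in the
    compact interval [s, t + 1/c] inside (a, b).\<close>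
  define c where "c = 2 / (b - t)"
  define m where "m n = c + real n" for n
  have c: "0 < c" "t + 1 / c < b" using st by (auto simp: c_def field_simps)
  have m: "0 < m n" "1 / m n \<le> 1 / c" for n
    using c by (auto simp: m_def intro!: divide_left_mono)
  have mlim: "filterlim m at_top sequentially"
    unfolding m_def by (rule filterlim_tendsto_add_at_top[OF tendsto_const filterlim_real_sequentially])
  define \<phi> where "\<phi> n x = smooth_step ((x - s) * m n) - smooth_step ((x - t) * m n)" for n x
  define \<psi> where "\<psi> n x = m n * tent ((x - s) * m n) - m n * tent ((x - t) * m n)" for n x
  have D: "(\<phi> n has_real_derivative \<psi> n x) (at x)" for n x
    unfolding \<phi>_def \<psi>_def by (intro DERIV_diff DERIV_smooth_step_affine)
  have cont\<psi>: "continuous_on S (\<psi> n)" for n S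
    unfolding \<psi>_def by (intro continuous_intros continuous_on_compose2[OF continuous_tent[of UNIV]]) auto
  have "\<phi> n \<in> test_functions a b" for n
  proof -
    have "\<phi> n x = 0" if "x \<notin> {s..t + 1 / c}" for x
    proof (cases "x < s")
      case True
      hence "(x - s) * m n \<le> 0" "(x - t) * m n \<le> 0" using m[of n] st by (auto intro!: mult_nonpos_nonneg)
      thus ?thesis by (simp add: \<phi>_def)
    next
      case False
      hence "1 / m n \<le> x - t" using that m[of n] by auto
      hence "1 \<le> (x - t) * m n" using m[of n] by (simp add: field_simps)
      moreover have "(x - t) * m n \<le> (x - s) * m n" using m[of n] st by (intro mult_right_mono) auto
      ultimately show ?thesis by (simp add: \<phi>_def)
    qed
    moreover have "\<phi> n C1_differentiable_on UNIV"
      unfolding C1_differentiable_on_def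
      using D[of n] cont\<psi>[of UNIV n] has_real_derivative_iff_has_vector_derivative by blast
    ultimately show ?thesis using st c unfolding test_functions_def
      by (auto intro!: exI[of _ "{s..t + 1 / c}"])
  qed
  moreover have "deriv (\<phi> n) = \<psi> n" for n using D DERIV_imp_deriv by blast
  ultimately have eq: "(LINT x|lint a b. \<psi> n x *\<^sub>R u x) = - (LINT x|lint a b. \<phi> n x *\<^sub>R g x)" for n
    using wd unfolding is_weak_deriv_def by metis
  have "(\<lambda>n. (LINT x|lint a b. (m n * tent ((x - s) * m n)) *\<^sub>R u x) -
      (LINT x|lint a b. (m n * tent ((x - t) * m n)) *\<^sub>R u x)) \<longlonglongrightarrow> u s - u t"
    using st by (intro tendsto_diff tent_mollify u mlim) auto
  moreover have "(LINT x|lint a b. (m n * tent ((x - s) * m n)) *\<^sub>R u x) -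
      (LINT x|lint a b. (m n * tent ((x - t) * m n)) *\<^sub>R u x) = (LINT x|lint a b. \<psi> n x *\<^sub>R u x)" for n
  proof -
    have "integrable (lint a b) (\<lambda>x. (m n * tent ((x - r) * m n)) *\<^sub>R u x)" for r
      by (intro continuous_integrable_lint continuous_intros u continuous_on_compose2[OF continuous_tent[of UNIV]]) auto
    thus ?thesis by (simp add: \<psi>_def scaleR_diff_left)
  qed
  ultimately have 1: "(\<lambda>n. LINT x|lint a b. \<phi> n x *\<^sub>R g x) \<longlonglongrightarrow> u t - u s"
    using tendsto_minus by (fastforce simp: eq)
  have meas: "\<phi> n \<in> borel_measurable (lint a b)" for n
    by (rule continuous_measurable_lint)
      (meson D DERIV_isCont continuous_at_imp_continuous_on)
  have "(\<lambda>n. LINT x|lint a b. \<phi> n x *\<^sub>R g x) \<longlonglongrightarrow> (LINT x|lint a b. indicat_real {s<..t} x *\<^sub>R g x)"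
  proof (rule integral_dominated_convergence)
    show "(\<lambda>x. indicat_real {s<..t} x *\<^sub>R g x) \<in> borel_measurable (lint a b)"
      using borel_measurable_integrable[OF g]
      by (intro borel_measurable_scaleR indicator_measurable_lint) auto
    show "(\<lambda>x. \<phi> n x *\<^sub>R g x) \<in> borel_measurable (lint a b)" for n
      using borel_measurable_integrable[OF g] meas by (intro borel_measurable_scaleR)
    show "integrable (lint a b) (\<lambda>x. 2 * norm (g x))" using g by simp
    show "AE x in lint a b. norm (\<phi> n x *\<^sub>R g x) \<le> 2 * norm (g x)" for n
    proof (rule AE_I2)
      fix x
      have "\<bar>\<phi> n x\<bar> \<le> 2"
        using smooth_step_bound[of "(x - s) * m n"] smooth_step_bound[of "(x - t) * m n"] unfolding \<phi>_def by linarith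
      thus "norm (\<phi> n x *\<^sub>R g x) \<le> 2 * norm (g x)" by (auto intro!: mult_right_mono)
    qed
    show "AE x in lint a b. (\<lambda>n. \<phi> n x *\<^sub>R g x) \<longlonglongrightarrow> indicat_real {s<..t} x *\<^sub>R g x"
    proof (rule AE_I2, rule tendsto_scaleR[OF tendsto_eventually tendsto_const])
      fix x
      \<comment> \<open>Each step rises to the right of its base point, so its limit at the base
        point itself is 0; this is why the interval is open at s and closed at t.\<close>
      have ev: "\<forall>\<^sub>F n in sequentially. smooth_step ((x - r) * m n) = (if r < x then 1 else 0)" for r
      proof (cases "r < x")
        case True
        have "\<forall>\<^sub>F n in sequentially. 1 / (x - r) \<le> m n" using mlim by (simp add: filterlim_at_top)
        thus ?thesis by eventually_elim (use True in \<open>simp add: field_simps\<close>)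
      next
        case False
        hence "(x - r) * m n \<le> 0" for n using m[of n] by (intro mult_nonpos_nonneg) auto
        thus ?thesis using False by simp
      qed
      show "\<forall>\<^sub>F n in sequentially. \<phi> n x = indicat_real {s<..t} x"
        using ev[of s] ev[of t] by eventually_elim (use st in \<open>auto simp: \<phi>_def indicator_def\<close>)
    qed
  qed
  thus ?thesis using 1 LIMSEQ_unique by blast
qed

text \<open>Lebesgue's differentiation theorem: at almost every x the value is the limit of averages
  over [x, x + h], and all of these vanish.\<close>

lemma AE_0_if_interval_integrals_0:
  fixes g :: "real \<Rightarrow> 'v::euclidean_space"
  assumes g: "integrable (lint a b) g"
    and 0: "\<And>s t. a < s \<Longrightarrow> s < t \<Longrightarrow> t < b \<Longrightarrow> (LINT x|lint a b. indicat_real {s<..t} x *\<^sub>R g x) = 0"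
  shows "AE x in lint a b. g x = 0"
proof -
  \<comment> \<open>Extension by 0, so that differentiation of integrals on the whole line
    applies.\<close>
  define G where "G x = (if x \<in> {a<..<b} then g x else 0)" for x
  have G: "integrable lebesgue G"
    unfolding G_def using g by (subst Lebesgue_Measure.integrable_restrict_UNIV) auto
  have GS: "integrable (lebesgue_on S) G" if "S \<in> sets lebesgue" for S
    using that integrable_mult_indicator[OF _ G] by (simp add: integrable_restrict_space)
  have ion: "G integrable_on cbox c d" for c d
    by (rule integrable_on_lebesgue_on[OF GS]) auto
  obtain N where N: "negligible N" "\<And>x e. x \<notin> N \<Longrightarrow> 0 < e \<Longrightarrow>
      \<exists>d>0. \<forall>h. 0 < h \<and> h < d \<longrightarrow> norm (integral (cbox x (x + h *\<^sub>R One)) G /\<^sub>R h ^ DIM(real) - G x) < e"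
    using integrable_ccontinuous_explicit[OF ion] by metis
  have int0: "integral {s..t} G = 0" if "a < s" "s < t" "t < b" for s t
  proof -
    have "integral {s..t} G = integral {s<..<t} G" by (rule integral_open_interval_real)
    also have "\<dots> = integral {s<..t} G"
      by (rule integral_spike_set) (auto intro: negligible_subset[of "{t}"])
    also have "\<dots> = (LINT x|lebesgue_on {s<..t}. G x)"
      by (rule lebesgue_integral_eq_integral[symmetric]) (auto intro: GS)
    also have "\<dots> = (LINT x|lebesgue. indicat_real {s<..t} x *\<^sub>R G x)"
      by (rule integral_restrict_space) auto
    also have "\<dots> = (LINT x|lebesgue. indicat_real {a<..<b} x *\<^sub>R (indicat_real {s<..t} x *\<^sub>R g x))"
      by (intro Bochner_Integration.integral_cong) (auto simp: G_def indicator_def)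
    also have "\<dots> = (LINT x|lint a b. indicat_real {s<..t} x *\<^sub>R g x)"
      by (rule integral_restrict_space[symmetric]) auto
    finally show ?thesis using 0[OF that] by simp
  qed
  have "g x = 0" if x: "x \<in> {a<..<b}" "x \<notin> N" for x
  proof (rule ccontr)
    assume "g x \<noteq> 0"
    hence pos: "0 < norm (G x)" using x by (simp add: G_def)
    obtain d where d: "0 < d" "\<And>h. 0 < h \<Longrightarrow> h < d \<Longrightarrow>
        norm (integral (cbox x (x + h *\<^sub>R One)) G /\<^sub>R h ^ DIM(real) - G x) < norm (G x)"
      using N(2)[OF x(2) pos] by blast
    define h where "h = min (d / 2) ((b - x) / 2)"
    have h: "0 < h" "h < d" "x + h < b" using d(1) x by (auto simp: h_def min_def field_simps)
    show False using d(2)[OF h(1,2)] int0[of x "x + h"] h x by simp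
  qed
  moreover have "AE x in lebesgue. x \<notin> N"
    using N(1) by (intro AE_not_in) (simp add: negligible_iff_null_sets)
  ultimately show ?thesis by (simp add: AE_restrict_space_iff) (auto elim: eventually_mono)
qed

text \<open>This makes the choice hidden in \<open>weak_deriv\<close> harmless. Both versions have
  the same integral over every (s, t], namely u t - u s.\<close>

corollary weak_deriv_unique:
  fixes u g h :: "real \<Rightarrow> 'v::euclidean_space"
  assumes u: "continuous_on {a..b} u"
    and g: "integrable (lint a b) g" "is_weak_deriv a b u g"
    and h: "integrable (lint a b) h" "is_weak_deriv a b u h"
  shows "AE x in lint a b. g x = h x"
proof -
  have "AE x in lint a b. g x - h x = 0"
  proof (rule AE_0_if_interval_integrals_0)
    fix s t assume st: "a < s" "s < t" "t < b"
    have int: "integrable (lint a b) (\<lambda>x. indicat_real {s<..t} x *\<^sub>R f x)"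
      if "integrable (lint a b) f" for f :: "real \<Rightarrow> 'v"
      using that by (rule integrable_scaleR_bounded[where B = 1])
        (auto intro: indicator_measurable_lint simp: indicator_le_1)
    show "(LINT x|lint a b. indicat_real {s<..t} x *\<^sub>R (g x - h x)) = 0"
      using weak_deriv_integral[OF st u g] weak_deriv_integral[OF st u h] int[OF g(1)] int[OF h(1)]
      by (simp add: scaleR_diff_right)
  qed (use g h in simp)
  thus ?thesis by simp
qed

section \<open>The Sobolev space\<close>

lemma test_functions_continuous:
  assumes "\<phi> \<in> test_functions a b"
  shows "continuous_on S \<phi>" "continuous_on S (deriv \<phi>)"
proof -
  obtain D where D: "\<And>x. (\<phi> has_vector_derivative D x) (at x)" "continuous_on UNIV D"
    using assms unfolding test_functions_def C1_differentiable_on_def by auto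
  have D': "(\<phi> has_real_derivative D x) (at x)" for x
    using D(1) by (simp add: has_real_derivative_iff_has_vector_derivative)
  show "continuous_on S \<phi>"
    using D' DERIV_isCont continuous_at_imp_continuous_on by blast
  have "deriv \<phi> = D" using D' DERIV_imp_deriv by blast
  thus "continuous_on S (deriv \<phi>)" using D(2) continuous_on_subset by blast
qed

lemma continuous_scaleR_integrable_lint:
  fixes g :: "real \<Rightarrow> 'v::euclidean_space"
  assumes f: "continuous_on {a..b} f" and g: "integrable (lint a b) g"
  shows "integrable (lint a b) (\<lambda>t. f t *\<^sub>R g t)"
proof -
  obtain B where "\<And>t. t \<in> {a..b} \<Longrightarrow> norm (f t) \<le> B" using continuous_bounded_interval[OF f] by blast
  thus ?thesis
    by (intro integrable_scaleR_bounded[OF g continuous_measurable_lint[OF f], of B]) auto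
qed

lemmas test_integrable = continuous_scaleR_integrable_lint[OF test_functions_continuous(1)]
  continuous_scaleR_integrable_lint[OF test_functions_continuous(2)]

lemma is_weak_deriv_lincomb:
  fixes u v g h :: "real \<Rightarrow> 'v::euclidean_space"
  assumes "is_weak_deriv a b u g" "is_weak_deriv a b v h"
    and int: "integrable (lint a b) u" "integrable (lint a b) v" "integrable (lint a b) g" "integrable (lint a b) h"
  shows "is_weak_deriv a b (\<lambda>t. c *\<^sub>R u t + d *\<^sub>R v t) (\<lambda>t. c *\<^sub>R g t + d *\<^sub>R h t)"
  unfolding is_weak_deriv_def
proof
  fix \<phi> assume \<phi>: "\<phi> \<in> test_functions a b"
  have eq: "(LINT t|lint a b. f t *\<^sub>R (c *\<^sub>R x t + d *\<^sub>R y t)) =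
      c *\<^sub>R (LINT t|lint a b. f t *\<^sub>R x t) + d *\<^sub>R (LINT t|lint a b. f t *\<^sub>R y t)"
    if "integrable (lint a b) (\<lambda>t. f t *\<^sub>R x t)" "integrable (lint a b) (\<lambda>t. f t *\<^sub>R y t)"
    for f and x y :: "real \<Rightarrow> 'v"
  proof -
    have "(LINT t|lint a b. f t *\<^sub>R (c *\<^sub>R x t + d *\<^sub>R y t)) =
        (LINT t|lint a b. c *\<^sub>R (f t *\<^sub>R x t) + d *\<^sub>R (f t *\<^sub>R y t))"
      by (simp add: scaleR_add_right mult.commute)
    also have "\<dots> = c *\<^sub>R (LINT t|lint a b. f t *\<^sub>R x t) + d *\<^sub>R (LINT t|lint a b. f t *\<^sub>R y t)"
      using that by (subst Bochner_Integration.integral_add) (simp_all del: scaleR_scaleR)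
    finally show ?thesis .
  qed
  show "(LINT t|lint a b. deriv \<phi> t *\<^sub>R (c *\<^sub>R u t + d *\<^sub>R v t)) =
      - (LINT t|lint a b. \<phi> t *\<^sub>R (c *\<^sub>R g t + d *\<^sub>R h t))"
    using eq[OF test_integrable(2)[OF \<phi> int(1)] test_integrable(2)[OF \<phi> int(2)]]
      eq[OF test_integrable(1)[OF \<phi> int(3)] test_integrable(1)[OF \<phi> int(4)]] assms(1,2) \<phi>
    by (simp add: is_weak_deriv_def)
qed

lemma W1pD:
  assumes "u \<in> W1p a b p"
  shows "continuous_on {a..b} u" "t \<notin> {a..b} \<Longrightarrow> u t = 0" "u \<in> Lp a b p"
  using assms by (auto simp: W1p_def)

text \<open>The version selected by \<open>weak_deriv\<close> is only known to lie in L^1.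
  Membership in L^p is transferred from the witness in \<open>W1p\<close>, with which it agrees
  almost everywhere.\<close>

lemma weak_deriv_W1p:
  assumes "u \<in> W1p a b p" "1 < p"
  shows "weak_deriv a b u \<in> Lp a b p" "is_weak_deriv a b u (weak_deriv a b u)"
    "integrable (lint a b) (weak_deriv a b u)"
    "\<And>g. integrable (lint a b) g \<Longrightarrow> is_weak_deriv a b u g \<Longrightarrow> AE t in lint a b. weak_deriv a b u t = g t"
proof -
  obtain g where g: "g \<in> Lp a b p" "is_weak_deriv a b u g" using assms by (auto simp: W1p_def)
  have intg: "integrable (lint a b) g" by (rule Lp_integrable(1)[OF g(1) assms(2)])
  have "weak_deriv a b u \<in> Lp a b 1 \<and> is_weak_deriv a b u (weak_deriv a b u)"
    unfolding weak_deriv_def by (rule someI[of _ g]) (use intg g(2) Lp_1_iff in blast)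
  thus *: "is_weak_deriv a b u (weak_deriv a b u)" "integrable (lint a b) (weak_deriv a b u)"
    using Lp_1_iff by auto
  show AE: "AE t in lint a b. weak_deriv a b u t = g t"
    if "integrable (lint a b) g" "is_weak_deriv a b u g" for g
    by (rule weak_deriv_unique[OF W1pD(1)[OF assms(1)] *(2) *(1) that])
  note [measurable] = borel_measurable_integrable[OF *(2)] Lp_measurable[OF g(1)]
  have "integrable (lint a b) (\<lambda>t. norm (weak_deriv a b u t) powr p)
      \<longleftrightarrow> integrable (lint a b) (\<lambda>t. norm (g t) powr p)"
  proof (rule integrable_cong_AE)
    show "AE t in lint a b. norm (weak_deriv a b u t) powr p = norm (g t) powr p"
      using AE[OF intg g(2)] by eventually_elim simp
  qed measurable
  thus "weak_deriv a b u \<in> Lp a b p" using g(1) by (auto simp: Lp_def)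
qed

lemma continuous_imp_Lp:
  fixes u :: "real \<Rightarrow> 'v::euclidean_space"
  assumes "continuous_on {a..b} u" "0 < p"
  shows "u \<in> Lp a b p"
proof -
  have "continuous_on {a..b} (\<lambda>t. norm (u t) powr p)"
    using assms by (intro continuous_on_powr' continuous_on_norm continuous_on_const) auto
  from continuous_integrable_lint[OF this] continuous_measurable_lint[OF assms(1)] show ?thesis
    by (simp add: Lp_def)
qed

text \<open>Linearity of the derivative can be claimed only almost everywhere, because a version is
  selected separately for each function.\<close>

lemma W1p_lincomb:
  assumes u: "u \<in> W1p a b p" and v: "v \<in> W1p a b p" and p: "1 < p"
  shows "(\<lambda>t. c *\<^sub>R u t + d *\<^sub>R v t) \<in> W1p a b p"
    "AE t in lint a b. weak_deriv a b (\<lambda>t. c *\<^sub>R u t + d *\<^sub>R v t) t =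
       c *\<^sub>R weak_deriv a b u t + d *\<^sub>R weak_deriv a b v t"
proof -
  let ?w = "\<lambda>t. c *\<^sub>R u t + d *\<^sub>R v t"
  let ?g = "\<lambda>t. c *\<^sub>R weak_deriv a b u t + d *\<^sub>R weak_deriv a b v t"
  have int: "integrable (lint a b) u" "integrable (lint a b) v"
    using W1pD(1)[OF u] W1pD(1)[OF v] continuous_integrable_lint by blast+
  have w: "is_weak_deriv a b ?w ?g"
    by (intro is_weak_deriv_lincomb weak_deriv_W1p(2,3)[OF u p] weak_deriv_W1p(2,3)[OF v p] int)
  have g: "?g \<in> Lp a b p"
    using p by (intro Lp_add Lp_scaleR weak_deriv_W1p(1)[OF u p] weak_deriv_W1p(1)[OF v p]) auto
  have cont: "continuous_on {a..b} ?w"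
    by (intro continuous_intros W1pD(1)[OF u] W1pD(1)[OF v])
  have "\<forall>t. t \<notin> {a..b} \<longrightarrow> ?w t = 0" using W1pD(2)[OF u] W1pD(2)[OF v] by simp
  moreover have "?w \<in> Lp a b p" using continuous_imp_Lp[OF cont] p by simp
  ultimately show W: "?w \<in> W1p a b p"
    unfolding W1p_def using w g cont by blast
  show "AE t in lint a b. weak_deriv a b ?w t = ?g t"
    by (rule weak_deriv_W1p(4)[OF W p Lp_integrable(1)[OF g p] w])
qed

lemma W1p_diff:
  assumes "u \<in> W1p a b p" "v \<in> W1p a b p" "1 < p"
  shows "(\<lambda>t. u t - v t) \<in> W1p a b p"
    "AE t in lint a b. weak_deriv a b (\<lambda>t. u t - v t) t = weak_deriv a b u t - weak_deriv a b v t"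
  using W1p_lincomb[OF assms, of 1 "-1"] by simp_all

definition midpoint_fun :: "(real \<Rightarrow> 'v::real_vector) \<Rightarrow> (real \<Rightarrow> 'v) \<Rightarrow> real \<Rightarrow> 'v" where
  "midpoint_fun u v = (\<lambda>t. (1/2) *\<^sub>R (u t + v t))"

lemma W1p_midpoint:
  assumes "u \<in> W1p a b p" "v \<in> W1p a b p" "1 < p"
  shows "midpoint_fun u v \<in> W1p a b p"
    "AE t in lint a b. weak_deriv a b (midpoint_fun u v) t = (1/2) *\<^sub>R (weak_deriv a b u t + weak_deriv a b v t)"
  using W1p_lincomb[OF assms, of "1/2" "1/2"] by (simp_all add: midpoint_fun_def scaleR_add_right)

text \<open>Any two values differ by at most the L^1 norm of the derivative; averaging over the
  second point replaces its value by the mean of \<open>norm (v s)\<close>.\<close>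

lemma W1p_sup_bound:
  fixes v :: "real \<Rightarrow> 'v::euclidean_space"
  assumes v: "v \<in> W1p a b p" "1 < p" and ab: "a < b" and t: "t \<in> {a..b}"
  shows "norm (v t) \<le> (LINT s|lint a b. norm (v s)) / (b - a) + (LINT s|lint a b. norm (weak_deriv a b v s))"
proof -
  define J where "J = (LINT s|lint a b. norm (weak_deriv a b v s))"
  note g = weak_deriv_W1p(3,2)[OF v]
  have intv: "integrable (lint a b) v" by (rule continuous_integrable_lint[OF W1pD(1)[OF v(1)]])
  have lt: "norm (v t - v s) \<le> J" if "a < s" "s < t" "t < b" for s t
  proof -
    have "v t - v s = (LINT x|lint a b. indicat_real {s<..t} x *\<^sub>R weak_deriv a b v x)"
      by (rule weak_deriv_integral[OF that W1pD(1)[OF v(1)] g])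
    also have "norm \<dots> \<le> J"
      unfolding J_def
    proof (rule order_trans[OF integral_norm_bound integral_mono])
      have "integrable (lint a b) (\<lambda>x. indicat_real {s<..t} x *\<^sub>R weak_deriv a b v x)"
        by (rule integrable_scaleR_bounded[OF g(1), where B = 1])
          (auto intro: indicator_measurable_lint simp: indicator_le_1)
      thus "integrable (lint a b) (\<lambda>x. norm (indicat_real {s<..t} x *\<^sub>R weak_deriv a b v x))"
        by (rule integrable_norm)
    qed (use g in \<open>auto simp: indicator_def\<close>)
    finally show ?thesis .
  qed
  have J0: "0 \<le> J" by (simp add: J_def integral_nonneg_AE)
  have osc: "norm (v t) \<le> norm (v s) + J" if "t \<in> {a<..<b}" "s \<in> {a<..<b}" for s t
  proof -
    have "norm (v t - v s) \<le> J"
      using lt[of s t] lt[of t s] that J0 by (cases s t rule: linorder_cases) (auto simp: norm_minus_commute)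
    thus ?thesis using norm_triangle_ineq2[of "v t" "v s"] by linarith
  qed
  have "norm (v t) \<le> (LINT s|lint a b. norm (v s)) / (b - a) + J" if "t \<in> {a<..<b}" for t
  proof -
    have "norm (v t) * (b - a) = (LINT s|lint a b. norm (v t))"
      using integral_const_lint[of a b "norm (v t)"] ab by linarith
    also have "\<dots> \<le> (LINT s|lint a b. norm (v s) + J)"
      using osc[OF that] intv by (intro integral_mono) auto
    also have "\<dots> = (LINT s|lint a b. norm (v s)) + J * (b - a)"
      using intv integral_const_lint[of a b J] ab by (subst Bochner_Integration.integral_add) auto
    finally show ?thesis using ab by (simp add: field_simps)
  qed
  hence "\<forall>t\<in>{a<..<b}. norm (v t) \<le> (LINT s|lint a b. norm (v s)) / (b - a) + J" by blast
  \<comment> \<open>The bound so far concerns the open interval; the end points follow by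
    continuity.\<close>
  moreover have "closure {a<..<b} = {a..b}" using ab by simp
  ultimately show ?thesis using continuous_on_closure_norm_le[of "{a<..<b}" v] W1pD(1)[OF v(1)] t
    unfolding J_def by simp
qed

text \<open>The \<open>p\<close>-th power of a norm equivalent to \<^const>\<open>W1p_norm\<close>; without the roots, uniform
  convexity is inherited from a pointwise inequality.\<close>

definition W1p_energy :: "real \<Rightarrow> real \<Rightarrow> real \<Rightarrow> (real \<Rightarrow> 'v::euclidean_space) \<Rightarrow> real" where
  "W1p_energy a b p u = powr_int a b p u + powr_int a b p (weak_deriv a b u)"

text \<open>A distance up to the factor 2^p in its triangle inequality. It uses the two selected
  derivatives instead of the derivative of the difference, which equals their difference only almost
  everywhere.\<close>

definition W1p_gauge :: "real \<Rightarrow> real \<Rightarrow> real \<Rightarrow> (real \<Rightarrow> 'v::euclidean_space) \<Rightarrow> (real \<Rightarrow> 'v) \<Rightarrow> real" where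
  "W1p_gauge a b p u v = powr_int a b p (\<lambda>t. u t - v t) +
     powr_int a b p (\<lambda>t. weak_deriv a b u t - weak_deriv a b v t)"

section \<open>Uniform convexity and sup-norm control in the Sobolev space\<close>

lemma W1p_energy_diff:
  assumes "u \<in> W1p a b p" "v \<in> W1p a b p" "1 < p"
  shows "W1p_energy a b p (\<lambda>t. u t - v t) = W1p_gauge a b p u v"
proof -
  have "powr_int a b p (weak_deriv a b (\<lambda>t. u t - v t)) =
      powr_int a b p (\<lambda>t. weak_deriv a b u t - weak_deriv a b v t)"
    by (rule powr_int_cong_AE[OF Lp_measurable[OF weak_deriv_W1p(1)[OF W1p_diff(1)[OF assms] assms(3)]]
          borel_measurable_diff[OF Lp_measurable[OF weak_deriv_W1p(1)[OF assms(1,3)]]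
            Lp_measurable[OF weak_deriv_W1p(1)[OF assms(2,3)]]] W1p_diff(2)[OF assms]])
  thus ?thesis by (simp add: W1p_energy_def W1p_gauge_def)
qed

lemma W1p_energy_midpoint:
  assumes "u \<in> W1p a b p" "v \<in> W1p a b p" "1 < p"
  shows "W1p_energy a b p (midpoint_fun u v) = powr_int a b p (\<lambda>t. (1/2) *\<^sub>R (u t + v t)) +
     powr_int a b p (\<lambda>t. (1/2) *\<^sub>R (weak_deriv a b u t + weak_deriv a b v t))"
proof -
  have "powr_int a b p (weak_deriv a b (midpoint_fun u v)) =
      powr_int a b p (\<lambda>t. (1/2) *\<^sub>R (weak_deriv a b u t + weak_deriv a b v t))"
    by (rule powr_int_cong_AE[OF Lp_measurable[OF weak_deriv_W1p(1)[OF W1p_midpoint(1)[OF assms] assms(3)]]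
          borel_measurable_scaleR[OF borel_measurable_const
            borel_measurable_add[OF Lp_measurable[OF weak_deriv_W1p(1)[OF assms(1,3)]]
            Lp_measurable[OF weak_deriv_W1p(1)[OF assms(2,3)]]]] W1p_midpoint(2)[OF assms]])
  thus ?thesis by (simp add: W1p_energy_def midpoint_fun_def)
qed

lemma W1p_energy_nonneg: "0 \<le> W1p_energy a b p u"
  by (simp add: W1p_energy_def powr_int_nonneg)

lemma W1p_gauge_nonneg: "0 \<le> W1p_gauge a b p u v"
  by (simp add: W1p_gauge_def powr_int_nonneg)

lemma W1p_gauge_triangle:
  assumes "u \<in> W1p a b p" "v \<in> W1p a b p" "w \<in> W1p a b p" "1 < p"
  shows "W1p_gauge a b p u w \<le> 2 powr p * (W1p_gauge a b p u v + W1p_gauge a b p v w)"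
proof -
  have p: "0 \<le> p" using assms(4) by simp
  have "X + Y \<le> c * (x + y + (x' + y'))" if "X \<le> c * (x + x')" "Y \<le> c * (y + y')"
    for X Y c x y x' y' :: real
    using that by (simp add: distrib_left)
  from this[OF powr_int_triangle[OF W1pD(3)[OF assms(1)] W1pD(3)[OF assms(2)] W1pD(3)[OF assms(3)] p]
    powr_int_triangle[OF weak_deriv_W1p(1)[OF assms(1,4)] weak_deriv_W1p(1)[OF assms(2,4)]
      weak_deriv_W1p(1)[OF assms(3,4)] p]]
  show ?thesis unfolding W1p_gauge_def .
qed

lemma W1p_uniform_convexity:
  fixes a b p e R :: real
  assumes p: "1 < p" and e: "0 < e"
  obtains \<delta> where "0 < \<delta>" "\<And>u v :: real \<Rightarrow> 'v::euclidean_space. u \<in> W1p a b p \<Longrightarrow> v \<in> W1p a b p \<Longrightarrow>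
    W1p_energy a b p u \<le> R \<Longrightarrow> W1p_energy a b p v \<le> R \<Longrightarrow>
    (W1p_energy a b p u + W1p_energy a b p v) / 2 - W1p_energy a b p (midpoint_fun u v) < \<delta> \<Longrightarrow>
    W1p_gauge a b p u v < e"
proof -
  \<comment> \<open>A positive bound for both energies, whatever the sign of R. With e / (4 * k) as
    convexity parameter the energies contribute at most e/2, and a gap below e / (2 * C) contributes
    the other half.\<close>
  define k where "k = \<bar>R\<bar> + 1"
  have k: "0 < k" "R \<le> k" by (auto simp: k_def)
  define \<epsilon> where "\<epsilon> = e / (4 * k)"
  have \<epsilon>: "0 < \<epsilon>" using e k by (simp add: \<epsilon>_def)
  obtain C where C: "0 < C" "\<And>f g :: real \<Rightarrow> 'v. f \<in> Lp a b p \<Longrightarrow> g \<in> Lp a b p \<Longrightarrow>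
    powr_int a b p (\<lambda>t. f t - g t) \<le> \<epsilon> * (powr_int a b p f + powr_int a b p g) +
      C * ((powr_int a b p f + powr_int a b p g) / 2 - powr_int a b p (\<lambda>t. (1/2) *\<^sub>R (f t + g t)))"
    by (rule powr_int_uniform_convexity[OF p \<epsilon>, of a b]) (rule that)
  show ?thesis
  proof (rule that[of "e / (2 * C)"])
    show "0 < e / (2 * C)" using e C by simp
    fix u v :: "real \<Rightarrow> 'v"
    assume u: "u \<in> W1p a b p" and v: "v \<in> W1p a b p"
      and R: "W1p_energy a b p u \<le> R" "W1p_energy a b p v \<le> R"
      and gap: "(W1p_energy a b p u + W1p_energy a b p v) / 2 - W1p_energy a b p (midpoint_fun u v) < e / (2 * C)"
    define E where "E = W1p_energy a b p u + W1p_energy a b p v"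
    have "X + Y \<le> \<epsilon> * (x + x' + (y + y')) + C * ((x + x' + (y + y')) / 2 - (m + n))"
      if "X \<le> \<epsilon> * (x + y) + C * ((x + y) / 2 - m)" "Y \<le> \<epsilon> * (x' + y') + C * ((x' + y') / 2 - n)"
      for X Y x y x' y' m n :: real
    proof -
      have "\<epsilon> * (x + x' + (y + y')) + C * ((x + x' + (y + y')) / 2 - (m + n)) =
        \<epsilon> * (x + y) + C * ((x + y) / 2 - m) + (\<epsilon> * (x' + y') + C * ((x' + y') / 2 - n))"
        by argo
      thus ?thesis using that by linarith
    qed
    from this[OF C(2)[OF W1pD(3)[OF u] W1pD(3)[OF v]]
        C(2)[OF weak_deriv_W1p(1)[OF u p] weak_deriv_W1p(1)[OF v p]]]
    have "W1p_gauge a b p u v \<le> \<epsilon> * E + C * (E / 2 - W1p_energy a b p (midpoint_fun u v))"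
      unfolding W1p_energy_midpoint[OF u v p] unfolding W1p_gauge_def E_def W1p_energy_def .
    moreover have "C * (E / 2 - W1p_energy a b p (midpoint_fun u v)) < C * (e / (2 * C))"
      using gap C(1) unfolding E_def by (rule mult_strict_left_mono)
    moreover have "C * (e / (2 * C)) = e / 2" using C(1) by simp
    moreover have "\<epsilon> * E \<le> \<epsilon> * (2 * k)"
      using \<epsilon> R k(2) by (intro mult_left_mono) (auto simp: E_def)
    moreover have "\<epsilon> * (2 * k) = e / 2" using k(1) by (simp add: \<epsilon>_def)
    ultimately show "W1p_gauge a b p u v < e" by linarith
  qed
qed

lemma W1p_gauge_sup:
  fixes a b p e :: real
  assumes p: "1 < p" and ab: "a < b" and e: "0 < e"
  obtains \<delta> where "0 < \<delta>" "\<And>u v :: real \<Rightarrow> 'v::euclidean_space. u \<in> W1p a b p \<Longrightarrow> v \<in> W1p a b p \<Longrightarrow>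
    W1p_gauge a b p u v < \<delta> \<Longrightarrow> \<forall>t\<in>{a..b}. norm (u t - v t) < e"
proof -
  \<comment> \<open>The minimum absorbs the division by b - a in \<open>W1p_sup_bound\<close>, so
    that each of its two terms is at most e/2.\<close>
  define e' where "e' = e / 2 * min 1 (b - a)"
  have e': "0 < e'" "e' \<le> e / 2" "e' / (b - a) \<le> e / 2"
  proof -
    have "e' \<le> e / 2 * 1" "e' \<le> e / 2 * (b - a)"
      unfolding e'_def using e by (intro mult_left_mono; simp)+
    thus "e' \<le> e / 2" "e' / (b - a) \<le> e / 2" using ab by (simp_all add: pos_divide_le_eq)
  qed (use e ab in \<open>simp add: e'_def\<close>)
  obtain \<delta> where \<delta>: "0 < \<delta>" "\<And>f :: real \<Rightarrow> 'v. f \<in> Lp a b p \<Longrightarrow>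
      powr_int a b p f < \<delta> \<Longrightarrow> (LINT t|lint a b. norm (f t)) < e'"
    by (rule powr_int_imp_L1_small[OF p ab e'(1)]) (rule that)
  show ?thesis
  proof (rule that[OF \<delta>(1)], rule ballI)
    fix u v :: "real \<Rightarrow> 'v" and t
    assume uv: "u \<in> W1p a b p" "v \<in> W1p a b p" "W1p_gauge a b p u v < \<delta>" and t: "t \<in> {a..b}"
    let ?w = "\<lambda>t. u t - v t"
    note W = W1p_diff(1)[OF uv(1,2) p]
    have E: "W1p_energy a b p ?w < \<delta>" using uv W1p_energy_diff[OF uv(1,2) p] by simp
    have "(LINT t|lint a b. norm (?w t)) < e'"
      using E powr_int_nonneg[of a b p "weak_deriv a b ?w"]
      by (intro \<delta>(2) W1pD(3)[OF W]) (simp add: W1p_energy_def)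
    hence 1: "(LINT t|lint a b. norm (?w t)) / (b - a) < e' / (b - a)"
      using ab by (simp add: divide_strict_right_mono)
    have 2: "(LINT t|lint a b. norm (weak_deriv a b ?w t)) < e'"
      using E powr_int_nonneg[of a b p ?w]
      by (intro \<delta>(2) weak_deriv_W1p(1)[OF W p]) (simp add: W1p_energy_def)
    show "norm (u t - v t) < e"
      using W1p_sup_bound[OF W p ab t] 1 2 e' by linarith
  qed
qed

section \<open>Completeness of the Sobolev space\<close>

lemma powr_int_le_sup:
  fixes f :: "real \<Rightarrow> 'v::euclidean_space"
  assumes "f \<in> Lp a b p" "0 \<le> p" "a \<le> b" "\<And>t. t \<in> {a<..<b} \<Longrightarrow> norm (f t) \<le> e"
  shows "powr_int a b p f \<le> e powr p * (b - a)"
proof -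
  have "powr_int a b p f \<le> (LINT t|lint a b. e powr p)"
    unfolding powr_int_def using assms
    by (intro integral_mono Lp_powr_integrable powr_mono2) auto
  thus ?thesis using integral_const_lint[OF assms(3), of "e powr p"] by linarith
qed

text \<open>For a fixed test function both sides of the defining identity are continuous under L^1
  convergence, since the test function and its derivative are bounded on [a, b].\<close>

lemma weak_deriv_limit:
  fixes z g :: "real \<Rightarrow> 'v::euclidean_space"
  assumes wd: "\<And>n. is_weak_deriv a b (w n) (h n)"
    and int: "\<And>n. integrable (lint a b) (w n)" "\<And>n. integrable (lint a b) (h n)"
      "integrable (lint a b) z" "integrable (lint a b) g"
    and lim: "(\<lambda>n. LINT t|lint a b. norm (w n t - z t)) \<longlonglongrightarrow> 0"
      "(\<lambda>n. LINT t|lint a b. norm (h n t - g t)) \<longlonglongrightarrow> 0"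
  shows "is_weak_deriv a b z g"
  unfolding is_weak_deriv_def
proof
  fix \<phi> assume \<phi>: "\<phi> \<in> test_functions a b"
  have tends: "(\<lambda>n. LINT t|lint a b. f t *\<^sub>R y n t) \<longlonglongrightarrow> (LINT t|lint a b. f t *\<^sub>R x t)"
    if f: "continuous_on {a..b} f" and int: "\<And>n. integrable (lint a b) (y n)" "integrable (lint a b) x"
      and lim: "(\<lambda>n. LINT t|lint a b. norm (y n t - x t)) \<longlonglongrightarrow> 0"
    for f and y :: "nat \<Rightarrow> real \<Rightarrow> 'v" and x
  proof -
    obtain B where B: "\<And>t. t \<in> {a..b} \<Longrightarrow> norm (f t) \<le> B" using continuous_bounded_interval[OF f] by blast
    note int' = continuous_scaleR_integrable_lint[OF f]
    have "(\<lambda>n. (LINT t|lint a b. f t *\<^sub>R y n t) - (LINT t|lint a b. f t *\<^sub>R x t)) \<longlonglongrightarrow> 0"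
    proof (rule Lim_null_comparison)
      show "\<forall>\<^sub>F n in sequentially. norm ((LINT t|lint a b. f t *\<^sub>R y n t) - (LINT t|lint a b. f t *\<^sub>R x t))
          \<le> B * (LINT t|lint a b. norm (y n t - x t))"
      proof (intro always_eventually allI)
        fix n
        have "(LINT t|lint a b. f t *\<^sub>R y n t) - (LINT t|lint a b. f t *\<^sub>R x t) =
            (LINT t|lint a b. f t *\<^sub>R (y n t - x t))"
          using int'[OF int(1)[of n]] int'[OF int(2)] by (simp add: scaleR_diff_right)
        also have "norm \<dots> \<le> (LINT t|lint a b. B * norm (y n t - x t))"
        proof (rule order_trans[OF integral_norm_bound integral_mono])
          show "integrable (lint a b) (\<lambda>t. norm (f t *\<^sub>R (y n t - x t)))"
            using int'[of "\<lambda>t. y n t - x t"] int by (intro integrable_norm) auto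
          show "norm (f t *\<^sub>R (y n t - x t)) \<le> B * norm (y n t - x t)"
            if "t \<in> space (lint a b)" for t
            using B[of t] that by (auto intro!: mult_right_mono)
        qed (use int in auto)
        finally show "norm ((LINT t|lint a b. f t *\<^sub>R y n t) - (LINT t|lint a b. f t *\<^sub>R x t))
          \<le> B * (LINT t|lint a b. norm (y n t - x t))" by simp
      qed
    qed (use tendsto_mult_right_zero[OF lim] in simp)
    thus ?thesis by (simp add: LIM_zero_iff)
  qed
  have "(\<lambda>n. LINT t|lint a b. deriv \<phi> t *\<^sub>R w n t) \<longlonglongrightarrow> (LINT t|lint a b. deriv \<phi> t *\<^sub>R z t)"
    by (intro tends test_functions_continuous[OF \<phi>] int lim)
  moreover have "(\<lambda>n. LINT t|lint a b. \<phi> t *\<^sub>R h n t) \<longlonglongrightarrow> (LINT t|lint a b. \<phi> t *\<^sub>R g t)"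
    by (intro tends test_functions_continuous[OF \<phi>] int lim)
  from tendsto_minus[OF this]
  have "(\<lambda>n. LINT t|lint a b. deriv \<phi> t *\<^sub>R w n t) \<longlonglongrightarrow> - (LINT t|lint a b. \<phi> t *\<^sub>R g t)"
    using wd \<phi> by (simp add: is_weak_deriv_def)
  ultimately show "(LINT t|lint a b. deriv \<phi> t *\<^sub>R z t) = - (LINT t|lint a b. \<phi> t *\<^sub>R g t)"
    by (rule LIMSEQ_unique)
qed

text \<open>The derivatives converge in L^p and the functions converge uniformly; the weak identity
  survives because both convergences imply convergence in L^1.\<close>

proposition W1p_complete:
  fixes w :: "nat \<Rightarrow> real \<Rightarrow> 'v::euclidean_space"
  assumes p: "1 < p" and ab: "a < b" and w: "\<And>n. w n \<in> W1p a b p"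
    and Cauchy: "\<And>e. 0 < e \<Longrightarrow> \<exists>n0. \<forall>m\<ge>n0. \<forall>n\<ge>n0. W1p_gauge a b p (w m) (w n) < e"
  obtains z where "z \<in> W1p a b p" "(\<lambda>n. W1p_gauge a b p (w n) z) \<longlonglongrightarrow> 0"
proof -
  let ?h = "\<lambda>n. weak_deriv a b (w n)"
  have le: "powr_int a b p (\<lambda>t. ?h m t - ?h n t) \<le> W1p_gauge a b p (w m) (w n)" for m n
    by (simp add: W1p_gauge_def powr_int_nonneg)
  have "\<exists>n0. \<forall>m\<ge>n0. \<forall>n\<ge>n0. powr_int a b p (\<lambda>t. ?h m t - ?h n t) < e" if "0 < e" for e
    using Cauchy[OF that] le_less_trans[OF le] by blast
  then obtain g where g: "g \<in> Lp a b p" "(\<lambda>n. powr_int a b p (\<lambda>t. ?h n t - g t)) \<longlonglongrightarrow> 0"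
    by (rule Lp_complete[OF p ab weak_deriv_W1p(1)[OF w p]])
  \<comment> \<open>An L^p limit would be determined only almost everywhere; uniform convergence
    supplies the continuous representative.\<close>
  have "uniformly_Cauchy_on {a..b} w"
    unfolding uniformly_Cauchy_on_def
  proof (intro allI impI)
    fix e :: real assume "0 < e"
    then obtain \<delta> where \<delta>: "0 < \<delta>" "\<And>u v :: real \<Rightarrow> 'v. u \<in> W1p a b p \<Longrightarrow> v \<in> W1p a b p \<Longrightarrow>
        W1p_gauge a b p u v < \<delta> \<Longrightarrow> \<forall>t\<in>{a..b}. norm (u t - v t) < e"
      by (rule W1p_gauge_sup[OF p ab]) (rule that)
    obtain n0 where "\<forall>m\<ge>n0. \<forall>n\<ge>n0. W1p_gauge a b p (w m) (w n) < \<delta>" using Cauchy[OF \<delta>(1)] by blast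
    thus "\<exists>M. \<forall>x\<in>{a..b}. \<forall>m\<ge>M. \<forall>n\<ge>M. dist (w m x) (w n x) < e"
      using \<delta>(2)[OF w w] unfolding dist_norm by blast
  qed
  then obtain l where l: "uniform_limit {a..b} w l sequentially"
    using Cauchy_uniformly_convergent[of "{a..b}" w] unfolding uniformly_convergent_on_def by blast
  \<comment> \<open>\<open>W1p\<close> demands the value 0 outside [a, b].\<close>
  define z where "z t = (if t \<in> {a..b} then l t else 0)" for t
  have z: "uniform_limit {a..b} w z sequentially"
    using l unfolding uniform_limit_iff by (simp add: z_def)
  have contz: "continuous_on {a..b} z"
    by (rule uniform_limit_theorem[OF _ z]) (use W1pD(1)[OF w] in auto)
  have Lpz: "z \<in> Lp a b p" using continuous_imp_Lp[OF contz] p by simp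
  have Lpw: "(\<lambda>t. w n t - z t) \<in> Lp a b p" for n
    using Lp_diff(1)[OF W1pD(3)[OF w] Lpz] p by simp
  have limz: "(\<lambda>n. powr_int a b p (\<lambda>t. w n t - z t)) \<longlonglongrightarrow> 0"
  proof (rule LIMSEQ_I)
    fix e :: real assume e: "0 < e"
    define c where "c = (e / (2 * (b - a))) powr (1 / p)"
    have c: "0 < c" "c powr p * (b - a) = e / 2"
      using e ab p by (auto simp: c_def powr_powr divide_simps)
    have "\<forall>\<^sub>F n in sequentially. \<forall>t\<in>{a..b}. dist (w n t) (z t) < c"
      using z c(1) by (simp add: uniform_limit_iff)
    then obtain n0 where n0: "\<And>n t. n0 \<le> n \<Longrightarrow> t \<in> {a..b} \<Longrightarrow> norm (w n t - z t) < c"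
      unfolding eventually_sequentially dist_norm by blast
    have "powr_int a b p (\<lambda>t. w n t - z t) \<le> c powr p * (b - a)" if "n0 \<le> n" for n
      using n0[OF that] p ab by (intro powr_int_le_sup Lpw) (auto intro: less_imp_le)
    hence "norm (powr_int a b p (\<lambda>t. w n t - z t) - 0) < e" if "n0 \<le> n" for n
      using powr_int_nonneg[of a b p "\<lambda>t. w n t - z t"] e that c(2) by fastforce
    thus "\<exists>n0. \<forall>n\<ge>n0. norm (powr_int a b p (\<lambda>t. w n t - z t) - 0) < e" by blast
  qed
  have intg: "integrable (lint a b) g" by (rule Lp_integrable(1)[OF g(1) p])
  have hg: "(\<lambda>t. ?h n t - g t) \<in> Lp a b p" for n
    using Lp_diff(1)[OF weak_deriv_W1p(1)[OF w p] g(1)] p by simp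
  have wz: "is_weak_deriv a b z g"
    by (rule weak_deriv_limit[OF weak_deriv_W1p(2)[OF w p] Lp_integrable(1)[OF W1pD(3)[OF w] p]
          weak_deriv_W1p(3)[OF w p] Lp_integrable(1)[OF Lpz p] intg
          powr_int_imp_L1_tendsto[OF p ab Lpw limz] powr_int_imp_L1_tendsto[OF p ab hg g(2)]])
  have W: "z \<in> W1p a b p"
    using contz Lpz g(1) wz by (auto simp: W1p_def z_def)
  note [measurable] = Lp_measurable[OF weak_deriv_W1p(1)[OF w p]]
    Lp_measurable[OF g(1)] Lp_measurable[OF weak_deriv_W1p(1)[OF W p]]
  \<comment> \<open>The version selected for z need not be g itself, but the integral does not see
    the difference.\<close>
  have "powr_int a b p (\<lambda>t. ?h n t - weak_deriv a b z t) = powr_int a b p (\<lambda>t. ?h n t - g t)" for n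
  proof (rule powr_int_cong_AE)
    show "AE t in lint a b. ?h n t - weak_deriv a b z t = ?h n t - g t"
      using weak_deriv_W1p(4)[OF W p intg wz] by eventually_elim simp
  qed measurable
  hence "(\<lambda>n. W1p_gauge a b p (w n) z) \<longlonglongrightarrow> 0"
    using tendsto_add_zero[OF limz g(2)] by (simp add: W1p_gauge_def)
  thus ?thesis using that W by blast
qed

section \<open>Cluster points in uniformly convex spaces\<close>

inductive_set mid_hull :: "('x \<Rightarrow> 'x \<Rightarrow> 'x) \<Rightarrow> 'x set \<Rightarrow> 'x set" for mid A where
  base: "x \<in> A \<Longrightarrow> x \<in> mid_hull mid A"
| mid: "x \<in> mid_hull mid A \<Longrightarrow> y \<in> mid_hull mid A \<Longrightarrow> mid x y \<in> mid_hull mid A"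

lemma mid_hull_mono:
  assumes "A \<subseteq> B" shows "mid_hull mid A \<subseteq> mid_hull mid B"
proof
  fix x assume "x \<in> mid_hull mid A"
  thus "x \<in> mid_hull mid B" by induction (use assms in \<open>auto intro: mid_hull.intros\<close>)
qed

lemma mid_hull_least:
  assumes "A \<subseteq> B" "\<And>x y. x \<in> B \<Longrightarrow> y \<in> B \<Longrightarrow> mid x y \<in> B"
  shows "mid_hull mid A \<subseteq> B"
proof
  fix x assume "x \<in> mid_hull mid A"
  thus "x \<in> B" by induction (use assms in auto)
qed

text \<open>The least size \<open>d A\<close> over the hull grows as A shrinks along the filter,
  with supremum \<open>S\<close>. Two points of \<open>H (A k)\<close> of size below S + 1/(k+1)
  have their midpoint in the same hull, hence of size above S - 1/(k+1): the convexity gap is below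
  2/(k+1), which forces the points together. Any set of the filter may be intersected with
  \<open>A k\<close> without spoiling this, so one limit serves all hulls.\<close>

proposition uniformly_convex_cluster:
  fixes mid :: "'x \<Rightarrow> 'x \<Rightarrow> 'x" and N :: "'x \<Rightarrow> real" and D :: "'x \<Rightarrow> 'x \<Rightarrow> real"
    and X :: "'x set" and F :: "'x filter"
  assumes mid: "\<And>x y. x \<in> X \<Longrightarrow> y \<in> X \<Longrightarrow> mid x y \<in> X"
    and N: "\<And>x. 0 \<le> N x"
    and D: "\<And>x y. 0 \<le> D x y"
    and tri: "\<And>x y z. x \<in> X \<Longrightarrow> y \<in> X \<Longrightarrow> z \<in> X \<Longrightarrow> D x z \<le> K * (D x y + D y z)"
    and convex: "\<And>e R. 0 < e \<Longrightarrow> \<exists>\<delta>>0. \<forall>x\<in>X. \<forall>y\<in>X. N x \<le> R \<longrightarrow> N y \<le> R \<longrightarrow>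
        (N x + N y) / 2 - N (mid x y) < \<delta> \<longrightarrow> D x y < e"
    and complete: "\<And>w :: nat \<Rightarrow> 'x. (\<And>n. w n \<in> X) \<Longrightarrow>
        (\<And>e. 0 < e \<Longrightarrow> \<exists>n0. \<forall>m\<ge>n0. \<forall>n\<ge>n0. D (w m) (w n) < e) \<Longrightarrow> \<exists>z\<in>X. (\<lambda>n. D (w n) z) \<longlonglongrightarrow> 0"
    and F: "F \<noteq> bot" "eventually (\<lambda>x. x \<in> X \<and> N x \<le> R) F"
  obtains z where "z \<in> X"
    "\<And>A. eventually (\<lambda>x. x \<in> A) F \<Longrightarrow>
       \<exists>y :: nat \<Rightarrow> 'x. (\<forall>n. y n \<in> mid_hull mid (A \<inter> X)) \<and> (\<lambda>n. D (y n) z) \<longlonglongrightarrow> 0"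
proof -
  define H where "H A = mid_hull mid (A \<inter> X)" for A
  define d where "d A = Inf (N ` H A)" for A
  define \<A> where "\<A> = {A. eventually (\<lambda>x. x \<in> A) F}"
  have HX: "H A \<subseteq> X" for A
    unfolding H_def by (rule mid_hull_least) (use mid in auto)
  have Hmono: "H A \<subseteq> H B" if "A \<subseteq> B" for A B
    unfolding H_def by (rule mid_hull_mono) (use that in auto)
  have Hmid: "mid x y \<in> H A" if "x \<in> H A" "y \<in> H A" for x y A
    using that unfolding H_def by (rule mid_hull.mid)
  have bdd: "bdd_below (N ` H A)" for A
    by (rule bdd_belowI[of _ 0]) (use N in auto)
  have d_le: "d A \<le> N x" if "x \<in> H A" for x A
    unfolding d_def by (rule cInf_lower) (use that bdd in auto)
  have ne: "\<exists>x\<in>H A. N x \<le> R" if "A \<in> \<A>" for A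
  proof -
    have "eventually (\<lambda>x. x \<in> A \<and> (x \<in> X \<and> N x \<le> R)) F"
      using that F(2) unfolding \<A>_def mem_Collect_eq by (rule eventually_conj)
    then obtain x where "x \<in> A" "x \<in> X" "N x \<le> R"
      using eventually_happens'[OF F(1)] by blast
    thus ?thesis by (auto simp: H_def intro: mid_hull.base)
  qed
  have dR: "d A \<le> R" if "A \<in> \<A>" for A
    using ne[OF that] d_le by force
  define S where "S = Sup (d ` \<A>)"
  have "UNIV \<in> \<A>" by (simp add: \<A>_def)
  have bdd': "bdd_above (d ` \<A>)" by (rule bdd_aboveI[of _ R]) (use dR in auto)
  have dS: "d A \<le> S" if "A \<in> \<A>" for A
    unfolding S_def by (rule cSup_upper) (use that bdd' in auto)
  have "\<exists>A\<in>\<A>. S - 1 / Suc k < d A" for k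
  proof -
    have "S - 1 / Suc k < S" by simp
    hence "\<exists>y\<in>d ` \<A>. S - 1 / Suc k < y"
      unfolding S_def using less_cSup_iff[OF _ bdd'] \<open>UNIV \<in> \<A>\<close> by blast
    thus ?thesis by auto
  qed
  then obtain B where B: "\<And>k. B k \<in> \<A>" "\<And>k. S - 1 / Suc k < d (B k)" by metis
  \<comment> \<open>Intersecting makes the sets decrease and keeps them in the filter, while
    \<open>H (A k)\<close> stays inside \<open>H (B k)\<close>, where sizes exceed S -
    1/(k+1).\<close>
  define A where "A k = (\<Inter>j\<le>k. B j)" for k
  have A: "A k \<in> \<A>" for k
  proof -
    have "eventually (\<lambda>x. \<forall>j\<in>{..k}. x \<in> B j) F"
      using B(1) by (intro eventually_ball_finite) (auto simp: \<A>_def)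
    thus ?thesis by (simp add: A_def \<A>_def)
  qed
  have Aanti: "A m \<subseteq> A n" if "n \<le> m" for m n
    using that by (auto simp: A_def)
  \<comment> \<open>\<open>A k \<inter> C\<close> still belongs to the filter, so its infimum cannot
    exceed \<open>S\<close>.\<close>
  have near: "\<exists>x\<in>H (A k \<inter> C). N x < S + 1 / Suc k" if "C \<in> \<A>" for k C
  proof -
    have *: "A k \<inter> C \<in> \<A>" using A[of k] that by (auto simp: \<A>_def eventually_conj_iff)
    have "d (A k \<inter> C) < S + 1 / Suc k" using dS[OF *] by (smt (verit) divide_pos_pos of_nat_0_less_iff zero_less_Suc)
    moreover have "N ` H (A k \<inter> C) \<noteq> {}" using ne[OF *] by auto
    ultimately show ?thesis unfolding d_def using cInf_less_iff[OF _ bdd] by auto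
  qed
  have close: "\<exists>n0. \<forall>k\<ge>n0. \<forall>x\<in>H (A k). \<forall>y\<in>H (A k).
      N x < S + 1 / Suc k \<longrightarrow> N y < S + 1 / Suc k \<longrightarrow> D x y < e" if e: "0 < e" for e
  proof -
    obtain \<delta> where \<delta>: "0 < \<delta>" "\<And>x y. x \<in> X \<Longrightarrow> y \<in> X \<Longrightarrow> N x \<le> S + 1 \<Longrightarrow> N y \<le> S + 1 \<Longrightarrow>
        (N x + N y) / 2 - N (mid x y) < \<delta> \<Longrightarrow> D x y < e"
      using convex[OF e, of "S + 1"] by blast
    define r where "r n = 1 / real (Suc n)" for n
    obtain n0 where n0: "1 / Suc n0 < \<delta> / 2"
      using reals_Archimedean[of "\<delta> / 2"] \<delta>(1) by (auto simp: inverse_eq_divide)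
    have "D x y < e" if k: "n0 \<le> k" and xy: "x \<in> H (A k)" "y \<in> H (A k)"
      "N x < S + 1 / Suc k" "N y < S + 1 / Suc k" for k x y
    proof (rule \<delta>(2))
      have k1: "1 / Suc k \<le> 1 / real (Suc n0)" using k by (intro divide_left_mono) auto
      have k2: "1 / Suc k \<le> (1 :: real)" by simp
      show "x \<in> X" "y \<in> X" using xy HX by auto
      show "N x \<le> S + 1" "N y \<le> S + 1" using xy k2 by linarith+
      have "mid x y \<in> H (B k)"
        using Hmid[OF xy(1,2)] Hmono[of "A k" "B k"] by (auto simp: A_def)
      hence "S - 1 / Suc k < N (mid x y)" using B(2)[of k] d_le by force
      hence "N x + N y < 2 * N (mid x y) + 2 * \<delta>" using xy(3,4) k1 n0
        unfolding r_def[symmetric] by linarith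
      thus "(N x + N y) / 2 - N (mid x y) < \<delta>" by (simp add: field_simps)
    qed
    thus ?thesis by blast
  qed
  have "\<forall>k. \<exists>x. x \<in> H (A k) \<and> N x < S + 1 / Suc k"
    using near[OF \<open>UNIV \<in> \<A>\<close>] by auto
  then obtain w where w: "\<And>k. w k \<in> H (A k)" "\<And>k. N (w k) < S + 1 / Suc k" by metis
  have "\<exists>n0. \<forall>m\<ge>n0. \<forall>n\<ge>n0. D (w m) (w n) < e" if e: "0 < e" for e
  proof -
    obtain n0 where n0: "\<And>k x y. n0 \<le> k \<Longrightarrow> x \<in> H (A k) \<Longrightarrow> y \<in> H (A k) \<Longrightarrow>
        N x < S + 1 / Suc k \<Longrightarrow> N y < S + 1 / Suc k \<Longrightarrow> D x y < e"
      using close[OF e] by blast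
    \<comment> \<open>All later terms lie in the hull, and within the tolerance, of the single index
      n0, so one use of the estimate compares any two of them.\<close>
    have "w m \<in> H (A n0) \<and> N (w m) < S + 1 / Suc n0" if "n0 \<le> m" for m
    proof -
      have "1 / Suc m \<le> 1 / real (Suc n0)" using that by (intro divide_left_mono) auto
      thus ?thesis using w(1)[of m] w(2)[of m] Hmono[OF Aanti[OF that]] by auto
    qed
    thus ?thesis using n0[of n0] by blast
  qed
  then obtain z where z: "z \<in> X" "(\<lambda>n. D (w n) z) \<longlonglongrightarrow> 0"
    using complete[of w] w(1) HX by blast
  show ?thesis
  proof (rule that[OF z(1)])
    fix C assume "eventually (\<lambda>x. x \<in> C) F"
    hence C: "C \<in> \<A>" by (simp add: \<A>_def)
    have "\<forall>k. \<exists>x. x \<in> H (A k \<inter> C) \<and> N x < S + 1 / Suc k" using near[OF C] by auto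
    then obtain y where y: "\<And>k. y k \<in> H (A k \<inter> C)" "\<And>k. N (y k) < S + 1 / Suc k" by metis
    have yA: "y k \<in> H (A k)" "y k \<in> H C" for k using y(1)[of k] Hmono[of "A k \<inter> C"] by auto
    \<comment> \<open>Both sequences are nearly minimal in the same \<open>H (A k)\<close>; this
      ties the points chosen for C to the sequence \<open>w\<close>, which does not depend on
      C.\<close>
    have yw: "(\<lambda>k. D (y k) (w k)) \<longlonglongrightarrow> 0"
    proof (rule LIMSEQ_I)
      fix e :: real assume "0 < e"
      then obtain n0 where "\<And>k x y. n0 \<le> k \<Longrightarrow> x \<in> H (A k) \<Longrightarrow> y \<in> H (A k) \<Longrightarrow>
        N x < S + 1 / Suc k \<Longrightarrow> N y < S + 1 / Suc k \<Longrightarrow> D x y < e"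
        using close by blast
      hence "\<forall>k\<ge>n0. D (y k) (w k) < e" using yA(1) y(2) w by blast
      thus "\<exists>n0. \<forall>k\<ge>n0. norm (D (y k) (w k) - 0) < e" using D by auto
    qed
    have "(\<lambda>k. D (y k) z) \<longlonglongrightarrow> 0"
    proof (rule tendsto_sandwich[OF _ _ tendsto_const])
      show "\<forall>\<^sub>F k in sequentially. D (y k) z \<le> K * (D (y k) (w k) + D (w k) z)"
        using yA(1) w(1) HX z(1) by (intro always_eventually allI tri) auto
      show "(\<lambda>k. K * (D (y k) (w k) + D (w k) z)) \<longlonglongrightarrow> 0"
        using tendsto_mult_right_zero[OF tendsto_add_zero[OF yw z(2)]] by simp
    qed (use D in auto)
    thus "\<exists>y. (\<forall>n. y n \<in> mid_hull mid (C \<inter> X)) \<and> (\<lambda>n. D (y n) z) \<longlonglongrightarrow> 0"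
      using yA(2) unfolding H_def by blast
  qed
qed

section \<open>Fractional integrals\<close>

text \<open>For integrands with a singularity at an end point: the gauge integral needs only a
  continuous antiderivative, and nonnegativity upgrades it to Lebesgue integrability.\<close>

lemma fundamental_theorem_Ioo:
  fixes F f :: "real \<Rightarrow> real"
  assumes ab: "a \<le> b" and F: "\<And>x. x \<in> {a<..<b} \<Longrightarrow> (F has_real_derivative f x) (at x)"
    and cont: "continuous_on {a..b} F" and f: "\<And>x. x \<in> {a<..<b} \<Longrightarrow> 0 \<le> f x"
  shows "integrable (lint a b) f" "(LINT x|lint a b. f x) = F b - F a"
proof -
  have "(f has_integral (F b - F a)) {a..b}"
    using assms by (intro fundamental_theorem_of_calculus_interior)
      (auto simp: has_real_derivative_iff_has_vector_derivative[symmetric])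
  hence I: "(f has_integral (F b - F a)) {a<..<b}" by (simp add: has_integral_Icc_iff_Ioo)
  hence "f absolutely_integrable_on {a<..<b}"
    using f by (intro nonnegative_absolutely_integrable_1) auto
  thus int: "integrable (lint a b) f" by (rule absolutely_integrable_imp_integrable) simp
  show "(LINT x|lint a b. f x) = F b - F a"
    using lebesgue_integral_eq_integral[OF int] I by (simp add: integral_unique)
qed

lemma lint_subinterval:
  fixes f g :: "real \<Rightarrow> 'v::euclidean_space"
  assumes "{c<..<d} \<subseteq> {a<..<b}" "\<And>x. x \<in> {c<..<d} \<Longrightarrow> g x = f x"
    "\<And>x. x \<in> {a<..<b} - {c<..<d} \<Longrightarrow> g x = 0"
  shows "integrable (lint a b) g \<longleftrightarrow> integrable (lint c d) f"
    "(LINT x|lint a b. g x) = (LINT x|lint c d. f x)"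
proof -
  have eq: "(\<lambda>x. indicat_real {a<..<b} x *\<^sub>R g x) = (\<lambda>x. indicat_real {c<..<d} x *\<^sub>R f x)"
  proof
    fix x show "indicat_real {a<..<b} x *\<^sub>R g x = indicat_real {c<..<d} x *\<^sub>R f x"
      using assms(1) assms(2)[of x] assms(3)[of x] by (cases "x \<in> {c<..<d}"; cases "x \<in> {a<..<b}") auto
  qed
  show "integrable (lint a b) g \<longleftrightarrow> integrable (lint c d) f"
    by (simp add: integrable_restrict_space eq)
  show "(LINT x|lint a b. g x) = (LINT x|lint c d. f x)"
    by (simp add: integral_restrict_space eq)
qed

text \<open>Cutting off at y = t replaces the moving interval (a, t) by the fixed one (a, b), as
  Fubini's theorem requires. The Gamma factor is kept outside.\<close>

definition RL_kernel :: "real \<Rightarrow> real \<Rightarrow> real \<Rightarrow> real" where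
  "RL_kernel \<beta> t y = (if y < t then (t - y) powr (\<beta> - 1) else 0)"

lemma RL_kernel_nonneg: "0 \<le> RL_kernel \<beta> t y"
  by (simp add: RL_kernel_def)

lemma RL_kernel_measurable:
  "(\<lambda>(t, y). RL_kernel \<beta> t y) \<in> borel_measurable (lint a b \<Otimes>\<^sub>M lint a b)"
proof -
  have id: "(\<lambda>x. x) \<in> borel_measurable (lint a b)"
    using id_borel_measurable_lebesgue_on by (simp add: id_def)
  have [measurable]: "fst \<in> borel_measurable (lint a b \<Otimes>\<^sub>M lint a b)"
    "snd \<in> borel_measurable (lint a b \<Otimes>\<^sub>M lint a b)"
    using measurable_compose[OF measurable_fst id] measurable_compose[OF measurable_snd id] by auto
  show ?thesis unfolding RL_kernel_def[abs_def] case_prod_beta' by measurable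
qed

lemma RL_integral_kernel:
  assumes "t \<in> {a<..<b}"
  shows "RL_integral a \<beta> f t = (1 / Gamma \<beta>) *\<^sub>R (LINT y|lint a b. RL_kernel \<beta> t y *\<^sub>R f y)"
  unfolding RL_integral_def
  by (subst lint_subinterval(2)[of a t a b _ "\<lambda>y. (t - y) powr (\<beta> - 1) *\<^sub>R f y"])
    (use assms in \<open>auto simp: RL_kernel_def\<close>)

text \<open>Since \<beta> > 0, the antiderivative is continuous up to the singularity. With the same
  bound in the other variable this is the hypothesis of a Schur test.\<close>

lemma RL_kernel_integral_snd:
  assumes t: "t \<in> {a<..<b}" and \<beta>: "0 < \<beta>"
  shows "integrable (lint a b) (\<lambda>y. RL_kernel \<beta> t y)"
    "(LINT y|lint a b. RL_kernel \<beta> t y) \<le> (b - a) powr \<beta> / \<beta>"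
proof -
  let ?F = "\<lambda>y. - ((t - y) powr \<beta> / \<beta>)"
  have D: "(?F has_real_derivative (t - y) powr (\<beta> - 1)) (at y)" if "y \<in> {a<..<t}" for y
    using that \<beta> by (auto intro!: derivative_eq_intros)
  have cont: "continuous_on {a..t} ?F"
    using \<beta> by (intro continuous_on_minus continuous_on_divide continuous_on_powr' continuous_intros) auto
  note ftc = fundamental_theorem_Ioo[OF _ D cont]
  note sub = lint_subinterval[of a t a b "\<lambda>y. RL_kernel \<beta> t y" "\<lambda>y. (t - y) powr (\<beta> - 1)"]
  have "integrable (lint a b) (\<lambda>y. RL_kernel \<beta> t y) \<longleftrightarrow> integrable (lint a t) (\<lambda>y. (t - y) powr (\<beta> - 1))"
    using t by (intro sub(1)) (auto simp: RL_kernel_def)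
  thus "integrable (lint a b) (\<lambda>y. RL_kernel \<beta> t y)" using ftc(1) t by simp
  have "(LINT y|lint a b. RL_kernel \<beta> t y) = (LINT y|lint a t. (t - y) powr (\<beta> - 1))"
    using t by (intro sub(2)) (auto simp: RL_kernel_def)
  also have "\<dots> = ?F t - ?F a" using t by (intro ftc(2)) auto
  also have "\<dots> \<le> (b - a) powr \<beta> / \<beta>"
    using t \<beta> by (auto intro!: divide_right_mono powr_mono2)
  finally show "(LINT y|lint a b. RL_kernel \<beta> t y) \<le> (b - a) powr \<beta> / \<beta>" .
qed

lemma RL_kernel_integral_fst:
  assumes y: "y \<in> {a<..<b}" and \<beta>: "0 < \<beta>"
  shows "integrable (lint a b) (\<lambda>t. RL_kernel \<beta> t y)"
    "(LINT t|lint a b. RL_kernel \<beta> t y) \<le> (b - a) powr \<beta> / \<beta>"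
proof -
  let ?F = "\<lambda>t. (t - y) powr \<beta> / \<beta>"
  have D: "(?F has_real_derivative (t - y) powr (\<beta> - 1)) (at t)" if "t \<in> {y<..<b}" for t
    using that \<beta> by (auto intro!: derivative_eq_intros)
  have cont: "continuous_on {y..b} ?F"
    using \<beta> by (intro continuous_on_divide continuous_on_powr' continuous_intros) auto
  note ftc = fundamental_theorem_Ioo[OF _ D cont]
  note sub = lint_subinterval[of y b a b "\<lambda>t. RL_kernel \<beta> t y" "\<lambda>t. (t - y) powr (\<beta> - 1)"]
  have "integrable (lint a b) (\<lambda>t. RL_kernel \<beta> t y) \<longleftrightarrow> integrable (lint y b) (\<lambda>t. (t - y) powr (\<beta> - 1))"
    using y by (intro sub(1)) (auto simp: RL_kernel_def)
  thus "integrable (lint a b) (\<lambda>t. RL_kernel \<beta> t y)" using ftc(1) y by simp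
  have "(LINT t|lint a b. RL_kernel \<beta> t y) = (LINT t|lint y b. (t - y) powr (\<beta> - 1))"
    using y by (intro sub(2)) (auto simp: RL_kernel_def)
  also have "\<dots> = ?F b - ?F y" using y by (intro ftc(2)) auto
  also have "\<dots> \<le> (b - a) powr \<beta> / \<beta>"
    using y \<beta> by (auto intro!: divide_right_mono powr_mono2)
  finally show "(LINT t|lint a b. RL_kernel \<beta> t y) \<le> (b - a) powr \<beta> / \<beta>" .
qed

text \<open>Integrating in t first leaves norm (f y) times the mass of the kernel, which is bounded
  uniformly in y.\<close>

lemma RL_kernel_product_integrable:
  fixes f :: "real \<Rightarrow> 'v::euclidean_space"
  assumes f: "integrable (lint a b) f" and \<beta>: "0 < \<beta>"
  shows "integrable (lint a b \<Otimes>\<^sub>M lint a b) (\<lambda>(y, t). RL_kernel \<beta> t y *\<^sub>R f y)"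
proof -
  interpret M: finite_measure "lint a b" by (rule finite_measure_lint)
  interpret P: pair_sigma_finite "lint a b" "lint a b" ..
  note [measurable] = borel_measurable_integrable[OF f]
  have k: "(\<lambda>z. RL_kernel \<beta> (snd z) (fst z)) \<in> borel_measurable (lint a b \<Otimes>\<^sub>M lint a b)"
    using measurable_pair_swap[OF RL_kernel_measurable[of \<beta> a b]] by (simp add: case_prod_beta')
  have m: "(\<lambda>(y, t). RL_kernel \<beta> t y *\<^sub>R f y) \<in> borel_measurable (lint a b \<Otimes>\<^sub>M lint a b)"
    unfolding case_prod_beta'
    by (rule borel_measurable_scaleR[OF k]) measurable
  have k': "(\<lambda>y. LINT t|lint a b. RL_kernel \<beta> t y) \<in> borel_measurable (lint a b)"
    by (rule M.borel_measurable_lebesgue_integral) (use k in \<open>simp add: case_prod_beta'\<close>)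
  show ?thesis
  proof (rule P.Fubini_integrable[OF m])
    have "integrable (lint a b) (\<lambda>y. norm (f y) * (LINT t|lint a b. RL_kernel \<beta> t y))"
    proof (rule Bochner_Integration.integrable_bound)
      show "integrable (lint a b) (\<lambda>y. norm (f y) * ((b - a) powr \<beta> / \<beta>))" using f by simp
      show "(\<lambda>y. norm (f y) * (LINT t|lint a b. RL_kernel \<beta> t y)) \<in> borel_measurable (lint a b)"
        using k' by measurable
      show "AE y in lint a b. norm (norm (f y) * (LINT t|lint a b. RL_kernel \<beta> t y)) \<le>
          norm (norm (f y) * ((b - a) powr \<beta> / \<beta>))"
      proof (rule AE_I2)
        fix y assume "y \<in> space (lint a b)"
        hence "(LINT t|lint a b. RL_kernel \<beta> t y) \<le> (b - a) powr \<beta> / \<beta>"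
          using RL_kernel_integral_fst(2)[OF _ \<beta>] by simp
        moreover have "0 \<le> (LINT t|lint a b. RL_kernel \<beta> t y)"
          by (intro integral_nonneg_AE AE_I2 RL_kernel_nonneg)
        ultimately have "\<bar>LINT t|lint a b. RL_kernel \<beta> t y\<bar> \<le> \<bar>(b - a) powr \<beta> / \<beta>\<bar>" by linarith
        thus "norm (norm (f y) * (LINT t|lint a b. RL_kernel \<beta> t y)) \<le>
          norm (norm (f y) * ((b - a) powr \<beta> / \<beta>))"
          unfolding real_norm_def abs_mult by (rule mult_left_mono) simp
      qed
    qed
    moreover have "(LINT t|lint a b. norm (case (y, t) of (y, t) \<Rightarrow> RL_kernel \<beta> t y *\<^sub>R f y)) =
        norm (f y) * (LINT t|lint a b. RL_kernel \<beta> t y)" for y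
      by (simp add: mult.commute abs_of_nonneg[OF RL_kernel_nonneg])
    ultimately show "integrable (lint a b)
        (\<lambda>y. LINT t|lint a b. norm (case (y, t) of (y, t) \<Rightarrow> RL_kernel \<beta> t y *\<^sub>R f y))" by (simp only:)
    show "AE y in lint a b. integrable (lint a b) (\<lambda>t. case (y, t) of (y, t) \<Rightarrow> RL_kernel \<beta> t y *\<^sub>R f y)"
      using RL_kernel_integral_fst(1)[OF _ \<beta>] by (intro AE_I2) simp
  qed
qed

lemma RL_kernel_Tonelli:
  fixes f :: "real \<Rightarrow> 'v::euclidean_space" and h :: "real \<Rightarrow> real"
  assumes \<beta>: "0 < \<beta>"
  shows "integrable (lint a b) f \<Longrightarrow> AE t in lint a b. integrable (lint a b) (\<lambda>y. RL_kernel \<beta> t y *\<^sub>R f y)"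
    "integrable (lint a b) f \<Longrightarrow> integrable (lint a b) (\<lambda>t. LINT y|lint a b. RL_kernel \<beta> t y *\<^sub>R f y)"
    "integrable (lint a b) h \<Longrightarrow> (\<And>y. 0 \<le> h y) \<Longrightarrow>
      (LINT t|lint a b. LINT y|lint a b. RL_kernel \<beta> t y * h y) \<le> (b - a) powr \<beta> / \<beta> * (LINT y|lint a b. h y)"
proof -
  interpret M: finite_measure "lint a b" by (rule finite_measure_lint)
  interpret P: pair_sigma_finite "lint a b" "lint a b" ..
  {
    assume "integrable (lint a b) f"
    note * = RL_kernel_product_integrable[OF this \<beta>]
    show "AE t in lint a b. integrable (lint a b) (\<lambda>y. RL_kernel \<beta> t y *\<^sub>R f y)"
      by (rule P.AE_integrable_snd[OF *])
    show "integrable (lint a b) (\<lambda>t. LINT y|lint a b. RL_kernel \<beta> t y *\<^sub>R f y)"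
      by (rule P.integrable_snd[OF *])
  }
  assume h: "integrable (lint a b) h" "\<And>y. 0 \<le> h y"
  note * = RL_kernel_product_integrable[OF h(1) \<beta>]
  have "(LINT t|lint a b. LINT y|lint a b. RL_kernel \<beta> t y * h y) =
      (LINT y|lint a b. LINT t|lint a b. RL_kernel \<beta> t y * h y)"
    using P.Fubini_integral[OF *] by simp
  also have "\<dots> \<le> (LINT y|lint a b. (b - a) powr \<beta> / \<beta> * h y)"
  proof (rule integral_mono)
    show "integrable (lint a b) (\<lambda>y. LINT t|lint a b. RL_kernel \<beta> t y * h y)"
      using P.integrable_fst[OF *] by simp
    show "(LINT t|lint a b. RL_kernel \<beta> t y * h y) \<le> (b - a) powr \<beta> / \<beta> * h y"
      if "y \<in> space (lint a b)" for y
    proof -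
      have "(LINT t|lint a b. RL_kernel \<beta> t y * h y) = (LINT t|lint a b. RL_kernel \<beta> t y) * h y" by simp
      also have "\<dots> \<le> (b - a) powr \<beta> / \<beta> * h y"
        using RL_kernel_integral_fst(2)[OF _ \<beta>] that h(2) by (intro mult_right_mono) auto
      finally show ?thesis .
    qed
  qed (use h in simp)
  finally show "(LINT t|lint a b. LINT y|lint a b. RL_kernel \<beta> t y * h y) \<le> (b - a) powr \<beta> / \<beta> * (LINT y|lint a b. h y)"
    by simp
qed

lemma RL_integral_cong_AE:
  fixes f g :: "real \<Rightarrow> 'v::euclidean_space"
  assumes "t \<in> {a<..<b}" "f \<in> borel_measurable (lint a b)" "g \<in> borel_measurable (lint a b)"
    "AE y in lint a b. f y = g y"
  shows "RL_integral a \<beta> f t = RL_integral a \<beta> g t"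
proof -
  have [measurable]: "(\<lambda>y. RL_kernel \<beta> t y) \<in> borel_measurable (lint a b)"
    using measurable_Pair2[OF RL_kernel_measurable[of \<beta> a b], of t] assms(1) by simp
  note [measurable] = assms(2,3)
  have "(LINT y|lint a b. RL_kernel \<beta> t y *\<^sub>R f y) = (LINT y|lint a b. RL_kernel \<beta> t y *\<^sub>R g y)"
  proof (rule integral_cong_AE)
    show "AE y in lint a b. RL_kernel \<beta> t y *\<^sub>R f y = RL_kernel \<beta> t y *\<^sub>R g y"
      using assms(4) by eventually_elim simp
  qed measurable
  thus ?thesis by (simp add: RL_integral_kernel[OF assms(1)])
qed

text \<open>Only for almost every t are the singular integrands known to be integrable; elsewhere an
  integral may take its default value 0 and additivity can fail.\<close>

lemma RL_integral_lincomb: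
  fixes f g :: "real \<Rightarrow> 'v::euclidean_space"
  assumes f: "integrable (lint a b) f" and g: "integrable (lint a b) g" and \<beta>: "0 < \<beta>"
  shows "AE t in lint a b. RL_integral a \<beta> (\<lambda>y. c *\<^sub>R f y + d *\<^sub>R g y) t =
    c *\<^sub>R RL_integral a \<beta> f t + d *\<^sub>R RL_integral a \<beta> g t"
  using RL_kernel_Tonelli(1)[OF \<beta> f] RL_kernel_Tonelli(1)[OF \<beta> g] AE_space
proof eventually_elim
  fix t
  assume F: "integrable (lint a b) (\<lambda>y. RL_kernel \<beta> t y *\<^sub>R f y)"
    and G: "integrable (lint a b) (\<lambda>y. RL_kernel \<beta> t y *\<^sub>R g y)" and t: "t \<in> space (lint a b)"
  have t': "t \<in> {a<..<b}" using t by simp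
  have "(LINT y|lint a b. RL_kernel \<beta> t y *\<^sub>R (c *\<^sub>R f y + d *\<^sub>R g y)) =
      (LINT y|lint a b. c *\<^sub>R (RL_kernel \<beta> t y *\<^sub>R f y) + d *\<^sub>R (RL_kernel \<beta> t y *\<^sub>R g y))"
    by (simp add: scaleR_add_right mult.commute)
  also have "\<dots> = c *\<^sub>R (LINT y|lint a b. RL_kernel \<beta> t y *\<^sub>R f y) + d *\<^sub>R (LINT y|lint a b. RL_kernel \<beta> t y *\<^sub>R g y)"
    using F G by (subst Bochner_Integration.integral_add) (simp_all del: scaleR_scaleR)
  finally show "RL_integral a \<beta> (\<lambda>y. c *\<^sub>R f y + d *\<^sub>R g y) t =
    c *\<^sub>R RL_integral a \<beta> f t + d *\<^sub>R RL_integral a \<beta> g t"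
    unfolding RL_integral_kernel[OF t'] by (simp add: scaleR_add_right)
qed

lemma norm_RL_integral_le_sup:
  fixes f :: "real \<Rightarrow> 'v::euclidean_space"
  assumes f: "f \<in> borel_measurable (lint a b)" "\<And>y. y \<in> {a<..<b} \<Longrightarrow> norm (f y) \<le> e"
    and t: "t \<in> {a<..<b}" and \<beta>: "0 < \<beta>"
  shows "norm (RL_integral a \<beta> f t) \<le> 1 / Gamma \<beta> * (e * ((b - a) powr \<beta> / \<beta>))"
proof -
  note k = RL_kernel_integral_snd[OF t \<beta>]
  note [measurable] = f(1) borel_measurable_integrable[OF k(1)]
  have e: "0 \<le> e" using f(2)[OF t] norm_ge_zero order_trans by blast
  have bound: "norm (RL_kernel \<beta> t y *\<^sub>R f y) \<le> e * RL_kernel \<beta> t y" if "y \<in> space (lint a b)" for y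
    using f(2)[of y] that RL_kernel_nonneg[of \<beta> t y] by (simp add: mult.commute mult_right_mono)
  have int: "integrable (lint a b) (\<lambda>y. RL_kernel \<beta> t y *\<^sub>R f y)"
  proof (rule Bochner_Integration.integrable_bound)
    show "integrable (lint a b) (\<lambda>y. e * RL_kernel \<beta> t y)" using k by simp
    show "AE y in lint a b. norm (RL_kernel \<beta> t y *\<^sub>R f y) \<le> norm (e * RL_kernel \<beta> t y)"
      using bound by (intro AE_I2) (metis abs_ge_self order_trans real_norm_def)
  qed measurable
  have "norm (LINT y|lint a b. RL_kernel \<beta> t y *\<^sub>R f y) \<le> (LINT y|lint a b. e * RL_kernel \<beta> t y)"
    by (rule order_trans[OF integral_norm_bound integral_mono[OF integrable_norm[OF int] _ bound]])
      (use k in simp)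
  also have "\<dots> \<le> e * ((b - a) powr \<beta> / \<beta>)" using mult_left_mono[OF k(2) e] by simp
  finally have *: "norm (LINT y|lint a b. RL_kernel \<beta> t y *\<^sub>R f y) \<le> e * ((b - a) powr \<beta> / \<beta>)" .
  show ?thesis
    unfolding RL_integral_kernel[OF t] norm_scaleR
    using mult_left_mono[OF *, of "1 / Gamma \<beta>"] Gamma_real_pos[OF \<beta>] by simp
qed

text \<open>Applying Young's inequality under the kernel and then Tonelli replaces the boundedness of
  the fractional integral on \<open>L\<^sup>p\<close>.\<close>

lemma RL_integral_pairing_bound:
  fixes f h :: "real \<Rightarrow> 'v::euclidean_space"
  assumes f: "f \<in> Lp a b p" and h: "h \<in> Lp a b (p / (p - 1))" and p: "1 < p" and \<beta>: "0 < \<beta>" and c: "0 < c"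
  obtains B where "integrable (lint a b) B"
    "AE t in lint a b. norm (h t) * norm (RL_integral a \<beta> f t) \<le> B t"
    "(LINT t|lint a b. B t) \<le> 1 / Gamma \<beta> * ((b - a) powr \<beta> / \<beta>) *
       (c * powr_int a b (p / (p - 1)) h + c powr (1 - p) * powr_int a b p f)"
proof -
  define q where "q = p / (p - 1)"
  define K where "K = (b - a) powr \<beta> / \<beta>"
  have K: "0 \<le> K" using \<beta> by (simp add: K_def)
  have G: "0 < Gamma \<beta>" by (rule Gamma_real_pos[OF \<beta>])
  define J where "J t = (LINT y|lint a b. RL_kernel \<beta> t y * norm (f y) powr p)" for t
  note fp = Lp_powr_integrable[OF f] and hq = Lp_powr_integrable[OF h, folded q_def]
  have intf: "integrable (lint a b) f" by (rule Lp_integrable(1)[OF f p])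
  have Jint: "integrable (lint a b) J"
    using RL_kernel_Tonelli(2)[OF \<beta> fp] by (simp add: J_def[abs_def])
  have Jle: "(LINT t|lint a b. J t) \<le> K * powr_int a b p f"
    using RL_kernel_Tonelli(3)[OF \<beta> fp] by (simp add: J_def K_def powr_int_def)
  \<comment> \<open>In the h term the kernel is integrated over y at fixed t, which gives the factor
    K at once. The f term keeps \<open>J\<close>, whose total integral Tonelli bounds by the same
    K.\<close>
  define B where "B t = 1 / Gamma \<beta> * (c * K * norm (h t) powr q + c powr (1 - p) * J t)" for t
  have Bint: "integrable (lint a b) B" unfolding B_def using hq Jint by simp
  have "AE t in lint a b. norm (h t) * norm (RL_integral a \<beta> f t) \<le> B t"
    using RL_kernel_Tonelli(1)[OF \<beta> intf] RL_kernel_Tonelli(1)[OF \<beta> fp] AE_space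
  proof eventually_elim
    fix t
    assume I1: "integrable (lint a b) (\<lambda>y. RL_kernel \<beta> t y *\<^sub>R f y)"
      and I2: "integrable (lint a b) (\<lambda>y. RL_kernel \<beta> t y *\<^sub>R (norm (f y) powr p))"
      and "t \<in> space (lint a b)"
    hence t: "t \<in> {a<..<b}" by simp
    note k = RL_kernel_integral_snd[OF t \<beta>]
    have "norm (h t) * norm (LINT y|lint a b. RL_kernel \<beta> t y *\<^sub>R f y) \<le>
        norm (h t) * (LINT y|lint a b. norm (RL_kernel \<beta> t y *\<^sub>R f y))"
      by (intro mult_left_mono integral_norm_bound) simp
    also have "\<dots> = (LINT y|lint a b. norm (h t) * norm (RL_kernel \<beta> t y *\<^sub>R f y))" by simp
    also have "\<dots> \<le> (LINT y|lint a b. c * norm (h t) powr q * RL_kernel \<beta> t y +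
        c powr (1 - p) * (RL_kernel \<beta> t y * norm (f y) powr p))"
    proof (rule integral_mono)
      show "integrable (lint a b) (\<lambda>y. norm (h t) * norm (RL_kernel \<beta> t y *\<^sub>R f y))"
        using integrable_norm[OF I1] by (rule integrable_mult_right)
      show "integrable (lint a b) (\<lambda>y. c * norm (h t) powr q * RL_kernel \<beta> t y +
        c powr (1 - p) * (RL_kernel \<beta> t y * norm (f y) powr p))"
        using k(1) I2 by simp
      fix y
      have "norm (h t) * norm (f y) \<le> c * norm (h t) powr q + c powr (1 - p) * norm (f y) powr p"
        unfolding q_def by (rule mult_le_powr_add) (use c p in auto)
      from mult_left_mono[OF this RL_kernel_nonneg[of \<beta> t y]]
      show "norm (h t) * norm (RL_kernel \<beta> t y *\<^sub>R f y) \<le> c * norm (h t) powr q * RL_kernel \<beta> t y +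
        c powr (1 - p) * (RL_kernel \<beta> t y * norm (f y) powr p)"
        using RL_kernel_nonneg[of \<beta> t y] by (simp add: algebra_simps)
    qed
    also have "\<dots> = c * norm (h t) powr q * (LINT y|lint a b. RL_kernel \<beta> t y) + c powr (1 - p) * J t"
      using k(1) I2 by (simp add: J_def)
    also have "\<dots> \<le> c * norm (h t) powr q * K + c powr (1 - p) * J t"
      unfolding K_def using c k(2) by (intro add_right_mono mult_left_mono) auto
    finally have "1 / Gamma \<beta> * (norm (h t) * norm (LINT y|lint a b. RL_kernel \<beta> t y *\<^sub>R f y)) \<le> B t"
      unfolding B_def using G by (intro mult_left_mono) (auto simp: mult_ac)
    thus "norm (h t) * norm (RL_integral a \<beta> f t) \<le> B t"
      unfolding RL_integral_kernel[OF t] using G by (simp add: mult_ac)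
  qed
  moreover have "(LINT t|lint a b. B t) = 1 / Gamma \<beta> * (c * K * powr_int a b q h + c powr (1 - p) * (LINT t|lint a b. J t))"
    unfolding B_def powr_int_def using hq Jint by simp
  hence "(LINT t|lint a b. B t) \<le> 1 / Gamma \<beta> * K * (c * powr_int a b q h + c powr (1 - p) * powr_int a b p f)"
  proof -
    have "c powr (1 - p) * (LINT t|lint a b. J t) \<le> c powr (1 - p) * (K * powr_int a b p f)"
      by (intro mult_left_mono Jle) simp
    from add_left_mono[OF this, of "c * K * powr_int a b q h"]
    have "1 / Gamma \<beta> * (c * K * powr_int a b q h + c powr (1 - p) * (LINT t|lint a b. J t)) \<le>
        1 / Gamma \<beta> * (c * K * powr_int a b q h + c powr (1 - p) * (K * powr_int a b p f))"
      using G by (intro mult_left_mono) auto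
    thus ?thesis using \<open>(LINT t|lint a b. B t) = _\<close> by (simp add: algebra_simps)
  qed
  ultimately show ?thesis using that[OF Bint] unfolding q_def K_def by blast
qed

section \<open>Convexity and lower semicontinuity of the action\<close>

lemma lagr_arg_lincomb:
  fixes u v :: "real \<Rightarrow> real ^ 'd::finite"
  assumes u: "u \<in> W1p a b p" and v: "v \<in> W1p a b p" and p: "1 < p" and \<alpha>: "0 < \<alpha>" "\<alpha> < 1"
  shows "AE t in lint a b. fst (lagr_arg a b \<alpha> (\<lambda>t. c *\<^sub>R u t + d *\<^sub>R v t) t) =
    c *\<^sub>R fst (lagr_arg a b \<alpha> u t) + d *\<^sub>R fst (lagr_arg a b \<alpha> v t)"
proof -
  note U = weak_deriv_W1p[OF u p] and V = weak_deriv_W1p[OF v p]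
  let ?w = "\<lambda>t. c *\<^sub>R u t + d *\<^sub>R v t"
  note W = W1p_lincomb[OF u v p, of c d]
  have wd: "weak_deriv a b ?w \<in> borel_measurable (lint a b)"
    by (rule Lp_measurable[OF weak_deriv_W1p(1)[OF W(1) p]])
  have wd': "(\<lambda>t. c *\<^sub>R weak_deriv a b u t + d *\<^sub>R weak_deriv a b v t) \<in> borel_measurable (lint a b)"
    using U(3) V(3) by (intro borel_measurable_integrable) simp
  have \<alpha>': "0 < 1 - \<alpha>" using \<alpha> by simp
  show ?thesis
    using RL_integral_lincomb[OF Lp_integrable(1)[OF W1pD(3)[OF u] p] Lp_integrable(1)[OF W1pD(3)[OF v] p] \<alpha>(1), of c d]
      RL_integral_lincomb[OF U(3) V(3) \<alpha>', of c d] W(2) AE_space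
  proof eventually_elim
    fix t
    assume rl: "RL_integral a \<alpha> ?w t = c *\<^sub>R RL_integral a \<alpha> u t + d *\<^sub>R RL_integral a \<alpha> v t"
      and cap: "RL_integral a (1 - \<alpha>) (\<lambda>y. c *\<^sub>R weak_deriv a b u y + d *\<^sub>R weak_deriv a b v y) t =
        c *\<^sub>R RL_integral a (1 - \<alpha>) (weak_deriv a b u) t + d *\<^sub>R RL_integral a (1 - \<alpha>) (weak_deriv a b v) t"
      and w: "weak_deriv a b ?w t = c *\<^sub>R weak_deriv a b u t + d *\<^sub>R weak_deriv a b v t"
      and t: "t \<in> space (lint a b)"
    \<comment> \<open>The selected derivative of the combination is the combination of derivatives
      only almost everywhere, which a fractional integral does not notice.\<close>
    have "RL_integral a (1 - \<alpha>) (weak_deriv a b ?w) t =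
        RL_integral a (1 - \<alpha>) (\<lambda>y. c *\<^sub>R weak_deriv a b u y + d *\<^sub>R weak_deriv a b v y) t"
      using t by (intro RL_integral_cong_AE[OF _ wd wd' W(2)]) simp
    thus "fst (lagr_arg a b \<alpha> ?w t) = c *\<^sub>R fst (lagr_arg a b \<alpha> u t) + d *\<^sub>R fst (lagr_arg a b \<alpha> v t)"
      using rl cap w by (simp add: lagr_arg_def caputo_def)
  qed
qed

lemma snd_lagr_arg [simp]: "snd (lagr_arg a b \<alpha> u t) = t"
  by (simp add: lagr_arg_def)

lemma lagr_arg_eq: "lagr_arg a b \<alpha> u t = (fst (lagr_arg a b \<alpha> u t), t)"
  by (simp add: prod_eq_iff)

lemma regular_integrable:
  assumes "regular a b p \<alpha> L" "u \<in> W1p a b p"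
  shows "integrable (lint a b) (\<lambda>t. L (lagr_arg a b \<alpha> u t))"
  using assms Lp_1_iff unfolding regular_def Let_def by blast

text \<open>Pointwise convexity under the integral. It is stated on all of \<open>W1p\<close>
  because midpoints of elements of \<open>E\<close> may leave \<open>E\<close>; regularity keeps all
  three integrals finite.\<close>

lemma action_midpoint:
  fixes u v :: "real \<Rightarrow> real ^ 'd::finite"
  assumes u: "u \<in> W1p a b p" and v: "v \<in> W1p a b p" and p: "1 < p" and \<alpha>: "0 < \<alpha>" "\<alpha> < 1"
    and reg: "regular a b p \<alpha> L"
    and conv: "\<And>t. t \<in> {a..b} \<Longrightarrow> convex_on UNIV (\<lambda>x. L (x, t))"
  shows "action a b \<alpha> L (midpoint_fun u v) \<le> (action a b \<alpha> L u + action a b \<alpha> L v) / 2"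
proof -
  note int = regular_integrable[OF reg u] regular_integrable[OF reg v]
    regular_integrable[OF reg W1p_midpoint(1)[OF u v p]]
  have "AE t in lint a b. L (lagr_arg a b \<alpha> (midpoint_fun u v) t) \<le>
      (L (lagr_arg a b \<alpha> u t) + L (lagr_arg a b \<alpha> v t)) / 2"
    using lagr_arg_lincomb[OF u v p \<alpha>, of "1/2" "1/2"] AE_space
  proof eventually_elim
    fix t
    let ?x = "fst (lagr_arg a b \<alpha> u t)" and ?y = "fst (lagr_arg a b \<alpha> v t)"
    assume eq: "fst (lagr_arg a b \<alpha> (\<lambda>t. (1/2) *\<^sub>R u t + (1/2) *\<^sub>R v t) t) = (1/2) *\<^sub>R ?x + (1/2) *\<^sub>R ?y"
      and "t \<in> space (lint a b)"
    hence t: "t \<in> {a..b}" by simp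
    have "L (lagr_arg a b \<alpha> (midpoint_fun u v) t) = L ((1/2) *\<^sub>R ?x + (1/2) *\<^sub>R ?y, t)"
      using eq lagr_arg_eq[of a b \<alpha> "midpoint_fun u v" t] by (simp add: midpoint_fun_def scaleR_add_right)
    also have "\<dots> \<le> (1/2) * L (?x, t) + (1/2) * L (?y, t)"
      using convex_onD[OF conv[OF t], of "1/2" ?x ?y] by simp
    also have "L (?x, t) = L (lagr_arg a b \<alpha> u t)" using lagr_arg_eq[of a b \<alpha> u t] by simp
    also have "L (?y, t) = L (lagr_arg a b \<alpha> v t)" using lagr_arg_eq[of a b \<alpha> v t] by simp
    finally show "L (lagr_arg a b \<alpha> (midpoint_fun u v) t) \<le>
      (L (lagr_arg a b \<alpha> u t) + L (lagr_arg a b \<alpha> v t)) / 2" by simp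
  qed
  hence "action a b \<alpha> L (midpoint_fun u v) \<le> (LINT t|lint a b. (L (lagr_arg a b \<alpha> u t) + L (lagr_arg a b \<alpha> v t)) / 2)"
    unfolding action_def using int by (intro integral_mono_AE) auto
  also have "\<dots> = (action a b \<alpha> L u + action a b \<alpha> L v) / 2"
    unfolding action_def using int by simp
  finally show ?thesis .
qed

section \<open>Tangent inequality for the Lagrangian\<close>

lemma convex_on_above_tangent:
  fixes g :: "'a::real_normed_vector \<Rightarrow> real"
  assumes conv: "convex_on UNIV g" and D: "(g has_derivative D) (at x)"
  shows "g x + D (y - x) \<le> g y"
proof -
  \<comment> \<open>Restriction to the line through x and y reduces the claim to a convex function
    of one real variable.\<close>
  define h where "h s = g (x + s *\<^sub>R (y - x))" for s :: real
  have "convex_on UNIV h"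
  proof (rule convex_onI)
    fix t s r :: real assume t: "0 < t" "t < 1"
    have "x + ((1 - t) *\<^sub>R s + t *\<^sub>R r) *\<^sub>R (y - x) =
        (1 - t) *\<^sub>R (x + s *\<^sub>R (y - x)) + t *\<^sub>R (x + r *\<^sub>R (y - x))"
      by (simp add: algebra_simps)
    thus "h ((1 - t) *\<^sub>R s + t *\<^sub>R r) \<le> (1 - t) * h s + t * h r"
      unfolding h_def using convex_onD[OF conv, of t] t by simp
  qed simp
  moreover have "(h has_real_derivative D (y - x)) (at 0)"
  proof -
    interpret D: bounded_linear D by (rule has_derivative_bounded_linear[OF D])
    have line: "((\<lambda>s. x + s *\<^sub>R (y - x)) has_derivative (\<lambda>s. s *\<^sub>R (y - x))) (at 0)"
      by (auto intro!: derivative_eq_intros)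
    have "(h has_derivative (\<lambda>s. D (s *\<^sub>R (y - x)))) (at 0)"
      unfolding h_def using has_derivative_compose[OF line, of g D] D by simp
    moreover have "(\<lambda>s. D (s *\<^sub>R (y - x))) = (*) (D (y - x))"
      by (simp add: D.scaleR fun_eq_iff)
    ultimately show ?thesis by (simp add: has_field_derivative_def)
  qed
  ultimately have "D (y - x) * (1 - 0) \<le> h 1 - h 0"
    by (intro convex_on_imp_above_tangent[where A = UNIV]) auto
  thus ?thesis by (simp add: h_def)
qed

text \<open>Representing the derivative by an inner product shows that the description in
  \<open>grad\<close> has exactly one solution.\<close>

lemma grad_inner:
  fixes f :: "'v::euclidean_space \<Rightarrow> real"
  assumes D: "(f has_derivative D) (at x)"
  shows "h \<bullet> grad f x = D h"
proof -
  interpret D: bounded_linear D by (rule has_derivative_bounded_linear[OF D])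
  define G where "G = (\<Sum>b\<in>Basis. D b *\<^sub>R b)"
  have rep: "D = (\<lambda>h. h \<bullet> G)"
  proof
    fix h
    have "D h = D (\<Sum>b\<in>Basis. (h \<bullet> b) *\<^sub>R b)" by (simp add: euclidean_representation)
    also have "\<dots> = h \<bullet> G" by (simp add: D.sum D.scaleR G_def inner_sum_right mult.commute)
    finally show "D h = h \<bullet> G" .
  qed
  have "grad f x = G" unfolding grad_def
  proof (rule the_equality)
    show "GDERIV f x :> G" using D rep by (simp add: gderiv_def)
    fix G' assume "GDERIV f x :> G'"
    hence "(\<lambda>h. h \<bullet> G') = (\<lambda>h. h \<bullet> G)"
      unfolding gderiv_def using D rep has_derivative_unique by metis
    hence "(G' - G) \<bullet> G' = (G' - G) \<bullet> G" by meson
    hence "(G' - G) \<bullet> (G' - G) = 0" by (simp add: inner_diff_right)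
    thus "G' = G" by simp
  qed
  thus ?thesis using rep by simp
qed

text \<open>The total derivative in x is linear, so its value at (h1, h2, h3, h4) splits into the
  four partial gradients; the rest is convexity.\<close>

lemma lagrangian_above_tangent:
  fixes L :: "'d::finite phase \<times> real \<Rightarrow> real"
  assumes C1: "C1_on (UNIV \<times> {a..b}) L" and t: "t \<in> {a..b}"
    and conv: "convex_on UNIV (\<lambda>x. L (x, t))"
  shows "L (x, t) + (h1 \<bullet> partial1 L (x, t) + h2 \<bullet> partial2 L (x, t) + h3 \<bullet> partial3 L (x, t) + h4 \<bullet> partial4 L (x, t))
    \<le> L (x + (h1, h2, h3, h4), t)"
proof -
  obtain x1 x2 x3 x4 where x: "x = (x1, x2, x3, x4)" by (metis prod.collapse)
  obtain D' where "(L has_derivative blinfun_apply D') (at (x, t) within UNIV \<times> {a..b})"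
    using C1 t unfolding C1_on_def by blast
  \<comment> \<open>Restricting to the slice of fixed t turns a derivative within the strip into a
    full derivative in x, also at t = a and t = b.\<close>
  hence "(L has_derivative blinfun_apply D') (at (x, t) within (\<lambda>x. (x, t)) ` UNIV)"
    by (rule has_derivative_subset) (use t in auto)
  moreover have "((\<lambda>x. (x, t)) has_derivative (\<lambda>h. (h, 0))) (at x)"
    by (auto intro!: derivative_eq_intros)
  ultimately have D: "((\<lambda>x. L (x, t)) has_derivative (\<lambda>h. blinfun_apply D' (h, 0))) (at x)"
    using has_derivative_in_compose by blast
  define D where "D h = blinfun_apply D' (h, 0)" for h
  have D: "((\<lambda>x. L (x, t)) has_derivative D) (at x)" using D by (simp add: D_def[abs_def])
  interpret D: bounded_linear D by (rule has_derivative_bounded_linear[OF D])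
  have slice: "h \<bullet> grad (\<lambda>y. L (i y, t)) y = D (i' h)"
    if "(i has_derivative i') (at y)" "i y = x" for i :: "real ^ 'd \<Rightarrow> 'd phase" and i' y h
  proof (rule grad_inner)
    show "((\<lambda>y. L (i y, t)) has_derivative (\<lambda>h. D (i' h))) (at y)"
      using has_derivative_compose[OF that(1), of "\<lambda>x. L (x, t)" D] D that(2) by simp
  qed
  note intros = has_derivative_Pair has_derivative_ident has_derivative_const
  have "h1 \<bullet> partial1 L (x, t) = D (h1, 0, 0, 0)"
    unfolding partial1_def x prod.case
    by (rule slice[where i = "\<lambda>y. (y, x2, x3, x4)" and i' = "\<lambda>h. (h, 0, 0, 0)"]) (intro intros, simp add: x)
  moreover have "h2 \<bullet> partial2 L (x, t) = D (0, h2, 0, 0)"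
    unfolding partial2_def x prod.case
    by (rule slice[where i = "\<lambda>y. (x1, y, x3, x4)" and i' = "\<lambda>h. (0, h, 0, 0)"]) (intro intros, simp add: x)
  moreover have "h3 \<bullet> partial3 L (x, t) = D (0, 0, h3, 0)"
    unfolding partial3_def x prod.case
    by (rule slice[where i = "\<lambda>y. (x1, x2, y, x4)" and i' = "\<lambda>h. (0, 0, h, 0)"]) (intro intros, simp add: x)
  moreover have "h4 \<bullet> partial4 L (x, t) = D (0, 0, 0, h4)"
    unfolding partial4_def x prod.case
    by (rule slice[where i = "\<lambda>y. (x1, x2, x3, y)" and i' = "\<lambda>h. (0, 0, 0, h)"]) (intro intros, simp add: x)
  moreover have "D (h1, h2, h3, h4) = D (h1, 0, 0, 0) + D (0, h2, 0, 0) + D (0, 0, h3, 0) + D (0, 0, 0, h4)"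
    by (simp flip: D.add)
  ultimately show ?thesis
    using convex_on_above_tangent[OF conv D, of "x + (h1, h2, h3, h4)"] by simp
qed

text \<open>The tangent at w produces four pairings of components of u - w with gradients. The first
  two are controlled by the uniform bound e, the third by Young's inequality and the fourth by
  Young's inequality under the kernel. The constants are fixed before u, e and c, so a sequence can
  be inserted for u and both parameters sent to 0 afterwards.\<close>

lemma action_lower_bound:
  fixes w :: "real \<Rightarrow> real ^ 'd::finite" and L :: "'d phase \<times> real \<Rightarrow> real"
  assumes ab: "a < b" and p: "1 < p" and \<alpha>: "0 < \<alpha>" "\<alpha> < 1" and w: "w \<in> W1p a b p"
    and C1: "C1_on (UNIV \<times> {a..b}) L" and reg: "regular a b p \<alpha> L"
    and conv: "\<And>t. t \<in> {a..b} \<Longrightarrow> convex_on UNIV (\<lambda>x. L (x, t))"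
  obtains A1 A2 A3 where "\<And>u e c. u \<in> W1p a b p \<Longrightarrow> \<forall>t\<in>{a..b}. norm (u t - w t) \<le> e \<Longrightarrow> 0 < c \<Longrightarrow>
    action a b \<alpha> L w \<le> action a b \<alpha> L u + e * A1 + c * A2 + c powr (1 - p) * (A3 * W1p_gauge a b p u w)"
proof -
  define q where "q = p / (p - 1)"
  have q: "1 < q" using p by (simp add: q_def)
  define P1 where "P1 t = partial1 L (lagr_arg a b \<alpha> w t)" for t
  define P2 where "P2 t = partial2 L (lagr_arg a b \<alpha> w t)" for t
  define P3 where "P3 t = partial3 L (lagr_arg a b \<alpha> w t)" for t
  define P4 where "P4 t = partial4 L (lagr_arg a b \<alpha> w t)" for t
  have "P1 \<in> Lp a b 1 \<and> P2 \<in> Lp a b q \<and> P3 \<in> Lp a b q \<and> P4 \<in> Lp a b q"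
    using reg w unfolding regular_def Let_def P1_def[abs_def] P2_def[abs_def] P3_def[abs_def] P4_def[abs_def] q_def
    by blast
  hence P1: "integrable (lint a b) P1" and P2': "P2 \<in> Lp a b q" and P3: "P3 \<in> Lp a b q" and P4: "P4 \<in> Lp a b q"
    using Lp_1_iff by blast+
  have P2: "integrable (lint a b) P2" by (rule Lp_integrable(1)[OF P2' q])
  define K2 where "K2 = 1 / Gamma \<alpha> * ((b - a) powr \<alpha> / \<alpha>)"
  define K3 where "K3 = 1 / Gamma (1 - \<alpha>) * ((b - a) powr (1 - \<alpha>) / (1 - \<alpha>))"
  have \<alpha>': "0 < 1 - \<alpha>" using \<alpha> by simp
  have K3: "0 \<le> K3" using Gamma_real_pos[OF \<alpha>'] \<alpha> by (simp add: K3_def)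
  define A1 where "A1 = (LINT t|lint a b. norm (P1 t)) + K2 * (LINT t|lint a b. norm (P2 t))"
  define A2 where "A2 = powr_int a b q P3 + K3 * powr_int a b q P4"
  define A3 where "A3 = 1 + K3"
  show ?thesis
  proof (rule that)
    fix u :: "real \<Rightarrow> real ^ 'd" and e c :: real
    assume u: "u \<in> W1p a b p" and e': "\<forall>t\<in>{a..b}. norm (u t - w t) \<le> e" and c: "0 < c"
    have e: "norm (u t - w t) \<le> e" if "t \<in> {a..b}" for t using e' that by blast
    define v where "v t = u t - w t" for t
    have v: "v \<in> W1p a b p" using W1p_diff(1)[OF u w p] by (simp add: v_def[abs_def])
    note dv = weak_deriv_W1p(1)[OF v p]
    have dvp: "powr_int a b p (weak_deriv a b v) \<le> W1p_gauge a b p u w"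
      using W1p_energy_diff[OF u w p] powr_int_nonneg[of a b p v] by (simp add: W1p_energy_def v_def[abs_def])
    obtain B where B: "integrable (lint a b) B"
      "AE t in lint a b. norm (P4 t) * norm (RL_integral a (1 - \<alpha>) (weak_deriv a b v) t) \<le> B t"
      "(LINT t|lint a b. B t) \<le> 1 / Gamma (1 - \<alpha>) * ((b - a) powr (1 - \<alpha>) / (1 - \<alpha>)) *
       (c * powr_int a b (p / (p - 1)) P4 + c powr (1 - p) * powr_int a b p (weak_deriv a b v))"
      using RL_integral_pairing_bound[OF dv P4[unfolded q_def] p \<alpha>' c] by blast
    let ?E = "\<lambda>t. L (lagr_arg a b \<alpha> u t) + (e * norm (P1 t) + e * K2 * norm (P2 t) +
        (c * norm (P3 t) powr q + c powr (1 - p) * norm (weak_deriv a b v t) powr p) + B t)"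
    have "AE t in lint a b. L (lagr_arg a b \<alpha> w t) \<le> ?E t"
      using B(2) lagr_arg_lincomb[OF u w p \<alpha>, of 1 "-1"] AE_space
    proof eventually_elim
      fix t
      assume Bt: "norm (P4 t) * norm (RL_integral a (1 - \<alpha>) (weak_deriv a b v) t) \<le> B t"
        and lin: "fst (lagr_arg a b \<alpha> (\<lambda>t. 1 *\<^sub>R u t + (-1) *\<^sub>R w t) t) =
          1 *\<^sub>R fst (lagr_arg a b \<alpha> u t) + (-1) *\<^sub>R fst (lagr_arg a b \<alpha> w t)"
        and "t \<in> space (lint a b)"
      hence t: "t \<in> {a<..<b}" and t': "t \<in> {a..b}" by auto
      let ?x = "fst (lagr_arg a b \<alpha> w t)"
      have "fst (lagr_arg a b \<alpha> v t) = fst (lagr_arg a b \<alpha> u t) - ?x"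
        using lin by (simp add: v_def[abs_def])
      hence x: "?x + (v t, RL_integral a \<alpha> v t, weak_deriv a b v t, caputo a b \<alpha> v t) = fst (lagr_arg a b \<alpha> u t)"
        by (simp add: lagr_arg_def)
      have "L (?x, t) + (v t \<bullet> partial1 L (?x, t) + RL_integral a \<alpha> v t \<bullet> partial2 L (?x, t) +
          weak_deriv a b v t \<bullet> partial3 L (?x, t) + caputo a b \<alpha> v t \<bullet> partial4 L (?x, t)) \<le>
          L (fst (lagr_arg a b \<alpha> u t), t)"
        using lagrangian_above_tangent[OF C1 t' conv[OF t'], of ?x "v t" "RL_integral a \<alpha> v t"
            "weak_deriv a b v t" "caputo a b \<alpha> v t"] unfolding x .
      hence main: "L (lagr_arg a b \<alpha> w t) + (v t \<bullet> P1 t + RL_integral a \<alpha> v t \<bullet> P2 t +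
          weak_deriv a b v t \<bullet> P3 t + caputo a b \<alpha> v t \<bullet> P4 t) \<le> L (lagr_arg a b \<alpha> u t)"
        unfolding P1_def P2_def P3_def P4_def by (simp only: lagr_arg_eq[symmetric])
      have cs: "- (x \<bullet> y) \<le> norm x * norm y" for x y :: "real ^ 'd"
        using Cauchy_Schwarz_ineq2[of x y] by linarith
      have 1: "- (v t \<bullet> P1 t) \<le> e * norm (P1 t)"
        using cs[of "v t" "P1 t"] mult_right_mono[OF e[OF t'], of "norm (P1 t)"] by (simp add: v_def)
      have "norm (RL_integral a \<alpha> v t) \<le> 1 / Gamma \<alpha> * (e * ((b - a) powr \<alpha> / \<alpha>))"
        using e by (intro norm_RL_integral_le_sup[OF Lp_measurable[OF W1pD(3)[OF v]] _ t \<alpha>(1)])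
          (simp add: v_def)
      hence "norm (RL_integral a \<alpha> v t) \<le> e * K2" by (simp add: K2_def)
      hence 2: "- (RL_integral a \<alpha> v t \<bullet> P2 t) \<le> e * K2 * norm (P2 t)"
        using cs[of "RL_integral a \<alpha> v t" "P2 t"] mult_right_mono[of _ "e * K2" "norm (P2 t)"] by fastforce
      have 3: "- (weak_deriv a b v t \<bullet> P3 t) \<le>
          c * norm (P3 t) powr q + c powr (1 - p) * norm (weak_deriv a b v t) powr p"
        using cs[of "weak_deriv a b v t" "P3 t"]
          mult_le_powr_add[of "norm (P3 t)" "norm (weak_deriv a b v t)" c p] c p
        unfolding q_def by (simp add: mult.commute)
      have 4: "- (caputo a b \<alpha> v t \<bullet> P4 t) \<le> B t"
        using cs[of "caputo a b \<alpha> v t" "P4 t"] Bt unfolding caputo_def by (simp add: mult.commute)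
      show "L (lagr_arg a b \<alpha> w t) \<le> ?E t" using main 1 2 3 4 by linarith
    qed
    moreover note int = regular_integrable[OF reg u] P1 P2 Lp_powr_integrable[OF P3]
      Lp_powr_integrable[OF dv] B(1)
    ultimately have "action a b \<alpha> L w \<le> (LINT t|lint a b. ?E t)"
      unfolding action_def using regular_integrable[OF reg w] by (intro integral_mono_AE) auto
    also have "\<dots> = action a b \<alpha> L u + (e * (LINT t|lint a b. norm (P1 t)) + e * K2 * (LINT t|lint a b. norm (P2 t)) +
        (c * powr_int a b q P3 + c powr (1 - p) * powr_int a b p (weak_deriv a b v)) + (LINT t|lint a b. B t))"
      unfolding action_def powr_int_def using int by simp
    finally have le: "action a b \<alpha> L w \<le> action a b \<alpha> L u + (e * (LINT t|lint a b. norm (P1 t)) +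
        e * K2 * (LINT t|lint a b. norm (P2 t)) +
        (c * powr_int a b q P3 + c powr (1 - p) * powr_int a b p (weak_deriv a b v)) + (LINT t|lint a b. B t))" .
    have B3: "(LINT t|lint a b. B t) \<le> K3 * (c * powr_int a b q P4 + c powr (1 - p) * powr_int a b p (weak_deriv a b v))"
      using B(3) unfolding K3_def q_def .
    have "c powr (1 - p) * (A3 * powr_int a b p (weak_deriv a b v)) \<le> c powr (1 - p) * (A3 * W1p_gauge a b p u w)"
      using dvp K3 by (intro mult_left_mono) (auto simp: A3_def)
    thus "action a b \<alpha> L w \<le> action a b \<alpha> L u + e * A1 + c * A2 + c powr (1 - p) * (A3 * W1p_gauge a b p u w)"
      using le B3 unfolding A1_def A2_def A3_def by (simp add: algebra_simps)
  qed
qed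

text \<open>Two limits in this order: with c = e fixed, the gauge term vanishes along the sequence
  in spite of its factor e^(1-p); only then does e tend to 0. Convergence in the gauge makes the
  uniform bound e available eventually.\<close>

lemma action_lsc:
  fixes w :: "real \<Rightarrow> real ^ 'd::finite" and L :: "'d phase \<times> real \<Rightarrow> real"
  assumes ab: "a < b" and p: "1 < p" and \<alpha>: "0 < \<alpha>" "\<alpha> < 1" and w: "w \<in> W1p a b p"
    and C1: "C1_on (UNIV \<times> {a..b}) L" and reg: "regular a b p \<alpha> L"
    and conv: "\<And>t. t \<in> {a..b} \<Longrightarrow> convex_on UNIV (\<lambda>x. L (x, t))"
    and y: "\<And>n. y n \<in> W1p a b p" "(\<lambda>n. W1p_gauge a b p (y n) w) \<longlonglongrightarrow> 0" "\<And>n. action a b \<alpha> L (y n) \<le> r"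
  shows "action a b \<alpha> L w \<le> r"
proof -
  obtain A1 A2 A3 where A: "\<And>u e c. u \<in> W1p a b p \<Longrightarrow> \<forall>t\<in>{a..b}. norm (u t - w t) \<le> e \<Longrightarrow> 0 < c \<Longrightarrow>
    action a b \<alpha> L w \<le> action a b \<alpha> L u + e * A1 + c * A2 + c powr (1 - p) * (A3 * W1p_gauge a b p u w)"
    by (rule action_lower_bound[OF ab p \<alpha> w C1 reg conv]) (assumption, rule that)
  have e: "action a b \<alpha> L w \<le> r + e * A1 + e * A2" if "0 < e" for e
  proof -
    obtain \<delta> where \<delta>: "0 < \<delta>" "\<And>u v :: real \<Rightarrow> real ^ 'd. u \<in> W1p a b p \<Longrightarrow> v \<in> W1p a b p \<Longrightarrow>
        W1p_gauge a b p u v < \<delta> \<Longrightarrow> \<forall>t\<in>{a..b}. norm (u t - v t) < e"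
      by (rule W1p_gauge_sup[OF p ab \<open>0 < e\<close>]) (rule that)
    have "\<forall>\<^sub>F n in sequentially. W1p_gauge a b p (y n) w < \<delta>"
      using order_tendstoD(2)[OF y(2) \<delta>(1)] .
    hence "\<forall>\<^sub>F n in sequentially. action a b \<alpha> L w \<le>
        r + e * A1 + e * A2 + e powr (1 - p) * (A3 * W1p_gauge a b p (y n) w)"
    proof eventually_elim
      fix n assume "W1p_gauge a b p (y n) w < \<delta>"
      hence "\<forall>t\<in>{a..b}. norm (y n t - w t) < e" by (rule \<delta>(2)[OF y(1) w])
      hence "action a b \<alpha> L w \<le> action a b \<alpha> L (y n) + e * A1 + e * A2 +
          e powr (1 - p) * (A3 * W1p_gauge a b p (y n) w)"
        by (intro A[OF y(1)] \<open>0 < e\<close>) (auto intro: less_imp_le)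
      thus "action a b \<alpha> L w \<le> r + e * A1 + e * A2 + e powr (1 - p) * (A3 * W1p_gauge a b p (y n) w)"
        using y(3)[of n] by linarith
    qed
    moreover have "(\<lambda>n. r + e * A1 + e * A2 + e powr (1 - p) * (A3 * W1p_gauge a b p (y n) w)) \<longlonglongrightarrow>
        r + e * A1 + e * A2 + e powr (1 - p) * (A3 * 0)"
      by (intro tendsto_intros y(2))
    ultimately show ?thesis using tendsto_lowerbound[of _ _ sequentially] by force
  qed
  have "((\<lambda>e. r + e * A1 + e * A2) \<longlongrightarrow> r + 0 * A1 + 0 * A2) (at_right 0)"
    by (intro tendsto_intros)
  moreover have "\<forall>\<^sub>F e in at_right 0. action a b \<alpha> L w \<le> r + e * A1 + e * A2"
    using e by (simp add: eventually_at_right_less eventually_mono[OF eventually_at_right_less])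
  ultimately have "action a b \<alpha> L w \<le> r + 0 * A1 + 0 * A2"
    by (rule tendsto_lowerbound) simp
  thus ?thesis by simp
qed

section \<open>Weak compactness and existence of a minimizer\<close>

text \<open>The tuples of all values \<open>\<Phi> x\<close> lie in a product of compact intervals.
  Pulling back the neighbourhoods of a cluster point \<open>l\<close> makes every coordinate
  converge.\<close>

lemma bounded_imp_convergent_subfilter:
  fixes F0 :: "'x filter" and T :: "('x \<Rightarrow> real) set"
  assumes F0: "F0 \<noteq> bot" "eventually (\<lambda>x. x \<in> S) F0"
    and T: "\<And>\<Phi>. \<Phi> \<in> T \<Longrightarrow> \<exists>C. \<forall>x\<in>S. \<bar>\<Phi> x\<bar> \<le> C"
  obtains F where "F \<noteq> bot" "F \<le> F0" "\<And>\<Phi>. \<Phi> \<in> T \<Longrightarrow> \<exists>l. (\<Phi> \<longlongrightarrow> l) F"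
proof -
  obtain C where C: "\<And>\<Phi> x. \<Phi> \<in> T \<Longrightarrow> x \<in> S \<Longrightarrow> \<bar>\<Phi> x\<bar> \<le> C \<Phi>"
    using T by metis
  define K where "K = (\<Pi>\<^sub>E \<Phi>\<in>(UNIV :: ('x \<Rightarrow> real) set). {- \<bar>C \<Phi>\<bar>..\<bar>C \<Phi>\<bar>})"
  \<comment> \<open>Coordinates outside \<open>T\<close> are set to 0, which lies in every interval
    because the bounds are taken as plus and minus \<bar>C \<Phi>\<bar>.\<close>
  define ev where "ev x = (\<lambda>\<Phi>. if \<Phi> \<in> T then \<Phi> x else (0::real))" for x :: 'x
  have "compactin (product_topology (\<lambda>_. euclidean) UNIV) K"
    unfolding K_def compactin_PiE by simp
  hence "compact K" by (simp add: euclidean_product_topology)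
  moreover have "filtermap ev F0 \<noteq> bot" using F0 by (simp add: filtermap_bot_iff)
  moreover have "eventually (\<lambda>y. y \<in> K) (filtermap ev F0)"
    unfolding eventually_filtermap using F0(2)
  proof eventually_elim
    fix x assume "x \<in> S"
    hence "ev x \<Phi> \<in> {- \<bar>C \<Phi>\<bar>..\<bar>C \<Phi>\<bar>}" for \<Phi>
      using C[of \<Phi> x] by (auto simp: ev_def abs_le_iff)
    thus "ev x \<in> K" by (auto simp: K_def)
  qed
  ultimately obtain l where l: "inf (nhds l) (filtermap ev F0) \<noteq> bot"
    unfolding compact_filter by blast
  define F where "F = inf F0 (filtercomap ev (nhds l))"
  show ?thesis
  proof (rule that)
    show "F \<noteq> bot"
    proof
      assume "F = bot"
      hence "eventually (\<lambda>_. False) F" by simp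
      then obtain P Q where PQ: "eventually P F0" "eventually Q (filtercomap ev (nhds l))" "\<And>x. P x \<and> Q x \<Longrightarrow> False"
        unfolding F_def eventually_inf by blast
      obtain R where R: "eventually R (nhds l)" "\<And>x. R (ev x) \<Longrightarrow> Q x"
        using PQ(2) unfolding eventually_filtercomap by blast
      \<comment> \<open>If the refinement were trivial, the image filter would avoid a neighbourhood
        of \<open>l\<close>, so \<open>l\<close> would not be a cluster point.\<close>
      have "eventually (\<lambda>y. \<not> R y) (filtermap ev F0)"
        unfolding eventually_filtermap using PQ(1) by eventually_elim (use PQ(3) R(2) in blast)
      hence "eventually (\<lambda>_. False) (inf (nhds l) (filtermap ev F0))"
        using R(1) unfolding eventually_inf by blast
      thus False using l by (simp add: eventually_False)
    qed
    show "F \<le> F0" by (simp add: F_def)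
    fix \<Phi> assume \<Phi>: "\<Phi> \<in> T"
    have "filterlim ev (nhds l) F"
      unfolding F_def by (rule filterlim_mono[OF filterlim_filtercomap order_refl]) simp
    moreover have "continuous_on UNIV (\<lambda>y :: ('x \<Rightarrow> real) \<Rightarrow> real. y \<Phi>)"
      by (rule continuous_on_product_coordinates)
    hence "((\<lambda>y. y \<Phi>) \<longlongrightarrow> l \<Phi>) (at l)" by (simp add: continuous_on_def)
    hence "filterlim (\<lambda>y. y \<Phi>) (nhds (l \<Phi>)) (nhds l)"
      using tendsto_at_iff_tendsto_nhds[of "\<lambda>y. y \<Phi>" l] by simp
    ultimately have "((\<lambda>x. ev x \<Phi>) \<longlongrightarrow> l \<Phi>) F" by (rule filterlim_compose[rotated])
    moreover have "(\<lambda>x. ev x \<Phi>) = \<Phi>" using \<Phi> by (simp add: ev_def)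
    ultimately show "\<exists>l. (\<Phi> \<longlongrightarrow> l) F" by auto
  qed
qed

section \<open>Norm, energy and bounded functionals\<close>

lemma Lp_norm_eq: "Lp_norm a b p f = powr_int a b p f powr (1 / p)"
  by (simp add: Lp_norm_def powr_int_def)

lemma W1p_norm_nonneg: "0 \<le> W1p_norm a b p u"
  by (simp add: W1p_norm_def Lp_norm_eq)

lemma W1p_energy_le:
  assumes "0 < p" "W1p_norm a b p u \<le> R"
  shows "W1p_energy a b p u \<le> 2 * R powr p"
proof -
  have le: "powr_int a b p f \<le> R powr p" if "Lp_norm a b p f \<le> R" for f :: "real \<Rightarrow> 'a"
  proof -
    have "(powr_int a b p f powr (1 / p)) powr p \<le> R powr p"
      using that assms by (intro powr_mono2) (auto simp: Lp_norm_eq)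
    thus ?thesis using powr_int_nonneg[of a b p f] assms by (simp add: powr_powr)
  qed
  have "0 \<le> Lp_norm a b p u" "0 \<le> Lp_norm a b p (weak_deriv a b u)" by (simp_all add: Lp_norm_eq)
  hence "Lp_norm a b p u \<le> R" "Lp_norm a b p (weak_deriv a b u) \<le> R"
    using assms(2) by (auto simp: W1p_norm_def)
  thus ?thesis using le[of u] le[of "weak_deriv a b u"] by (simp add: W1p_energy_def)
qed

lemma W1p_norm_le:
  assumes "0 < p"
  shows "W1p_norm a b p u \<le> 2 * W1p_energy a b p u powr (1 / p)"
proof -
  have "Lp_norm a b p u \<le> W1p_energy a b p u powr (1 / p)"
    "Lp_norm a b p (weak_deriv a b u) \<le> W1p_energy a b p u powr (1 / p)"
    using assms unfolding Lp_norm_eq W1p_energy_def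
    by (auto intro!: powr_mono2 simp: powr_int_nonneg)
  thus ?thesis by (simp add: W1p_norm_def)
qed

lemma W1p_dual_midpoint:
  assumes \<Phi>: "\<Phi> \<in> W1p_dual a b p" and u: "u \<in> W1p a b p" and v: "v \<in> W1p a b p" and p: "1 < p"
  shows "\<Phi> (midpoint_fun u v) = (\<Phi> u + \<Phi> v) / 2"
proof -
  have s: "(\<lambda>t. u t + v t) \<in> W1p a b p" using W1p_lincomb(1)[OF u v p, of 1 1] by simp
  have "\<Phi> (midpoint_fun u v) = (1/2) * \<Phi> (\<lambda>t. u t + v t)"
    using \<Phi> s by (simp add: W1p_dual_def midpoint_fun_def del: scaleR_add_right)
  also have "\<Phi> (\<lambda>t. u t + v t) = \<Phi> u + \<Phi> v"
    using \<Phi> u v by (simp add: W1p_dual_def)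
  finally show ?thesis by simp
qed

text \<open>The bound in the definition of the dual, applied to y n - w, is a multiple of the p-th
  root of the gauge.\<close>

lemma W1p_dual_tendsto:
  fixes w :: "real \<Rightarrow> 'v::euclidean_space"
  assumes \<Phi>: "\<Phi> \<in> W1p_dual a b p" and y: "\<And>n. y n \<in> W1p a b p" and w: "w \<in> W1p a b p" and p: "1 < p"
    and lim: "(\<lambda>n. W1p_gauge a b p (y n) w) \<longlonglongrightarrow> 0"
  shows "(\<lambda>n. \<Phi> (y n)) \<longlonglongrightarrow> \<Phi> w"
proof -
  have add: "\<Phi> (\<lambda>t. u t + v t) = \<Phi> u + \<Phi> v" if "u \<in> W1p a b p" "v \<in> W1p a b p" for u v
    using \<Phi> that by (simp add: W1p_dual_def)
  have scale: "\<Phi> (\<lambda>t. c *\<^sub>R u t) = c * \<Phi> u" if "u \<in> W1p a b p" for u c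
    using \<Phi> that by (simp add: W1p_dual_def)
  obtain C where C: "\<And>u. u \<in> W1p a b p \<Longrightarrow> \<bar>\<Phi> u\<bar> \<le> C * W1p_norm a b p u"
    using \<Phi> unfolding W1p_dual_def mem_Collect_eq by blast
  have neg: "(\<lambda>t. (-1) *\<^sub>R w t) \<in> W1p a b p" using W1p_lincomb(1)[OF w w p, of "-1" 0] by simp
  have diff: "\<Phi> (\<lambda>t. y n t - w t) = \<Phi> (y n) - \<Phi> w" for n
    using add[OF y neg, of n] scale[OF w, of "-1"] by simp
  have le: "norm (\<Phi> (y n) - \<Phi> w) \<le> \<bar>C\<bar> * (2 * W1p_gauge a b p (y n) w powr (1 / p))" for n
  proof -
    have "\<bar>\<Phi> (y n) - \<Phi> w\<bar> \<le> C * W1p_norm a b p (\<lambda>t. y n t - w t)"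
      using C[OF W1p_diff(1)[OF y w p], of n] diff by simp
    also have "\<dots> \<le> \<bar>C\<bar> * W1p_norm a b p (\<lambda>t. y n t - w t)"
      by (intro mult_right_mono W1p_norm_nonneg) simp
    also have "\<dots> \<le> \<bar>C\<bar> * (2 * W1p_energy a b p (\<lambda>t. y n t - w t) powr (1 / p))"
      using p by (intro mult_left_mono W1p_norm_le) auto
    finally show ?thesis by (simp add: W1p_energy_diff[OF y w p])
  qed
  have "(\<lambda>n. W1p_gauge a b p (y n) w powr (1 / p)) \<longlonglongrightarrow> 0 powr (1 / p)"
    by (rule tendsto_powr2[OF lim tendsto_const always_eventually]) (use p in \<open>simp_all add: W1p_gauge_nonneg\<close>)
  hence "(\<lambda>n. 2 * W1p_gauge a b p (y n) w powr (1 / p)) \<longlonglongrightarrow> 0"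
    using tendsto_mult_right_zero by fastforce
  from tendsto_mult_right_zero[OF this, of "\<bar>C\<bar>"]
  have "(\<lambda>n. \<Phi> (y n) - \<Phi> w) \<longlonglongrightarrow> 0"
    by (rule Lim_null_comparison[OF always_eventually, rotated]) (use le in blast)
  thus ?thesis by (simp add: LIM_zero_iff)
qed

text \<open>This takes the place of both the reflexivity of \<open>W\<^sup>1\<^sup>,\<^sup>p\<close> and Mazur's lemma.\<close>

proposition W1p_bounded_weak_cluster:
  fixes F0 :: "(real \<Rightarrow> 'v::euclidean_space) filter"
  assumes ab: "a < b" and p: "1 < p" and F0: "F0 \<noteq> bot"
    and bdd: "eventually (\<lambda>u. u \<in> W1p a b p \<and> W1p_norm a b p u \<le> R) F0"
  obtains F w where "F \<noteq> bot" "F \<le> F0" "w \<in> W1p a b p"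
    "\<And>\<Phi>. \<Phi> \<in> W1p_dual a b p \<Longrightarrow> (\<Phi> \<longlongrightarrow> \<Phi> w) F"
    "\<And>A. eventually (\<lambda>u. u \<in> A) F \<Longrightarrow> \<exists>y :: nat \<Rightarrow> real \<Rightarrow> 'v.
       (\<forall>n. y n \<in> mid_hull midpoint_fun (A \<inter> W1p a b p)) \<and> (\<lambda>n. W1p_gauge a b p (y n) w) \<longlonglongrightarrow> 0"
proof -
  define S :: "(real \<Rightarrow> 'v) set" where "S = {u \<in> W1p a b p. W1p_norm a b p u \<le> R}"
  have S: "eventually (\<lambda>u. u \<in> S) F0" using bdd by (simp add: S_def)
  have "\<exists>C. \<forall>u\<in>S. \<bar>\<Phi> u\<bar> \<le> C" if \<Phi>: "\<Phi> \<in> W1p_dual a b p" for \<Phi> :: "(real \<Rightarrow> 'v) \<Rightarrow> real"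
  proof -
    obtain C where C: "\<And>u. u \<in> W1p a b p \<Longrightarrow> \<bar>\<Phi> u\<bar> \<le> C * W1p_norm a b p u"
      using \<Phi> unfolding W1p_dual_def mem_Collect_eq by blast
    have "\<bar>\<Phi> u\<bar> \<le> \<bar>C\<bar> * R" if "u \<in> S" for u
    proof -
      have "\<bar>\<Phi> u\<bar> \<le> C * W1p_norm a b p u" using C that by (simp add: S_def)
      also have "\<dots> \<le> \<bar>C\<bar> * W1p_norm a b p u" by (intro mult_right_mono W1p_norm_nonneg) simp
      also have "\<dots> \<le> \<bar>C\<bar> * R" using that by (intro mult_left_mono) (auto simp: S_def)
      finally show ?thesis .
    qed
    thus ?thesis by blast
  qed
  then obtain F where F: "F \<noteq> bot" "F \<le> F0" "\<And>\<Phi>. \<Phi> \<in> W1p_dual a b p \<Longrightarrow> \<exists>l. (\<Phi> \<longlongrightarrow> l) F"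
    by (rule bounded_imp_convergent_subfilter[OF F0 S]) (assumption, rule that)
  have SF: "eventually (\<lambda>u. u \<in> S) F" by (rule filter_leD[OF F(2) S])
  have en: "eventually (\<lambda>u. u \<in> W1p a b p \<and> W1p_energy a b p u \<le> 2 * R powr p) F"
    using SF by eventually_elim (use p in \<open>auto simp: S_def intro!: W1p_energy_le\<close>)
  have conv: "\<exists>\<delta>>0. \<forall>u\<in>W1p a b p. \<forall>v :: real \<Rightarrow> 'v\<in>W1p a b p. W1p_energy a b p u \<le> R' \<longrightarrow> W1p_energy a b p v \<le> R' \<longrightarrow>
      (W1p_energy a b p u + W1p_energy a b p v) / 2 - W1p_energy a b p (midpoint_fun u v) < \<delta> \<longrightarrow>
      W1p_gauge a b p u v < e" if "0 < e" for e R'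
    by (rule W1p_uniform_convexity[OF p that, of a b R']) blast
  have compl: "\<exists>z\<in>W1p a b p. (\<lambda>n. W1p_gauge a b p (w n) z) \<longlonglongrightarrow> 0"
    if "\<And>n. w n \<in> W1p a b p" "\<And>e. 0 < e \<Longrightarrow> \<exists>n0. \<forall>m\<ge>n0. \<forall>n\<ge>n0. W1p_gauge a b p (w m) (w n) < e"
    for w :: "nat \<Rightarrow> real \<Rightarrow> 'v"
    using W1p_complete[OF p ab that] by blast
  obtain w where w: "w \<in> W1p a b p" "\<And>A. eventually (\<lambda>u. u \<in> A) F \<Longrightarrow> \<exists>y :: nat \<Rightarrow> real \<Rightarrow> 'v.
       (\<forall>n. y n \<in> mid_hull midpoint_fun (A \<inter> W1p a b p)) \<and> (\<lambda>n. W1p_gauge a b p (y n) w) \<longlonglongrightarrow> 0"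
    by (rule uniformly_convex_cluster[where X = "W1p a b p" and mid = midpoint_fun and N = "W1p_energy a b p"
          and D = "W1p_gauge a b p" and K = "2 powr p" and F = F and R = "2 * R powr p",
          OF W1p_midpoint(1)[OF _ _ p] W1p_energy_nonneg W1p_gauge_nonneg W1p_gauge_triangle[OF _ _ _ p]
          conv compl F(1) en]) (assumption+, rule that)
  have "(\<Phi> \<longlongrightarrow> \<Phi> w) F" if \<Phi>: "\<Phi> \<in> W1p_dual a b p" for \<Phi>
  proof -
    obtain l where l: "(\<Phi> \<longlongrightarrow> l) F" using F(3)[OF \<Phi>] by blast
    have "\<bar>\<Phi> w - l\<bar> \<le> e" if e: "0 < e" for e
    proof -
      \<comment> \<open>This strip is closed under midpoints, so the hull stays in it; strong
        continuity of \<Phi> then puts \<open>w\<close> into it as well.\<close>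
      define A where "A = {u. \<bar>\<Phi> u - l\<bar> \<le> e}"
      have "eventually (\<lambda>u. u \<in> A) F"
        using tendstoD[OF l e] by eventually_elim (auto simp: A_def dist_real_def)
      then obtain y where y: "\<And>n. y n \<in> mid_hull midpoint_fun (A \<inter> W1p a b p)"
        "(\<lambda>n. W1p_gauge a b p (y n) w) \<longlonglongrightarrow> 0" using w(2) by blast
      have "mid_hull midpoint_fun (A \<inter> W1p a b p) \<subseteq> A \<inter> W1p a b p"
      proof (rule mid_hull_least)
        fix u v assume uv: "u \<in> A \<inter> W1p a b p" "v \<in> A \<inter> W1p a b p"
        hence "\<bar>(\<Phi> u + \<Phi> v) / 2 - l\<bar> \<le> e" by (auto simp: A_def abs_le_iff field_simps)
        moreover have "\<Phi> (midpoint_fun u v) = (\<Phi> u + \<Phi> v) / 2" "midpoint_fun u v \<in> W1p a b p"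
          using uv by (intro W1p_dual_midpoint[OF \<Phi> _ _ p] W1p_midpoint(1)[OF _ _ p]; simp)+
        ultimately show "midpoint_fun u v \<in> A \<inter> W1p a b p" by (simp only: A_def Int_iff mem_Collect_eq)
      qed simp
      hence y': "y n \<in> A" "y n \<in> W1p a b p" for n using y(1) by auto
      have "(\<lambda>n. \<bar>\<Phi> (y n) - l\<bar>) \<longlonglongrightarrow> \<bar>\<Phi> w - l\<bar>"
        by (intro tendsto_intros W1p_dual_tendsto[OF \<Phi> y'(2) w(1) p y(2)])
      thus ?thesis by (rule LIMSEQ_le_const2) (use y'(1) in \<open>auto simp: A_def\<close>)
    qed
    hence "\<bar>\<Phi> w - l\<bar> \<le> 0" by (rule field_le_epsilon[where y = 0, simplified])
    thus ?thesis using l by simp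
  qed
  thus ?thesis using that F(1,2) w by blast
qed

text \<open>Convergence of all functionals concerns the subbase only; induction over the generation
  of open sets extends it to every open set around \<open>w\<close>, and the complement of
  \<open>E\<close> would be one of them.\<close>

lemma weak_limit_in_closed:
  fixes E :: "(real \<Rightarrow> 'v::euclidean_space) set"
  assumes E: "closedin (W1p_weak_topology a b p) E" and F: "F \<noteq> bot" "eventually (\<lambda>u. u \<in> E) F"
    and w: "w \<in> W1p a b p" and lim: "\<And>\<Phi>. \<Phi> \<in> W1p_dual a b p \<Longrightarrow> (\<Phi> \<longlongrightarrow> \<Phi> w) F"
  shows "w \<in> E"
proof (rule ccontr)
  assume nE: "w \<notin> E"
  define \<S> :: "(real \<Rightarrow> 'v) set set" where "\<S> = {{u \<in> W1p a b p. \<Phi> u \<in> U} | \<Phi> U. \<Phi> \<in> W1p_dual a b p \<and> open U}"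
  have top: "W1p_weak_topology a b p = topology_generated_by \<S>"
    by (simp add: W1p_weak_topology_def \<S>_def)
  \<comment> \<open>The zero functional with the full line as target shows that the whole of
    \<open>W1p\<close> is a subbasic set, so it is the underlying space of the topology.\<close>
  have zero: "(\<lambda>_. 0) \<in> W1p_dual a b p" by (auto simp: W1p_dual_def intro!: exI[of _ 0])
  hence "{u \<in> W1p a b p. (\<lambda>_. 0 :: real) u \<in> UNIV} \<in> \<S>" unfolding \<S>_def by blast
  hence ts: "topspace (topology_generated_by \<S>) = W1p a b p" by (auto simp: \<S>_def)
  have EW: "E \<subseteq> W1p a b p" using closedin_subset[OF E] unfolding top ts .
  have ev: "eventually (\<lambda>u. u \<in> S) F" if "generate_topology_on \<S> S" "w \<in> S" for S
    using that
  proof (induction rule: generate_topology_on.induct)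
    case (Int S S') thus ?case by (simp add: eventually_conj)
  next
    case (UN K)
    then obtain k where "k \<in> K" "w \<in> k" by blast
    with UN.IH[of k] show ?case by (auto elim: eventually_mono)
  next
    case (Basis S)
    then obtain \<Phi> U where S: "S = {u \<in> W1p a b p. \<Phi> u \<in> U}" "\<Phi> \<in> W1p_dual a b p" "open U"
      by (auto simp: \<S>_def)
    have "eventually (\<lambda>u. \<Phi> u \<in> U) F"
      using topological_tendstoD[OF lim[OF S(2)] S(3)] Basis.prems S(1) by simp
    \<comment> \<open>Subbasic sets also ask for membership in \<open>W1p\<close>, which comes from
      \<open>E\<close>.\<close>
    thus ?case using F(2) by eventually_elim (use EW S(1) in auto)
  qed simp
  have "openin (topology_generated_by \<S>) (W1p a b p - E)"
    using E unfolding closedin_def top ts by simp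
  from ev[OF openin_topology_generated_by[OF this]]
  have "eventually (\<lambda>u. u \<in> W1p a b p - E) F" using w nE by blast
  hence "eventually (\<lambda>_. False) F" using F(2) by eventually_elim simp
  thus False using F(1) by (simp add: eventually_False)
qed

theorem theorem3p3:
  fixes a b p \<alpha> :: real
    and E :: "(real \<Rightarrow> real ^ 'd::finite) set"
    and L :: "'d phase \<times> real \<Rightarrow> real"
  assumes "a < b" and "1 < p" and "0 < \<alpha>" and "\<alpha> < 1"
    and "closedin (W1p_weak_topology a b p) E" and "E \<noteq> {}"
    and "C1_on (UNIV \<times> {a..b}) L"
    and "regular a b p \<alpha> L"
    and "coercive_on a b p E (action a b \<alpha> L)"
    and "\<And>t. t \<in> {a..b} \<Longrightarrow> convex_on UNIV (\<lambda>x. L (x, t))"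
  shows "\<exists>ubar\<in>E. \<forall>u\<in>E. action a b \<alpha> L ubar \<le> action a b \<alpha> L u"
proof -
  note ab = assms(1) and p = assms(2) and \<alpha> = assms(3,4) and reg = assms(8) and conv = assms(10)
  let ?J = "action a b \<alpha> L"
  have EW: "E \<subseteq> W1p a b p"
    using closedin_subset[OF assms(5)] by (auto simp: W1p_weak_topology_def)
  define sub where "sub u = {v \<in> E. ?J v \<le> ?J u}" for u
  define F0 where "F0 = (INF u\<in>E. principal (sub u))"
  have F0: "eventually P F0 \<longleftrightarrow> (\<exists>u\<in>E. \<forall>v\<in>sub u. P v)" for P
  proof -
    \<comment> \<open>Sublevel sets are totally ordered by inclusion, so the infimum of their
      principal filters is directed and has them as a base.\<close>
    have "\<exists>w\<in>E. principal (sub w) \<le> inf (principal (sub u)) (principal (sub v))" if "u \<in> E" "v \<in> E" for u v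
      by (rule bexI[of _ "if ?J u \<le> ?J v then u else v"]) (use that in \<open>auto simp: sub_def\<close>)
    thus ?thesis unfolding F0_def
      by (subst eventually_INF_base) (use assms(6) in \<open>auto simp: eventually_principal\<close>)
  qed
  have F0_bot: "F0 \<noteq> bot"
  proof
    assume "F0 = bot"
    hence "eventually (\<lambda>_. False) F0" by simp
    thus False unfolding F0 by (auto simp: sub_def)
  qed
  obtain u0 where u0: "u0 \<in> E" using assms(6) by blast
  \<comment> \<open>The added 1 turns the bound of coercivity into a contradiction with membership
    in \<open>sub u0\<close>, which therefore lies in the ball of radius R.\<close>
  have "eventually (\<lambda>u. ?J u0 + 1 \<le> ?J u) (inf (filtercomap (W1p_norm a b p) at_top) (principal E))"
    using assms(9) unfolding coercive_on_def filterlim_at_top by blast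
  then obtain R where R: "\<And>u. R \<le> W1p_norm a b p u \<Longrightarrow> u \<in> E \<Longrightarrow> ?J u0 + 1 \<le> ?J u"
    unfolding eventually_inf_principal eventually_filtercomap_at_top_linorder by blast
  have bdd: "eventually (\<lambda>u. u \<in> W1p a b p \<and> W1p_norm a b p u \<le> R) F0"
    unfolding F0 using u0 EW R by (intro bexI[of _ u0]) (force simp: sub_def)+
  obtain F w where F: "F \<noteq> bot" "F \<le> F0" and w: "w \<in> W1p a b p"
    and lim: "\<And>\<Phi>. \<Phi> \<in> W1p_dual a b p \<Longrightarrow> (\<Phi> \<longlongrightarrow> \<Phi> w) F"
    and hull: "\<And>A. eventually (\<lambda>u. u \<in> A) F \<Longrightarrow> \<exists>y :: nat \<Rightarrow> real \<Rightarrow> real ^ 'd.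
       (\<forall>n. y n \<in> mid_hull midpoint_fun (A \<inter> W1p a b p)) \<and> (\<lambda>n. W1p_gauge a b p (y n) w) \<longlonglongrightarrow> 0"
    by (rule W1p_bounded_weak_cluster[OF ab p F0_bot bdd]) (rule that)
  have evsub: "eventually (\<lambda>v. v \<in> sub u) F" if "u \<in> E" for u
    by (rule filter_leD[OF F(2)]) (use that F0 in blast)
  have "w \<in> E"
  proof (rule weak_limit_in_closed[OF assms(5) F(1) _ w lim])
    show "eventually (\<lambda>u. u \<in> E) F" using evsub[OF u0] by eventually_elim (simp add: sub_def)
  qed
  moreover have "?J w \<le> ?J u" if u: "u \<in> E" for u
  proof -
    obtain y where y: "\<And>n. y n \<in> mid_hull midpoint_fun (sub u \<inter> W1p a b p)"
      "(\<lambda>n. W1p_gauge a b p (y n) w) \<longlonglongrightarrow> 0" using hull[OF evsub[OF u]] by blast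
    \<comment> \<open>The hull is compared with a sublevel set in all of \<open>W1p\<close>, since
      midpoints need not stay in \<open>E\<close>.\<close>
    have "mid_hull midpoint_fun (sub u \<inter> W1p a b p) \<subseteq> {v \<in> W1p a b p. ?J v \<le> ?J u}"
    proof (rule mid_hull_least)
      fix v v' assume v: "v \<in> {v \<in> W1p a b p. ?J v \<le> ?J u}" "v' \<in> {v \<in> W1p a b p. ?J v \<le> ?J u}"
      have "?J (midpoint_fun v v') \<le> (?J v + ?J v') / 2"
        by (rule action_midpoint[OF _ _ p \<alpha> reg conv]) (use v in auto)
      thus "midpoint_fun v v' \<in> {v \<in> W1p a b p. ?J v \<le> ?J u}"
        using v W1p_midpoint(1)[OF _ _ p] by auto
    qed (auto simp: sub_def)
    hence "y n \<in> W1p a b p" "?J (y n) \<le> ?J u" for n using y(1) by auto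
    thus ?thesis by (intro action_lsc[OF ab p \<alpha> w assms(7) reg conv _ y(2)])
  qed
  ultimately show ?thesis by blast
qed

end
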